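(* Let $U$ be a layer-unique multiplication-invariant potential on $\Omega=\{-1,1\}^{\mathbb N}$ and $\mu^U_\infty$ its unique Gibbs measure. For any local function $f:\Omega\to\mathbb R$, the limit $$\mathcal P^M(f|\mu^U_\infty)=\lim_{N\to\infty}\frac1N\log\mathbb E_{\mu^U_\infty}\Big(e^{\sum_{i=1}^NT_if}\Big)$$ exists, and, under $\mu^U_\infty$, the sequence $\big(\frac1N\sum_{i=1}^NT_if\big)_N$ satisfies the large deviation principle (with speed $N$) with rate function $$I_f(x)=\sup_{t\in\mathbb R}\big(tx-\mathcal P^M(tf|\mu_\infty^U)\big).$$ As a consequence, under $\mu^U_\infty$ the sequence of random probability measures $\big(\frac1N\sum_{i=1}^N\delta_{T_i\sigma}\big)_N$ on $\Omega$ satisfies the large deviation principle (with speed $N$) in the weak topology with rate function $$\mathcal I(\lambda|\mu^U_\infty)=\sup_{f\ \mathrm{local}}\Big(\int f\,d\lambda-\mathcal P^M(f|\mu^U_\infty)\Big),$$ for $\lambda$ a probability measure on $\Omega$.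
   Context: $\mathbb N=\{1,2,\ldots\}$, $\mathbb N_0=\mathbb N\cup\{0\}$. Multiplicative shift: $(T_i\sigma)_j=\sigma_{ij}$, $T_if(\sigma)=f(T_i\sigma)$. A function $f:\Omega\to\mathbb R$ is local if it depends on only finitely many coordinates. A potential is a function $U(A,\sigma)$ of finite subsets $A\subset\mathbb N$ and $\sigma\in\Omega$ such that $U(A,\sigma)$ depends only on $\sigma_A$ and $\sum_{A\ni i}\max_{\sigma_A}|U(A,\sigma)|<\infty$ for all $i\in\mathbb N$. It is multiplication invariant if $U(iA,\sigma)=U(A,T_i\sigma)$ for all finite $A\subset\mathbb N$, $\sigma\in\Omega$, $i\in\mathbb N$. All multiplication-invariant potentials considered are of the following form: there is a collection $\mathcal A$ of finite subsets of $\mathbb N$ and reals $J_A$, $A\in\mathcal A$, such that $U(iA,\sigma)=J_A\prod_{j\in A}(T_i\sigma)_j$ for $i\in\mathbb N$, $A\in\mathcal A$, and $U(B,\sigma)=0$ if $B$ is not of the form $iA$ (the sets $iA$ being pairwise distinct, so that this is well defined). The set $\{p_1<\cdots<p_d\}$ of primes appearing in the factorizations of the elements of $\bigcup_{A\in\mathcal A}A$ is assumed finite, $d\ge1$. The associated shift-invariant potential $V$ on $\Omega_{0,d}=\{-1,1\}^{(\mathbb N_0)^d}$: for $A\in\mathcal A$ let $A'=\{x\in(\mathbb N_0)^d:\prod_kp_k^{x_k}\in A\}$; then $V(A'+y,\tau)=J_A\prod_{x\in A'}\tau_{x+y}$ for $y\in(\mathbb N_0)^d$, and $V(B,\tau)=0$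 for other finite $B$. $U$ is layer unique if $V$ has exactly one Gibbs measure $\mu^V_\infty$ on $\Omega_{0,d}$. A Gibbs measure for a potential $W$ is a probability measure such that for every finite set $\Lambda$ of sites the conditional distribution of the spins in $\Lambda$ given the configuration $\eta$ outside is proportional to $\exp(-\sum_{A\cap\Lambda\neq\emptyset}W(A,\sigma_\Lambda\eta_{\Lambda^c}))$. If $U$ is layer unique it has a unique Gibbs measure $\mu^U_\infty$ on $\Omega$; under it the configurations $\tau^r\in\Omega_{0,d}$, $\tau^r_x=\sigma_{r\prod_kp_k^{x_k}}$, for $r\in\mathbb N$ divisible by none of the $p_k$, are i.i.d. with law $\mu_\infty^V$. *)

theory Defs
  imports "HOL-Probability.Probability" "HOL-Computational_Algebra.Primes"
begin

text \<open>Configurations on a set \<open>S\<close> of sites are the elements of \<open>S \<rightarrow>\<^sub>E {-1, 1}\<close>. The site set is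
  a carrier set, so that the positive integers and the orthants \<open>(N\<^sub>0)^d\<close> (with \<open>d\<close> depending on
  the potential) are treated uniformly.\<close>

abbreviation spin_configs :: "'s set \<Rightarrow> ('s \<Rightarrow> real) set" where
  "spin_configs S \<equiv> S \<rightarrow>\<^sub>E {-1, 1}"

definition spin_algebra :: "'s set \<Rightarrow> ('s \<Rightarrow> real) measure" where
  "spin_algebra S = PiM S (\<lambda>_. count_space {-1, 1})"

definition spin_topology :: "'s set \<Rightarrow> ('s \<Rightarrow> real) topology" where
  "spin_topology S = product_topology (\<lambda>_. discrete_topology {-1, 1}) S"

subsection \<open>Potentials and Gibbs measures\<close>

definition potential :: "'s set \<Rightarrow> ('s set \<Rightarrow> ('s \<Rightarrow> real) \<Rightarrow> real) \<Rightarrow> bool" where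
  "potential S W \<longleftrightarrow>
     (\<forall>A \<sigma> \<tau>. finite A \<and> A \<subseteq> S \<and> \<sigma> \<in> spin_configs S \<and> \<tau> \<in> spin_configs S \<and>
        (\<forall>j\<in>A. \<sigma> j = \<tau> j) \<longrightarrow> W A \<sigma> = W A \<tau>) \<and>
     (\<forall>i\<in>S. (\<lambda>A. Max ((\<lambda>\<sigma>. \<bar>W A \<sigma>\<bar>) ` spin_configs S))
        summable_on {A. finite A \<and> A \<subseteq> S \<and> i \<in> A})"

definition hamiltonian ::
    "'s set \<Rightarrow> ('s set \<Rightarrow> ('s \<Rightarrow> real) \<Rightarrow> real) \<Rightarrow> 's set \<Rightarrow> ('s \<Rightarrow> real) \<Rightarrow> real" where
  "hamiltonian S W \<Lambda> \<sigma> = (\<Sum>\<^sub>\<infinity>A | finite A \<and> A \<subseteq> S \<and> A \<inter> \<Lambda> \<noteq> {}. W A \<sigma>)"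

definition gibbs_weight ::
    "'s set \<Rightarrow> ('s set \<Rightarrow> ('s \<Rightarrow> real) \<Rightarrow> real) \<Rightarrow> 's set \<Rightarrow> ('s \<Rightarrow> real) \<Rightarrow> ('s \<Rightarrow> real) \<Rightarrow> real" where
  "gibbs_weight S W \<Lambda> \<zeta> \<eta> =
     exp (- hamiltonian S W \<Lambda> (merge \<Lambda> (S - \<Lambda>) (\<zeta>, \<eta>))) /
     (\<Sum>\<xi>\<in>spin_configs \<Lambda>. exp (- hamiltonian S W \<Lambda> (merge \<Lambda> (S - \<Lambda>) (\<xi>, \<eta>))))"

definition outside_algebra :: "'s set \<Rightarrow> 's set \<Rightarrow> ('s \<Rightarrow> real) measure" where
  "outside_algebra S \<Lambda> =
     vimage_algebra (spin_configs S) (\<lambda>\<sigma>. restrict \<sigma> (S - \<Lambda>)) (spin_algebra (S - \<Lambda>))"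

definition gibbs_measure ::
    "'s set \<Rightarrow> ('s set \<Rightarrow> ('s \<Rightarrow> real) \<Rightarrow> real) \<Rightarrow> ('s \<Rightarrow> real) measure \<Rightarrow> bool" where
  "gibbs_measure S W \<mu> \<longleftrightarrow>
     \<mu> \<in> space (prob_algebra (spin_algebra S)) \<and>
     (\<forall>\<Lambda> \<zeta>. finite \<Lambda> \<and> \<Lambda> \<subseteq> S \<and> \<zeta> \<in> spin_configs \<Lambda> \<longrightarrow>
        (AE \<eta> in \<mu>.
           real_cond_exp \<mu> (outside_algebra S \<Lambda>)
             (indicator {\<sigma> \<in> spin_configs S. restrict \<sigma> \<Lambda> = \<zeta>}) \<eta>
           = gibbs_weight S W \<Lambda> \<zeta> \<eta>))"

subsection \<open>Multiplication-invariant potentials on the positive integers\<close>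

definition mult_shift :: "nat \<Rightarrow> (nat \<Rightarrow> real) \<Rightarrow> nat \<Rightarrow> real" where
  "mult_shift i \<sigma> = (\<lambda>j\<in>{1..}. \<sigma> (i * j))"

definition multiplication_invariant :: "(nat set \<Rightarrow> (nat \<Rightarrow> real) \<Rightarrow> real) \<Rightarrow> bool" where
  "multiplication_invariant U \<longleftrightarrow>
     (\<forall>A \<sigma>. \<forall>i\<ge>1. finite A \<and> A \<subseteq> {1..} \<and> \<sigma> \<in> spin_configs {1..} \<longrightarrow>
        U ((*) i ` A) \<sigma> = U A (mult_shift i \<sigma>))"

text \<open>The injectivity clause says that the sets \<open>i A\<close> are pairwise distinct. These conditions alone
  do not imply multiplication invariance: for \<open>\<A> = {{2, 4}}\<close> and \<open>J {2, 4} \<noteq> 0\<close> they force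
  \<open>U {1, 2} = 0\<close> but \<open>U {2, 4} \<noteq> 0\<close>.\<close>

definition generated_by ::
    "(nat set \<Rightarrow> (nat \<Rightarrow> real) \<Rightarrow> real) \<Rightarrow> nat set set \<Rightarrow> (nat set \<Rightarrow> real) \<Rightarrow> bool" where
  "generated_by U \<A> J \<longleftrightarrow>
     (\<forall>A\<in>\<A>. finite A \<and> A \<subseteq> {1..}) \<and>
     inj_on (\<lambda>(i, A). (*) i ` A) ({1..} \<times> \<A>) \<and>
     (\<forall>i\<ge>1. \<forall>A\<in>\<A>. \<forall>\<sigma>\<in>spin_configs {1..}.
        U ((*) i ` A) \<sigma> = J A * (\<Prod>j\<in>A. mult_shift i \<sigma> j)) \<and>
     (\<forall>B. finite B \<and> B \<subseteq> {1..} \<and> (\<nexists>i A. i \<ge> 1 \<and> A \<in> \<A> \<and> B = (*) i ` A) \<longrightarrow>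
        (\<forall>\<sigma>\<in>spin_configs {1..}. U B \<sigma> = 0))"

subsection \<open>The associated shift-invariant potential\<close>

definition base_primes :: "nat set set \<Rightarrow> nat set" where
  "base_primes \<A> = (\<Union>a\<in>\<Union>\<A>. prime_factors a)"

text \<open>Vectors of length \<open>d\<close> are represented as sequences vanishing from index \<open>d\<close> on; the primes
  are numbered \<open>0, \<dots>, d - 1\<close> in increasing order.\<close>

definition orthant :: "nat \<Rightarrow> (nat \<Rightarrow> nat) set" where
  "orthant d = {x. \<forall>k\<ge>d. x k = 0}"

definition prime_monomial :: "nat set \<Rightarrow> (nat \<Rightarrow> nat) \<Rightarrow> nat" where
  "prime_monomial P x = (\<Prod>k<card P. (sorted_list_of_set P ! k) ^ x k)"

definition exponent_set :: "nat set \<Rightarrow> nat set \<Rightarrow> (nat \<Rightarrow> nat) set" where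
  "exponent_set P A = {x \<in> orthant (card P). prime_monomial P x \<in> A}"

definition translate :: "(nat \<Rightarrow> nat) \<Rightarrow> (nat \<Rightarrow> nat) set \<Rightarrow> (nat \<Rightarrow> nat) set" where
  "translate y B = (\<lambda>x k. x k + y k) ` B"

text \<open>When the sets \<open>i A\<close> are pairwise distinct, at most one pair \<open>(A, y)\<close> contributes to the sum.\<close>

definition layer_potential ::
    "nat set set \<Rightarrow> (nat set \<Rightarrow> real) \<Rightarrow> (nat \<Rightarrow> nat) set \<Rightarrow> ((nat \<Rightarrow> nat) \<Rightarrow> real) \<Rightarrow> real" where
  "layer_potential \<A> J B \<tau> =
     (\<Sum>(A, y) | A \<in> \<A> \<and> y \<in> orthant (card (base_primes \<A>)) \<and>
                B = translate y (exponent_set (base_primes \<A>) A).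
        J A * (\<Prod>x\<in>exponent_set (base_primes \<A>) A. \<tau> (\<lambda>k. x k + y k)))"

definition layer_unique :: "nat set set \<Rightarrow> (nat set \<Rightarrow> real) \<Rightarrow> bool" where
  "layer_unique \<A> J \<longleftrightarrow>
     (\<exists>!\<mu>. gibbs_measure (orthant (card (base_primes \<A>))) (layer_potential \<A> J) \<mu>)"

subsection \<open>Local functions and the multiplicative pressure\<close>

definition local_function :: "((nat \<Rightarrow> real) \<Rightarrow> real) \<Rightarrow> bool" where
  "local_function f \<longleftrightarrow>
     (\<exists>K. finite K \<and> K \<subseteq> {1..} \<and>
        (\<forall>\<sigma>\<in>spin_configs {1..}. \<forall>\<tau>\<in>spin_configs {1..}.
           (\<forall>k\<in>K. \<sigma> k = \<tau> k) \<longrightarrow> f \<sigma> = f \<tau>))"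

definition log_moment :: "(nat \<Rightarrow> real) measure \<Rightarrow> ((nat \<Rightarrow> real) \<Rightarrow> real) \<Rightarrow> nat \<Rightarrow> real" where
  "log_moment \<mu> f N = (1 / real N) * ln (\<integral>\<sigma>. exp (\<Sum>i=1..N. f (mult_shift i \<sigma>)) \<partial>\<mu>)"

definition mult_pressure :: "(nat \<Rightarrow> real) measure \<Rightarrow> ((nat \<Rightarrow> real) \<Rightarrow> real) \<Rightarrow> real" where
  "mult_pressure \<mu> f = lim (log_moment \<mu> f)"

definition rate_average ::
    "(nat \<Rightarrow> real) measure \<Rightarrow> ((nat \<Rightarrow> real) \<Rightarrow> real) \<Rightarrow> real \<Rightarrow> ereal" where
  "rate_average \<mu> f x = (SUP t. ereal (t * x - mult_pressure \<mu> (\<lambda>\<sigma>. t * f \<sigma>)))"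

definition rate_empirical :: "(nat \<Rightarrow> real) measure \<Rightarrow> (nat \<Rightarrow> real) measure \<Rightarrow> ereal" where
  "rate_empirical \<mu> \<nu> =
     (SUP f\<in>{f. local_function f}. ereal ((\<integral>\<sigma>. f \<sigma> \<partial>\<nu>) - mult_pressure \<mu> f))"

definition empirical_measure :: "nat \<Rightarrow> (nat \<Rightarrow> real) \<Rightarrow> (nat \<Rightarrow> real) measure" where
  "empirical_measure N \<sigma> =
     measure_of (spin_configs {1..}) (sets (spin_algebra {1..}))
       (\<lambda>B. (\<Sum>i=1..N. emeasure (return (spin_algebra {1..}) (mult_shift i \<sigma>)) B) / of_nat N)"

subsection \<open>Large deviations\<close>

definition ereal_ln :: "real \<Rightarrow> ereal" where
  "ereal_ln p = (if p = 0 then - \<infinity> else ereal (ln p))"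

definition rate_function :: "'x topology \<Rightarrow> ('x \<Rightarrow> ereal) \<Rightarrow> bool" where
  "rate_function X I \<longleftrightarrow>
     (\<forall>x\<in>topspace X. 0 \<le> I x) \<and>
     (\<forall>c::real. closedin X {x \<in> topspace X. I x \<le> ereal c})"

text \<open>The large deviation principle with speed \<open>N\<close>; the index \<open>N\<close> ranges over the positive
  integers, the value at \<open>0\<close> being irrelevant.\<close>

definition large_deviation_principle ::
    "'a measure \<Rightarrow> (nat \<Rightarrow> 'a \<Rightarrow> 'x) \<Rightarrow> 'x topology \<Rightarrow> ('x \<Rightarrow> ereal) \<Rightarrow> bool" where
  "large_deviation_principle \<mu> Y X I \<longleftrightarrow>
     (\<forall>N\<ge>1. Y N \<in> space \<mu> \<rightarrow> topspace X \<and>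
        (\<forall>G. openin X G \<longrightarrow> {\<omega> \<in> space \<mu>. Y N \<omega> \<in> G} \<in> sets \<mu>)) \<and>
     rate_function X I \<and>
     (\<forall>F. closedin X F \<longrightarrow>
        limsup (\<lambda>N. ereal (1 / real N) * ereal_ln (measure \<mu> {\<omega> \<in> space \<mu>. Y N \<omega> \<in> F}))
          \<le> - (INF x\<in>F. I x)) \<and>
     (\<forall>G. openin X G \<longrightarrow>
        - (INF x\<in>G. I x)
          \<le> liminf (\<lambda>N. ereal (1 / real N) * ereal_ln (measure \<mu> {\<omega> \<in> space \<mu>. Y N \<omega> \<in> G})))"

text \<open>The coarsest topology on the probability measures on \<open>M\<close> for which the integral of every
  bounded continuous function on \<open>X\<close> is continuous; \<open>M\<close> is meant to carry the Borel sets
  of \<open>X\<close>.\<close>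

definition weak_topology :: "'a topology \<Rightarrow> 'a measure \<Rightarrow> 'a measure topology" where
  "weak_topology X M =
     topology_generated_by
       {{\<nu> \<in> space (prob_algebra M). (\<integral>x. g x \<partial>\<nu>) \<in> V} | g V.
          continuous_map X euclideanreal g \<and> bounded (g ` topspace X) \<and> open V}"

end

theory Submission
  imports Defs
begin

text \<open>
  Conditioning a Gibbs measure of \<open>U\<close> on an event that concerns the other layers preserves the Gibbs
  property for \<open>V\<close> on a given layer; as \<open>V\<close> has only one Gibbs measure, the layers are i.i.d.
  For a local function \<open>f\<close>, let \<open>Q\<close> be a finite set of primes containing the base primes and all
  primes that divide a coordinate read by \<open>f\<close>. Writing \<open>i = r s\<close> with \<open>r\<close> free of the primes in \<open>Q\<close>
  and \<open>s\<close> composed of them splits \<open>\<Sum>i\<le>N. f (T\<^sub>i \<sigma>)\<close> into independent blocks indexed by \<open>r\<close>, so that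
  the normalised logarithmic moment is \<open>1/N\<close> times a sum of \<open>\<psi> \<lfloor>N/r\<rfloor>\<close> over \<open>r \<le> N\<close>. It converges by
  dominated convergence, since \<open>\<Sum>1/s\<close> over the numbers \<open>s\<close> is finite.

  The upper large deviation bound follows from Chernoff bounds and compactness. For the lower bound
  at \<open>x\<close>, the measure is tilted at the maximiser of \<open>t \<bullet> x - P\<^sub>N t - \<epsilon> \<bar>t\<bar>\<^sup>2/2\<close>; independence of the blocks
  bounds \<open>P\<^sub>N\<close> to second order, hence the tilted averages concentrate near \<open>x\<close>, and differentiability of
  the limiting pressure is not needed. For the empirical measures, the local functions are uniformly
  dense in the continuous ones, and the space of probability measures is weakly compact.
\<close>

subsection \<open>Smooth and rough numbers\<close>

text \<open>The obstacle is the lower bound. All estimates are therefore made at finite N, with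
  constants that survive the limit. This works because no block is large: a block contains at most
  \<open>smooth_count Q N\<close> of the N shifts, a number of order o(N), while the block sizes add
  up to N. Hence the squares of the block sizes add up to at most \<open>smooth_count Q N\<close>
  times N, and the tilted averages have a variance proxy of order
  \<open>smooth_count Q N / N\<close>, uniformly in the tilt. The quadratic penalty is there because
  the supremum in the rate need not be attained. It moves the tilted mean from x to x - \<epsilon>
  t, and comparison with t = 0 bounds this displacement in terms of the rate at x. The arithmetic
  input is elementary: the rough numbers have positive density, and counting 1, ..., N through i = r
  s then makes the smooth numbers sparse.\<close>

definition smooth_numbers :: "nat set \<Rightarrow> nat set" where
  "smooth_numbers Q = {s. 1 \<le> s \<and> prime_factors s \<subseteq> Q}"

definition rough_numbers :: "nat set \<Rightarrow> nat set" where
  "rough_numbers Q = {r. 1 \<le> r \<and> prime_factors r \<inter> Q = {}}"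

lemma real_nat_div_le: "real (m div n) \<le> real m / real n"
proof (cases "n = 0")
  case False
  have "real (m div n * n) \<le> real m" by (simp only: of_nat_le_iff div_times_less_eq_dividend)
  then show ?thesis using False by (simp add: le_divide_eq)
qed simp

lemma smooth_numbers_ge_1: "s \<in> smooth_numbers Q \<Longrightarrow> 1 \<le> s"
  by (simp add: smooth_numbers_def)

lemma rough_numbers_ge_1: "r \<in> rough_numbers Q \<Longrightarrow> 1 \<le> r"
  by (simp add: rough_numbers_def)

lemma one_in_smooth_numbers [simp]: "1 \<in> smooth_numbers Q" "Suc 0 \<in> smooth_numbers Q"
  by (simp_all add: smooth_numbers_def)

lemma one_in_rough_numbers [simp]: "1 \<in> rough_numbers Q" "Suc 0 \<in> rough_numbers Q"
  by (simp_all add: rough_numbers_def)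

lemma smooth_numbers_mult_iff:
  assumes "1 \<le> a" "1 \<le> b"
  shows "a * b \<in> smooth_numbers Q \<longleftrightarrow> a \<in> smooth_numbers Q \<and> b \<in> smooth_numbers Q"
  using assms by (auto simp: smooth_numbers_def prime_factors_product)

lemma rough_numbers_mult_iff:
  assumes "1 \<le> a" "1 \<le> b"
  shows "a * b \<in> rough_numbers Q \<longleftrightarrow> a \<in> rough_numbers Q \<and> b \<in> rough_numbers Q"
  using assms by (auto simp: rough_numbers_def prime_factors_product)

lemma coprime_rough_smooth:
  assumes "r \<in> rough_numbers Q" "s \<in> smooth_numbers Q"
  shows "coprime r s"
proof (rule ccontr)
  assume "\<not> coprime r s"
  then have "gcd r s \<noteq> 1" by (simp add: coprime_iff_gcd_eq_1)
  then obtain p where "prime p" "p dvd gcd r s" using prime_factor_nat by blast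
  then have "p \<in> prime_factors r" "p \<in> prime_factors s"
    using assms by (auto simp: in_prime_factors_iff rough_numbers_def smooth_numbers_def)
  then show False using assms by (auto simp: rough_numbers_def smooth_numbers_def)
qed

lemma rough_smooth_exists:
  assumes "1 \<le> n"
  shows "\<exists>r s. r \<in> rough_numbers Q \<and> s \<in> smooth_numbers Q \<and> n = r * s"
  using assms
proof (induction n rule: less_induct)
  case (less n)
  show ?case
  proof (cases "n = 1")
    case True
    then show ?thesis by (intro exI[of _ 1]) simp
  next
    case False
    then obtain p where p: "prime p" "p dvd n" using prime_factor_nat by blast
    then obtain m where m: "n = p * m" by auto
    have "m \<ge> 1" using m less.prems by (cases m) auto
    moreover have "m < n" using m p \<open>m \<ge> 1\<close> prime_gt_1_nat[OF p(1)] by simp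
    ultimately obtain r s where rs: "r \<in> rough_numbers Q" "s \<in> smooth_numbers Q" "m = r * s"
      using less.IH by blast
    have pf: "prime_factors p = {p}" "p \<ge> 1" using p prime_ge_1_nat[OF p(1)] by (simp_all add: prime_prime_factors)
    show ?thesis
    proof (cases "p \<in> Q")
      case True
      then have "p * s \<in> smooth_numbers Q"
        using rs pf by (subst smooth_numbers_mult_iff) (auto simp: smooth_numbers_def)
      then show ?thesis using rs m by (intro exI[of _ r] exI[of _ "p * s"]) simp
    next
      case False
      then have "p * r \<in> rough_numbers Q"
        using rs pf by (subst rough_numbers_mult_iff) (auto simp: rough_numbers_def)
      then show ?thesis using rs m by (intro exI[of _ "p * r"] exI[of _ s]) simp
    qed
  qed
qed

lemma rough_smooth_unique:
  assumes "r \<in> rough_numbers Q" "s \<in> smooth_numbers Q"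
    and "r' \<in> rough_numbers Q" "s' \<in> smooth_numbers Q" and "r * s = r' * s'"
  shows "r = r' \<and> s = s'"
proof -
  have "coprime r' s" "coprime r s'" using assms coprime_rough_smooth by auto
  moreover have "s dvd r' * s'" "s' dvd r * s" using assms(5) by (metis dvd_triv_right)+
  ultimately have "s dvd s'" "s' dvd s"
    using coprime_dvd_mult_right_iff coprime_commute by blast+
  then have "s = s'" by (rule dvd_antisym)
  then show ?thesis using assms smooth_numbers_ge_1[OF assms(2)] by auto
qed

text \<open>Unique factorisation i = r s, together with the fact that r s \<le> N is the same as s
  \<le> N div r. The truncation is what matters later: an inner sum sees N only through N div
  r.\<close>

lemma sum_rough_smooth:
  fixes F :: "nat \<Rightarrow> 'a::comm_monoid_add"
  shows "(\<Sum>i=1..N. F i) =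
    (\<Sum>r | r \<in> rough_numbers Q \<and> r \<le> N. \<Sum>s | s \<in> smooth_numbers Q \<and> s \<le> N div r. F (r * s))"
proof -
  let ?A = "{r. r \<in> rough_numbers Q \<and> r \<le> N}"
  let ?B = "\<lambda>r. {s. s \<in> smooth_numbers Q \<and> s \<le> N div r}"
  have le: "r * s \<le> N \<longleftrightarrow> s \<le> N div r" if "r \<in> rough_numbers Q" for r s
    using rough_numbers_ge_1[OF that] by (simp add: less_eq_div_iff_mult_less_eq mult.commute)
  have "bij_betw (\<lambda>(r, s). r * s) (Sigma ?A ?B) {1..N}"
    unfolding bij_betw_def
  proof
    show "inj_on (\<lambda>(r, s). r * s) (Sigma ?A ?B)"
      by (auto simp: inj_on_def dest: rough_smooth_unique)
    show "(\<lambda>(r, s). r * s) ` Sigma ?A ?B = {1..N}"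
    proof safe
      fix r s assume "r \<in> rough_numbers Q" "r \<le> N" "s \<in> smooth_numbers Q" "s \<le> N div r"
      then show "r * s \<in> {1..N}"
        using le[of r s] rough_numbers_ge_1[of r] smooth_numbers_ge_1[of s] by simp
    next
      fix n assume n: "n \<in> {1..N}"
      then obtain r s where rs: "r \<in> rough_numbers Q" "s \<in> smooth_numbers Q" "n = r * s"
        using rough_smooth_exists[of n Q] by auto
      moreover have "r \<le> n" using rs smooth_numbers_ge_1[of s] by simp
      moreover have "s \<le> N div r" "r \<le> N" using n rs le[of r s] \<open>r \<le> n\<close> le_trans[of r n N] by simp_all
      ultimately show "n \<in> (\<lambda>(r, s). r * s) ` Sigma ?A ?B"
        by (intro image_eqI[of _ _ "(r, s)"]) auto
    qed
  qed
  then have "(\<Sum>i=1..N. F i) = (\<Sum>(r, s)\<in>Sigma ?A ?B. F (r * s))"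
    by (subst sum.reindex_bij_betw[symmetric]) (auto simp: case_prod_unfold)
  also have "\<dots> = (\<Sum>r\<in>?A. \<Sum>s\<in>?B r. F (r * s))"
    by (subst sum.Sigma) auto
  finally show ?thesis by simp
qed

text \<open>The constraint r s \<le> N is symmetric in r and s. The exchange turns an average over
  rough numbers into a series over smooth numbers, to which domination applies.\<close>

lemma sum_rough_smooth_swap:
  fixes F :: "nat \<Rightarrow> nat \<Rightarrow> 'a::comm_monoid_add"
  shows "(\<Sum>r | r \<in> rough_numbers Q \<and> r \<le> N. \<Sum>s | s \<in> smooth_numbers Q \<and> s \<le> N div r. F r s) =
    (\<Sum>s | s \<in> smooth_numbers Q \<and> s \<le> N. \<Sum>r | r \<in> rough_numbers Q \<and> r \<le> N div s. F r s)"
proof -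
  have 1: "{s. s \<in> smooth_numbers Q \<and> s \<le> N div r} =
      {s. s \<in> {s. s \<in> smooth_numbers Q \<and> s \<le> N} \<and> r * s \<le> N}" if "r \<in> rough_numbers Q" for r
  proof -
    have "r \<ge> 1" using rough_numbers_ge_1[OF that] .
    then have "s \<le> N div r \<longleftrightarrow> s \<le> N \<and> r * s \<le> N" for s
      using div_le_dividend[of N r] less_eq_div_iff_mult_less_eq[of r s N] mult.commute[of s r] by linarith
    then show ?thesis by auto
  qed
  have 2: "{r. r \<in> rough_numbers Q \<and> r \<le> N div s} =
      {r. r \<in> {r. r \<in> rough_numbers Q \<and> r \<le> N} \<and> r * s \<le> N}" if "s \<in> smooth_numbers Q" for s
  proof -
    have s: "s \<ge> 1" using smooth_numbers_ge_1[OF that] .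
    have "r \<le> N div s \<longleftrightarrow> r \<le> N \<and> r * s \<le> N" for r
      using s div_le_dividend[of N s] less_eq_div_iff_mult_less_eq[of s r N] by linarith
    then show ?thesis by auto
  qed
  have "(\<Sum>r | r \<in> rough_numbers Q \<and> r \<le> N. \<Sum>s | s \<in> smooth_numbers Q \<and> s \<le> N div r. F r s) =
    (\<Sum>r | r \<in> rough_numbers Q \<and> r \<le> N. \<Sum>s | s \<in> {s. s \<in> smooth_numbers Q \<and> s \<le> N} \<and> r * s \<le> N. F r s)"
    by (intro sum.cong 1 refl) auto
  also have "\<dots> = (\<Sum>s | s \<in> smooth_numbers Q \<and> s \<le> N.
      \<Sum>r | r \<in> {r. r \<in> rough_numbers Q \<and> r \<le> N} \<and> r * s \<le> N. F r s)"
    by (rule sum.swap_restrict) auto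
  also have "\<dots> = (\<Sum>s | s \<in> smooth_numbers Q \<and> s \<le> N. \<Sum>r | r \<in> rough_numbers Q \<and> r \<le> N div s. F r s)"
    by (intro sum.cong 2[symmetric] refl) auto
  finally show ?thesis .
qed

section \<open>Counting rough and smooth numbers\<close>

definition rough_count :: "nat set \<Rightarrow> nat \<Rightarrow> nat" where
  "rough_count Q m = card {r. r \<in> rough_numbers Q \<and> r \<le> m}"

definition smooth_count :: "nat set \<Rightarrow> nat \<Rightarrow> nat" where
  "smooth_count Q m = card {s. s \<in> smooth_numbers Q \<and> s \<le> m}"

lemma rough_count_le: "rough_count Q m \<le> m"
proof -
  have "{r. r \<in> rough_numbers Q \<and> r \<le> m} \<subseteq> {1..m}" by (auto simp: rough_numbers_def)
  then show ?thesis unfolding rough_count_def using card_mono[of "{1..m}"] by fastforce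
qed

lemma smooth_count_mono: "m \<le> n \<Longrightarrow> smooth_count Q m \<le> smooth_count Q n"
  unfolding smooth_count_def by (intro card_mono) auto

lemma smooth_count_pos: "1 \<le> m \<Longrightarrow> 1 \<le> smooth_count Q m"
proof -
  assume "1 \<le> m"
  then have "{1} \<subseteq> {s. s \<in> smooth_numbers Q \<and> s \<le> m}" by auto
  then show ?thesis
    unfolding smooth_count_def using card_mono[of "{s. s \<in> smooth_numbers Q \<and> s \<le> m}" "{1}"] by simp
qed

text \<open>Adding \<open>\<Prod>Q\<close> preserves divisibility by each prime in Q, so roughness
  is periodic. The numbers up to m + \<open>\<Prod>Q\<close> split into one full period and a
  translate of the numbers up to m.\<close>

lemma rough_count_shift:
  assumes Q: "finite Q" "\<And>p. p \<in> Q \<Longrightarrow> prime p"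
  shows "rough_count Q (m + \<Prod>Q) = rough_count Q m + rough_count Q (\<Prod>Q)"
proof -
  let ?D = "\<Prod>Q"
  have pd: "p dvd ?D" if "p \<in> Q" for p using Q that by (metis dvd_prodI)
  have D: "?D \<ge> 1" using Q prime_gt_0_nat by (simp add: Suc_leI prod_pos)
  have rough: "r + ?D \<in> rough_numbers Q \<longleftrightarrow> r \<in> rough_numbers Q" if "r \<ge> 1" for r
  proof -
    have *: "n \<in> rough_numbers Q \<longleftrightarrow> (\<forall>p\<in>Q. \<not> p dvd n)" if "n \<ge> 1" for n
      using that Q(2) by (auto simp: rough_numbers_def in_prime_factors_iff disjoint_iff)
    have "p dvd r + ?D \<longleftrightarrow> p dvd r" if "p \<in> Q" for p
      using pd[OF that] by (rule dvd_add_left_iff)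
    then show ?thesis using *[of r] *[of "r + ?D"] that by simp
  qed
  have eq: "{r. r \<in> rough_numbers Q \<and> r \<le> m + ?D} =
    (\<lambda>r. r + ?D) ` {r. r \<in> rough_numbers Q \<and> r \<le> m} \<union> {r. r \<in> rough_numbers Q \<and> r \<le> ?D}" (is "?L = ?R")
  proof (intro set_eqI iffI)
    fix r assume r: "r \<in> ?L"
    show "r \<in> ?R"
    proof (cases "r \<le> ?D")
      case False
      then have "r = (r - ?D) + ?D" "r - ?D \<ge> 1" "r - ?D \<le> m" using r by auto
      then show ?thesis using rough[of "r - ?D"] r by (intro UnI1 image_eqI[of _ _ "r - ?D"]) auto
    qed (use r in auto)
  next
    fix r assume "r \<in> ?R"
    then show "r \<in> ?L" using rough rough_numbers_ge_1 by auto
  qed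
  show ?thesis unfolding rough_count_def eq
    by (subst card_Un_disjoint) (auto simp: card_image inj_on_def dest!: rough_numbers_ge_1)
qed

text \<open>The set of rough numbers is periodic with period \<open>\<Prod>Q\<close>.\<close>

lemma rough_count_asymptotics:
  assumes Q: "finite Q" "\<And>p. p \<in> Q \<Longrightarrow> prime p"
  obtains \<kappa> D :: real where "\<kappa> > 0" "\<And>m. \<bar>real (rough_count Q m) - \<kappa> * real m\<bar> \<le> D"
proof -
  let ?D = "\<Prod>Q"
  define \<kappa> where "\<kappa> = real (rough_count Q ?D) / real ?D"
  have D: "?D \<ge> 1" using Q prime_gt_0_nat by (simp add: Suc_leI prod_pos)
  \<comment> \<open>The number 1 is rough, so a period contains at least one rough number and the
    density is positive.\<close>
  have "{1} \<subseteq> {r. r \<in> rough_numbers Q \<and> r \<le> ?D}" using D by auto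
  then have "rough_count Q ?D \<ge> 1"
    unfolding rough_count_def using card_mono[of "{r. r \<in> rough_numbers Q \<and> r \<le> ?D}" "{1}"] by simp
  then have \<kappa>: "\<kappa> > 0" using D unfolding \<kappa>_def by (intro divide_pos_pos) (simp_all del: of_nat_prod)
  have \<kappa>1: "\<kappa> \<le> 1" unfolding \<kappa>_def using rough_count_le[of Q ?D] D by (subst divide_le_eq_1_pos) (simp_all only: of_nat_le_iff of_nat_0_less_iff)
  have \<kappa>D: "\<kappa> * real ?D = real (rough_count Q ?D)" unfolding \<kappa>_def using D by (metis nonzero_divide_eq_eq not_one_le_zero of_nat_eq_0_iff)
  \<comment> \<open>Below one period both quantities lie between 0 and m; removing a period changes
    both by the same amount and leaves the error as it was.\<close>
  have "\<bar>real (rough_count Q m) - \<kappa> * real m\<bar> \<le> real ?D" for m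
  proof (induction m rule: less_induct)
    case (less m)
    show ?case
    proof (cases "m < ?D")
      case True
      have "real (rough_count Q m) \<le> real m" using rough_count_le[of Q m] by simp
      moreover have "\<kappa> * real m \<le> real m" using \<kappa>1 by (simp add: mult_left_le_one_le \<kappa> less_imp_le)
      moreover have "0 \<le> \<kappa> * real m" using \<kappa> by simp
      moreover have "real m < real ?D" using True by (simp only: of_nat_less_iff)
      ultimately show ?thesis by linarith
    next
      case False
      then have m: "m = (m - ?D) + ?D" by simp
      have "real (rough_count Q m) = real (rough_count Q (m - ?D)) + \<kappa> * real ?D"
        using rough_count_shift[OF Q, of "m - ?D"] m \<kappa>D by (metis of_nat_add)
      moreover have "\<kappa> * real m = \<kappa> * real (m - ?D) + \<kappa> * real ?D"
        using m by (metis distrib_left of_nat_add)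
      moreover have "m - ?D < m" using D False by simp
      ultimately show ?thesis using less.IH[of "m - ?D"] by simp
    qed
  qed
  then show ?thesis using that \<kappa> by blast
qed

text \<open>Rounding N / s down costs at most 1, hence at most \<kappa> in the main term, so the
  total error stays bounded and disappears after division by N.\<close>

lemma rough_count_div_limit:
  assumes "\<And>m. \<bar>real (rough_count Q m) - \<kappa> * real m\<bar> \<le> D" "\<kappa> > 0" "s \<ge> 1"
  shows "(\<lambda>N. real (rough_count Q (N div s)) / real N) \<longlonglongrightarrow> \<kappa> / real s"
proof -
  have 1: "\<bar>real (rough_count Q (N div s)) - \<kappa> * (real N / real s)\<bar> \<le> D + \<kappa>" for N
  proof -
    have "N < (N div s + 1) * s"
      using dividend_less_div_times[of s N] assms(3) by (simp add: algebra_simps)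
    then have "real N < (real (N div s) + 1) * real s"
      by (metis of_nat_less_iff of_nat_mult of_nat_add of_nat_1)
    then have "real N / real s < real (N div s) + 1"
      using assms(3) by (simp add: divide_less_eq)
    moreover have "real (N div s) \<le> real N / real s" by (rule real_nat_div_le)
    ultimately have "\<bar>real (N div s) - real N / real s\<bar> \<le> 1" by linarith
    then have "\<bar>\<kappa> * real (N div s) - \<kappa> * (real N / real s)\<bar> \<le> \<kappa>"
      using assms(2) by (simp only: right_diff_distrib[symmetric] abs_mult) simp
    then show ?thesis using assms(1)[of "N div s"] by linarith
  qed
  have "(\<lambda>N. real (rough_count Q (N div s)) / real N - \<kappa> / real s) \<longlonglongrightarrow> 0"
  proof (rule Lim_null_comparison)
    show "\<forall>\<^sub>F N in sequentially. norm (real (rough_count Q (N div s)) / real N - \<kappa> / real s) \<le> (D + \<kappa>) / real N"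
      using eventually_gt_at_top[of 0]
    proof eventually_elim
      case (elim N)
      have "real (rough_count Q (N div s)) / real N - \<kappa> / real s =
        (real (rough_count Q (N div s)) - \<kappa> * (real N / real s)) / real N"
        using elim by (simp add: field_simps)
      then show ?case using 1[of N] elim by (simp add: divide_right_mono)
    qed
    show "(\<lambda>N. (D + \<kappa>) / real N) \<longlonglongrightarrow> 0" by (rule lim_const_over_n)
  qed
  then show ?thesis by (simp add: LIM_zero_iff)
qed

text \<open>Groups the numbers up to N by their smooth part. The companion
  \<open>sum_smooth_count\<close> groups them by their rough part and says that the block sizes add
  up to N.\<close>

lemma sum_rough_count: "(\<Sum>s | s \<in> smooth_numbers Q \<and> s \<le> N. rough_count Q (N div s)) = N"
proof -
  have "(\<Sum>s | s \<in> smooth_numbers Q \<and> s \<le> N. rough_count Q (N div s)) = (\<Sum>i=1..N. 1::nat)"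
    unfolding sum_rough_smooth[of _ N Q] sum_rough_smooth_swap by (simp add: rough_count_def)
  then show ?thesis by simp
qed

lemma sum_smooth_count: "(\<Sum>r | r \<in> rough_numbers Q \<and> r \<le> N. smooth_count Q (N div r)) = N"
proof -
  have "(\<Sum>r | r \<in> rough_numbers Q \<and> r \<le> N. smooth_count Q (N div r)) = (\<Sum>i=1..N. 1::nat)"
    unfolding sum_rough_smooth[of _ N Q] by (simp add: smooth_count_def)
  then show ?thesis by simp
qed

text \<open>A counting argument in place of an Euler product: in \<open>sum_rough_count\<close>
  divided by N each fixed term tends to \<kappa> / s, while every finite partial sum stays at most
  1. So the partial sums of the reciprocals are at most 1 / \<kappa>.\<close>

lemma summable_smooth_reciprocals:
  assumes Q: "finite Q" "\<And>p. p \<in> Q \<Longrightarrow> prime p"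
  shows "summable (\<lambda>s. if s \<in> smooth_numbers Q then 1 / real s else 0)"
proof -
  obtain \<kappa> D where \<kappa>: "\<kappa> > 0" and D: "\<And>m. \<bar>real (rough_count Q m) - \<kappa> * real m\<bar> \<le> D"
    using rough_count_asymptotics[OF Q] by blast
  have "(\<Sum>s<n. if s \<in> smooth_numbers Q then 1 / real s else 0) \<le> 1 / \<kappa>" for n
  proof -
    let ?S = "{s. s \<in> smooth_numbers Q \<and> s < n}"
    have "(\<lambda>N. \<Sum>s\<in>?S. real (rough_count Q (N div s)) / real N) \<longlonglongrightarrow> (\<Sum>s\<in>?S. \<kappa> / real s)"
      by (intro tendsto_sum rough_count_div_limit[OF D \<kappa>]) (auto simp: smooth_numbers_def)
    moreover have "(\<Sum>s\<in>?S. real (rough_count Q (N div s)) / real N) \<le> 1" if "N \<ge> n" for N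
    proof -
      have "(\<Sum>s\<in>?S. rough_count Q (N div s)) \<le> (\<Sum>s | s \<in> smooth_numbers Q \<and> s \<le> N. rough_count Q (N div s))"
        using that by (intro sum_mono2) auto
      then have "(\<Sum>s\<in>?S. real (rough_count Q (N div s))) \<le> real N"
        unfolding sum_rough_count by (simp flip: of_nat_sum)
      then show ?thesis by (cases "N = 0") (simp_all flip: sum_divide_distrib)
    qed
    ultimately have "(\<Sum>s\<in>?S. \<kappa> / real s) \<le> 1" by (intro LIMSEQ_le_const2) auto
    then have "\<kappa> * (\<Sum>s\<in>?S. 1 / real s) \<le> 1" by (simp add: sum_distrib_left)
    then have "(\<Sum>s\<in>?S. 1 / real s) \<le> 1 / \<kappa>" using \<kappa> by (simp add: pos_le_divide_eq mult.commute)
    moreover have "(\<Sum>s<n. if s \<in> smooth_numbers Q then 1 / real s else 0) = (\<Sum>s\<in>?S. 1 / real s)"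
      by (subst sum.inter_filter[symmetric]) (auto intro!: sum.cong)
    ultimately show ?thesis by simp
  qed
  then show ?thesis by (intro summableI_nonneg_bounded[of _ "1 / \<kappa>"]) auto
qed

text \<open>Tannery's theorem for the terms 1 / N with s \<le> N, which are dominated by 1 / s. This
  is what makes the largest block negligible.\<close>

lemma smooth_count_density_zero:
  assumes Q: "finite Q" "\<And>p. p \<in> Q \<Longrightarrow> prime p"
  shows "(\<lambda>N. real (smooth_count Q N) / real N) \<longlonglongrightarrow> 0"
proof -
  define a where "a = (\<lambda>s N. if s \<in> smooth_numbers Q \<and> s \<le> N then 1 / real N else 0)"
  have "(\<lambda>N. suminf (\<lambda>s. a s N)) \<longlonglongrightarrow> suminf (\<lambda>s. 0::real)"
  proof (rule conjunct2[OF conjunct2[OF tannerys_theorem]])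
    show "(\<lambda>N. a s N) \<longlonglongrightarrow> 0" for s
    proof (rule tendsto_sandwich[OF _ _ tendsto_const lim_const_over_n[of 1]])
    qed (auto simp: a_def)
    have "norm (a s N) \<le> (if s \<in> smooth_numbers Q then 1 / real s else 0)" for s N
      by (auto simp: a_def frac_le dest!: smooth_numbers_ge_1)
    then show "eventually (\<lambda>(s,N). norm (a s N) \<le> (if s \<in> smooth_numbers Q then 1 / real s else 0)) (at_top \<times>\<^sub>F sequentially)"
      by (intro always_eventually) auto
  qed (use summable_smooth_reciprocals[OF Q] in auto)
  moreover have "suminf (\<lambda>s. a s N) = real (smooth_count Q N) / real N" for N
    by (subst suminf_finite[of "{s. s \<in> smooth_numbers Q \<and> s \<le> N}"]) (auto simp: a_def smooth_count_def)
  ultimately show ?thesis by simp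
qed

text \<open>Summation by parts. The increments of g live on the smooth numbers, so the average is
  the sum over smooth s of the increment at s times \<open>rough_count Q (N div s) / N\<close>. Each
  term converges, and M / s is a summable dominating bound.\<close>

lemma rough_average_convergent:
  fixes g :: "nat \<Rightarrow> real"
  assumes Q: "finite Q" "\<And>p. p \<in> Q \<Longrightarrow> prime p"
    and g0: "g 0 = 0" and g: "\<And>n. \<bar>g (Suc n) - g n\<bar> \<le> (if Suc n \<in> smooth_numbers Q then M else 0)"
  shows "convergent (\<lambda>N. (1 / real N) * (\<Sum>r | r \<in> rough_numbers Q \<and> r \<le> N. g (N div r)))"
proof -
  obtain \<kappa> D where \<kappa>: "\<kappa> > 0" and D: "\<And>m. \<bar>real (rough_count Q m) - \<kappa> * real m\<bar> \<le> D"
    using rough_count_asymptotics[OF Q] by blast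
  have M: "M \<ge> 0" using g[of 0] by simp
  define \<delta> where "\<delta> s = g s - g (s - 1)" for s
  have \<delta>: "\<bar>\<delta> s\<bar> \<le> M" if "s \<in> smooth_numbers Q" for s
    using g[of "s - 1"] that smooth_numbers_ge_1[OF that] by (simp add: \<delta>_def)
  have g_sum: "g n = (\<Sum>s | s \<in> smooth_numbers Q \<and> s \<le> n. \<delta> s)" for n
  proof (induction n)
    case 0
    have "{s. s \<in> smooth_numbers Q \<and> s \<le> 0} = {}" by (auto simp: smooth_numbers_def)
    then show ?case by (simp only: g0 sum.empty)
  next
    case (Suc n)
    show ?case
    proof (cases "Suc n \<in> smooth_numbers Q")
      case True
      then have "{s. s \<in> smooth_numbers Q \<and> s \<le> Suc n} = insert (Suc n) {s. s \<in> smooth_numbers Q \<and> s \<le> n}"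
        by (auto simp: le_Suc_eq)
      then show ?thesis using Suc by (simp add: \<delta>_def)
    next
      case False
      then have "{s. s \<in> smooth_numbers Q \<and> s \<le> Suc n} = {s. s \<in> smooth_numbers Q \<and> s \<le> n}"
        by (auto simp: le_Suc_eq)
      then show ?thesis using Suc g[of n] False by simp
    qed
  qed
  define a where "a = (\<lambda>s N. if s \<in> smooth_numbers Q then \<delta> s * (real (rough_count Q (N div s)) / real N) else 0)"
  define b where "b = (\<lambda>s. if s \<in> smooth_numbers Q then \<delta> s * (\<kappa> / real s) else 0)"
  have "(\<lambda>N. suminf (\<lambda>s. a s N)) \<longlonglongrightarrow> suminf b"
  proof (rule conjunct2[OF conjunct2[OF tannerys_theorem]])
    show "(\<lambda>N. a s N) \<longlonglongrightarrow> b s" for s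
    proof (cases "s \<in> smooth_numbers Q")
      case True
      then show ?thesis
        using tendsto_mult[OF tendsto_const[of "\<delta> s"] rough_count_div_limit[OF D \<kappa> smooth_numbers_ge_1[OF True]]]
        by (simp add: a_def b_def)
    qed (simp add: a_def b_def)
    have "norm (a s N) \<le> M * (if s \<in> smooth_numbers Q then 1 / real s else 0)" for s N
    proof (cases "s \<in> smooth_numbers Q")
      case True
      have "real (rough_count Q (N div s)) \<le> real (N div s)" using rough_count_le[of Q "N div s"] by simp
      also have "\<dots> \<le> real N / real s" by (rule real_nat_div_le)
      finally have "real (rough_count Q (N div s)) / real N \<le> 1 / real s"
        by (cases "N = 0") (auto simp: field_simps)
      then show ?thesis using True \<delta>[OF True] M by (simp add: a_def abs_mult mult_mono del: times_divide_eq_right)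
    qed (simp add: a_def)
    then show "eventually (\<lambda>(s,N). norm (a s N) \<le> M * (if s \<in> smooth_numbers Q then 1 / real s else 0)) (at_top \<times>\<^sub>F sequentially)"
      by (intro always_eventually) auto
  qed (use summable_mult[OF summable_smooth_reciprocals[OF Q]] in auto)
  moreover have "suminf (\<lambda>s. a s N) = (1 / real N) * (\<Sum>r | r \<in> rough_numbers Q \<and> r \<le> N. g (N div r))" for N
  proof -
    have "(\<Sum>r | r \<in> rough_numbers Q \<and> r \<le> N. g (N div r)) =
      (\<Sum>s | s \<in> smooth_numbers Q \<and> s \<le> N. \<Sum>r | r \<in> rough_numbers Q \<and> r \<le> N div s. \<delta> s)"
      unfolding g_sum by (rule sum_rough_smooth_swap)
    also have "\<dots> = (\<Sum>s | s \<in> smooth_numbers Q \<and> s \<le> N. \<delta> s * real (rough_count Q (N div s)))"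
      by (simp add: rough_count_def mult.commute)
    also have "(1 / real N) * \<dots> = (\<Sum>s | s \<in> smooth_numbers Q \<and> s \<le> N. a s N)"
      unfolding sum_distrib_left by (intro sum.cong) (auto simp: a_def)
    also have "\<dots> = suminf (\<lambda>s. a s N)"
    proof (rule suminf_finite[symmetric])
      fix s assume "s \<notin> {s. s \<in> smooth_numbers Q \<and> s \<le> N}"
      \<comment> \<open>For s > N the quotient N div s is 0, so the series stops at N.\<close>
      moreover have "rough_count Q 0 = 0" using rough_count_le[of Q 0] by simp
      ultimately show "a s N = 0" by (auto simp: a_def)
    qed auto
    finally show ?thesis ..
  qed
  ultimately show ?thesis by (auto simp: convergent_def)
qed

section \<open>Exponent vectors of smooth numbers\<close>

lemma prime_monomial_add: "prime_monomial P (\<lambda>k. x k + y k) = prime_monomial P x * prime_monomial P y"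
  by (simp add: prime_monomial_def power_add prod.distrib)

context
  fixes P :: "nat set"
  assumes P: "finite P" "\<And>p. p \<in> P \<Longrightarrow> prime p"
begin

text \<open>Indexing the product by the primes themselves, instead of by their positions in the
  sorted list, makes the standard facts on products of prime powers applicable.\<close>

lemma prime_monomial_alt:
  "prime_monomial P x = (\<Prod>p\<in>P. p ^ x (the_inv_into {..<card P} ((!) (sorted_list_of_set P)) p))"
proof -
  have bij: "bij_betw ((!) (sorted_list_of_set P)) {..<card P} P"
    using P by (intro bij_betw_nth) auto
  then have "inj_on ((!) (sorted_list_of_set P)) {..<card P}" by (simp add: bij_betw_def)
  then have "prime_monomial P x = (\<Prod>k<card P. (sorted_list_of_set P ! k) ^
      x (the_inv_into {..<card P} ((!) (sorted_list_of_set P)) (sorted_list_of_set P ! k)))"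
    unfolding prime_monomial_def by (intro prod.cong) (auto simp: the_inv_into_f_f)
  then show ?thesis
    using prod.reindex_bij_betw[OF bij, of "\<lambda>p. p ^ x (the_inv_into {..<card P} ((!) (sorted_list_of_set P)) p)"] by simp
qed

lemma multiplicity_prime_monomial:
  assumes "k < card P"
  shows "multiplicity (sorted_list_of_set P ! k) (prime_monomial P x) = x k"
proof -
  have bij: "bij_betw ((!) (sorted_list_of_set P)) {..<card P} P"
    using P by (intro bij_betw_nth) auto
  then have "inj_on ((!) (sorted_list_of_set P)) {..<card P}" by (simp add: bij_betw_def)
  moreover have "sorted_list_of_set P ! k \<in> P" using bij assms by (auto simp: bij_betw_def)
  ultimately show ?thesis unfolding prime_monomial_alt
    using assms P by (subst multiplicity_prod_prime_powers) (auto simp: the_inv_into_f_f)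
qed

lemma prime_monomial_bij: "bij_betw (prime_monomial P) (orthant (card P)) (smooth_numbers P)"
  unfolding bij_betw_def
proof
  have bij: "bij_betw ((!) (sorted_list_of_set P)) {..<card P} P"
    using P by (intro bij_betw_nth) auto
  show "inj_on (prime_monomial P) (orthant (card P))"
  proof (rule inj_onI, rule ext)
    fix x y k assume "x \<in> orthant (card P)" "y \<in> orthant (card P)" "prime_monomial P x = prime_monomial P y"
    then show "x k = y k"
      using multiplicity_prime_monomial[of k x] multiplicity_prime_monomial[of k y]
      by (cases "k < card P") (auto simp: orthant_def)
  qed
  show "prime_monomial P ` orthant (card P) = smooth_numbers P"
  proof safe
    fix x :: "nat \<Rightarrow> nat"
    have "p \<noteq> 0" if "p \<in> P" for p using P(2)[OF that] by auto
    then have "prime_monomial P x \<noteq> 0" using P(1) unfolding prime_monomial_alt by auto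
    moreover have "q \<in> P" if q: "prime q" "q dvd prime_monomial P x" for q
    proof -
      obtain p where "p \<in> P" "q dvd p ^ x (the_inv_into {..<card P} ((!) (sorted_list_of_set P)) p)"
        using q(2)[unfolded prime_monomial_alt prime_dvd_prod_iff[OF P(1) q(1)]] by blast
      then have "p \<in> P" "q dvd p" using prime_dvd_power[OF q(1)] by auto
      then show ?thesis using P(2) q(1) primes_dvd_imp_eq by blast
    qed
    ultimately show "prime_monomial P x \<in> smooth_numbers P"
      by (auto simp: smooth_numbers_def in_prime_factors_iff)
  next
    fix s assume s: "s \<in> smooth_numbers P"
    define x where "x k = (if k < card P then multiplicity (sorted_list_of_set P ! k) s else 0)" for k
    have "prime_monomial P x = (\<Prod>k<card P. (sorted_list_of_set P ! k) ^ multiplicity (sorted_list_of_set P ! k) s)"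
      unfolding prime_monomial_def by (intro prod.cong) (auto simp: x_def)
    also have "\<dots> = (\<Prod>p\<in>P. p ^ multiplicity p s)"
      by (rule prod.reindex_bij_betw[OF bij])
    also have "\<dots> = (\<Prod>p\<in>prime_factors s. p ^ multiplicity p s)"
      using s P by (intro prod.mono_neutral_right)
        (auto simp: smooth_numbers_def in_prime_factors_iff not_dvd_imp_multiplicity_0)
    also have "\<dots> = s" using s by (subst prime_factorization_nat) (auto simp: smooth_numbers_def)
    finally show "s \<in> prime_monomial P ` orthant (card P)"
      by (intro image_eqI[of _ _ x]) (auto simp: x_def orthant_def)
  qed
qed

lemma prime_monomial_ge_1: "1 \<le> prime_monomial P x"
  using P unfolding prime_monomial_alt by (auto simp: Suc_le_eq intro!: prod_pos prime_gt_0_nat)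

end

subsection \<open>Layers of a multiplication-invariant potential\<close>

lemma space_spin_algebra [simp]: "space (spin_algebra S) = spin_configs S"
  by (simp add: spin_algebra_def space_PiM)

lemma measurable_spin_coordinate:
  "i \<in> S \<Longrightarrow> (\<lambda>\<sigma>. \<sigma> i) \<in> spin_algebra S \<rightarrow>\<^sub>M count_space {-1, 1}"
  by (simp add: spin_algebra_def)

lemma measurable_count_space_borel: "(\<lambda>x::real. x) \<in> count_space A \<rightarrow>\<^sub>M borel"
  by simp

lemma borel_measurable_spin_coordinate:
  "i \<in> S \<Longrightarrow> (\<lambda>\<sigma>. \<sigma> i) \<in> borel_measurable (spin_algebra S)"
  by (rule measurable_compose[OF measurable_spin_coordinate measurable_count_space_borel])

lemma measurable_into_spin_algebra:
  assumes "\<And>i. i \<in> S \<Longrightarrow> (\<lambda>\<omega>. f \<omega> i) \<in> M \<rightarrow>\<^sub>M count_space {-1, 1}"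
    and "\<And>\<omega>. \<omega> \<in> space M \<Longrightarrow> f \<omega> \<in> extensional S"
  shows "f \<in> M \<rightarrow>\<^sub>M spin_algebra S"
  unfolding spin_algebra_def
proof (rule measurable_PiM_single')
  show "f \<in> space M \<rightarrow> (\<Pi>\<^sub>E i\<in>S. space (count_space {- 1, 1}))"
    using assms(2) measurable_space[OF assms(1)] by (auto simp: PiE_def Pi_def)
qed (use assms in auto)

lemma space_outside_algebra [simp]: "space (outside_algebra S \<Lambda>) = spin_configs S"
  by (simp add: outside_algebra_def)

lemma restrict_outside_measurable:
  "(\<lambda>\<sigma>. restrict \<sigma> (S - \<Lambda>)) \<in> outside_algebra S \<Lambda> \<rightarrow>\<^sub>M spin_algebra (S - \<Lambda>)"
  unfolding outside_algebra_def by (intro measurable_vimage_algebra1) auto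

lemma measurable_outside_coordinate:
  assumes "i \<in> S - \<Lambda>"
  shows "(\<lambda>\<sigma>. \<sigma> i) \<in> outside_algebra S \<Lambda> \<rightarrow>\<^sub>M count_space {-1, 1}"
  using measurable_compose[OF restrict_outside_measurable measurable_spin_coordinate[OF assms]] assms by simp

lemma reindex_outside_measurable:
  assumes "\<And>k. k \<in> K \<Longrightarrow> g k \<in> S - \<Lambda>"
  shows "(\<lambda>\<sigma>. \<lambda>k\<in>K. \<sigma> (g k)) \<in> outside_algebra S \<Lambda> \<rightarrow>\<^sub>M spin_algebra K"
  using assms by (intro measurable_into_spin_algebra) (auto intro: measurable_outside_coordinate)

lemma reindex_measurable:
  assumes "\<And>k. k \<in> K \<Longrightarrow> g k \<in> S"
  shows "(\<lambda>\<sigma>. \<lambda>k\<in>K. \<sigma> (g k)) \<in> spin_algebra S \<rightarrow>\<^sub>M spin_algebra K"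
  using assms by (intro measurable_into_spin_algebra) (auto intro: measurable_spin_coordinate)

lemma outside_algebra_subset: "sets (outside_algebra S \<Lambda>) \<subseteq> sets (spin_algebra S)"
  unfolding outside_algebra_def
proof (rule sets_image_in_sets)
  have "(\<lambda>\<sigma>. \<lambda>k\<in>S - \<Lambda>. \<sigma> k) \<in> spin_algebra S \<rightarrow>\<^sub>M spin_algebra (S - \<Lambda>)"
    by (rule reindex_measurable) auto
  then show "(\<lambda>\<sigma>. restrict \<sigma> (S - \<Lambda>)) \<in> spin_algebra S \<rightarrow>\<^sub>M spin_algebra (S - \<Lambda>)" .
qed simp

lemma merge_outside_measurable:
  assumes "\<xi> \<in> spin_configs \<Lambda>" "\<Lambda> \<subseteq> S"
  shows "(\<lambda>\<eta>. merge \<Lambda> (S - \<Lambda>) (\<xi>, \<eta>)) \<in> outside_algebra S \<Lambda> \<rightarrow>\<^sub>M spin_algebra S"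
proof (rule measurable_into_spin_algebra)
  fix i assume i: "i \<in> S"
  show "(\<lambda>\<eta>. merge \<Lambda> (S - \<Lambda>) (\<xi>, \<eta>) i) \<in> outside_algebra S \<Lambda> \<rightarrow>\<^sub>M count_space {-1, 1}"
  proof (cases "i \<in> \<Lambda>")
    case True
    then have "\<xi> i \<in> {-1, 1}" using assms by auto
    then show ?thesis using True by (simp add: merge_def)
  next
    case False
    then show ?thesis using i measurable_outside_coordinate[of i S \<Lambda>] by (simp add: merge_def)
  qed
qed (use assms in \<open>auto simp: merge_def extensional_def\<close>)

lemma finite_spin_configs: "finite \<Lambda> \<Longrightarrow> finite (spin_configs \<Lambda>)"
  by (intro finite_PiE) auto

lemma merge_spin_configs:
  "\<xi> \<in> spin_configs \<Lambda> \<Longrightarrow> \<eta> \<in> spin_configs S \<Longrightarrow> \<Lambda> \<subseteq> S \<Longrightarrow> merge \<Lambda> (S - \<Lambda>) (\<xi>, \<eta>) \<in> spin_configs S"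
  by (auto simp: PiE_def Pi_def merge_def extensional_def)

text \<open>An enumeration turns the unordered sum into a series, padded by 0 at the numbers that
  enumerate nothing. Needed because a Hamiltonian adds up infinitely many interactions.\<close>

lemma borel_measurable_infsum:
  fixes f :: "'a \<Rightarrow> 'b \<Rightarrow> real"
  assumes "countable A" "\<And>a. a \<in> A \<Longrightarrow> f a \<in> borel_measurable M"
    and "\<And>x. x \<in> space M \<Longrightarrow> (\<lambda>a. f a x) summable_on A"
  shows "(\<lambda>x. \<Sum>\<^sub>\<infinity>a\<in>A. f a x) \<in> borel_measurable M"
proof -
  define g where "g n x = (if n \<in> to_nat_on A ` A then f (from_nat_into A n) x else 0)" for n x
  have inj: "inj_on (to_nat_on A) A" using assms(1) by (rule inj_on_to_nat_on)
  have eq: "(\<Sum>\<^sub>\<infinity>a\<in>A. f a x) = suminf (\<lambda>n. g n x)" if x: "x \<in> space M" for x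
  proof -
    have comp: "((\<lambda>n. g n x) \<circ> to_nat_on A) a = f a x" if "a \<in> A" for a
      using that assms(1) by (simp add: g_def)
    have "((\<lambda>n. g n x) \<circ> to_nat_on A) summable_on A"
      using assms(3)[OF x] comp by (subst summable_on_cong[of A _ "\<lambda>a. f a x"]) auto
    then have "(\<lambda>n. g n x) summable_on (to_nat_on A ` A)" by (simp add: summable_on_reindex[OF inj])
    then have "(\<lambda>n. g n x) summable_on UNIV"
      by (rule summable_on_cong_neutral[THEN iffD1, rotated -1]) (auto simp: g_def)
    then have "suminf (\<lambda>n. g n x) = infsum (\<lambda>n. g n x) UNIV"
      by (metis has_sum_imp_sums has_sum_infsum sums_unique)
    also have "\<dots> = infsum (\<lambda>n. g n x) (to_nat_on A ` A)"
      by (intro infsum_cong_neutral) (auto simp: g_def)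
    also have "\<dots> = infsum ((\<lambda>n. g n x) \<circ> to_nat_on A) A" by (rule infsum_reindex[OF inj])
    also have "\<dots> = (\<Sum>\<^sub>\<infinity>a\<in>A. f a x)" by (intro infsum_cong comp)
    finally show ?thesis ..
  qed
  have "g n \<in> borel_measurable M" for n
  proof (cases "n \<in> to_nat_on A ` A")
    case True
    then have "from_nat_into A n \<in> A" by (metis empty_iff from_nat_into image_empty)
    then show ?thesis using assms(2) True by (simp add: g_def[abs_def])
  qed (simp add: g_def[abs_def])
  then have "(\<lambda>x. suminf (\<lambda>n. g n x)) \<in> borel_measurable M" by (intro borel_measurable_suminf) auto
  then show ?thesis by (subst measurable_cong[OF eq]) auto
qed

lemma gibbs_weight_bounds:
  assumes "finite \<Lambda>" "\<zeta> \<in> spin_configs \<Lambda>"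
  shows "0 \<le> gibbs_weight S W \<Lambda> \<zeta> \<eta>" "gibbs_weight S W \<Lambda> \<zeta> \<eta> \<le> 1"
proof -
  let ?e = "\<lambda>\<xi>. exp (- hamiltonian S W \<Lambda> (merge \<Lambda> (S - \<Lambda>) (\<xi>, \<eta>)))"
  have "?e \<zeta> \<le> (\<Sum>\<xi>\<in>spin_configs \<Lambda>. ?e \<xi>)"
    using assms finite_spin_configs by (intro member_le_sum) auto
  moreover have "?e \<zeta> > 0" by simp
  moreover have "0 < (\<Sum>\<xi>\<in>spin_configs \<Lambda>. ?e \<xi>)" using calculation by linarith
  ultimately show "0 \<le> gibbs_weight S W \<Lambda> \<zeta> \<eta>" "gibbs_weight S W \<Lambda> \<zeta> \<eta> \<le> 1"
    unfolding gibbs_weight_def by (auto intro!: divide_nonneg_pos) 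
qed

text \<open>Induction on \<Lambda>: a set that meets \<open>insert i \<Lambda>\<close> either
  contains i, where the defining summability at i applies, or already meets \<Lambda>.\<close>

lemma potential_summable:
  assumes "potential S W" "finite \<Lambda>" "\<Lambda> \<subseteq> S" "\<sigma> \<in> spin_configs S"
  shows "(\<lambda>A. W A \<sigma>) summable_on {A. finite A \<and> A \<subseteq> S \<and> A \<inter> \<Lambda> \<noteq> {}}"
  using assms(2,3)
proof (induction \<Lambda>)
  case empty
  then show ?case by simp
next
  case (insert i \<Lambda>)
  let ?I = "{A. finite A \<and> A \<subseteq> S \<and> i \<in> A}"
  have bound: "\<bar>W A \<sigma>\<bar> \<le> Max ((\<lambda>\<sigma>. \<bar>W A \<sigma>\<bar>) ` spin_configs S)" if A: "A \<in> ?I" for A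
  proof (rule Max_ge)
    \<comment> \<open>\<open>Max\<close> is an upper bound only over a finite set. The values of W A
      form one, because W A depends only on the finitely many spins in A; the other spins are frozen
      at 1.\<close>
    have "(\<lambda>\<sigma>. \<bar>W A \<sigma>\<bar>) ` spin_configs S \<subseteq>
        (\<lambda>w. \<bar>W A (\<lambda>j\<in>S. if j \<in> A then w j else 1)\<bar>) ` spin_configs A"
    proof
      fix v assume "v \<in> (\<lambda>\<sigma>. \<bar>W A \<sigma>\<bar>) ` spin_configs S"
      then obtain \<tau> where \<tau>: "\<tau> \<in> spin_configs S" "v = \<bar>W A \<tau>\<bar>" by auto
      have "(\<lambda>j\<in>S. if j \<in> A then restrict \<tau> A j else 1) \<in> spin_configs S"
        using PiE_mem[OF \<tau>(1)] by (subst restrict_PiE_iff) simp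
      moreover have "\<forall>j\<in>A. \<tau> j = (\<lambda>j\<in>S. if j \<in> A then restrict \<tau> A j else 1) j" using A by auto
      ultimately have "W A \<tau> = W A (\<lambda>j\<in>S. if j \<in> A then restrict \<tau> A j else 1)"
        using assms(1) A \<tau>(1) unfolding potential_def by blast
      moreover have "restrict \<tau> A \<in> spin_configs A" using \<tau>(1) A by auto
      ultimately show "v \<in> (\<lambda>w. \<bar>W A (\<lambda>j\<in>S. if j \<in> A then w j else 1)\<bar>) ` spin_configs A"
        using \<tau>(2) by (intro image_eqI[of _ _ "restrict \<tau> A"]) auto
    qed
    then show "finite ((\<lambda>\<sigma>. \<bar>W A \<sigma>\<bar>) ` spin_configs S)"
      using finite_subset finite_imageI[OF finite_spin_configs] A by blast
  qed (use assms(4) in auto)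
  have sum: "(\<lambda>A. Max ((\<lambda>\<sigma>. \<bar>W A \<sigma>\<bar>) ` spin_configs S)) summable_on ?I"
    using assms(1) insert.prems unfolding potential_def by blast
  have "(\<lambda>A. \<bar>W A \<sigma>\<bar>) summable_on ?I"
    using bound by (intro summable_on_comparison_test[OF sum]) auto
  then have "(\<lambda>A. W A \<sigma>) summable_on ?I" by (rule abs_summable_summable[of "\<lambda>A. W A \<sigma>", unfolded real_norm_def])
  moreover have "(\<lambda>A. W A \<sigma>) summable_on ({A. finite A \<and> A \<subseteq> S \<and> A \<inter> \<Lambda> \<noteq> {}} - ?I)"
    using insert by (intro summable_on_subset_banach[OF insert.IH]) auto
  ultimately have "(\<lambda>A. W A \<sigma>) summable_on (?I \<union> ({A. finite A \<and> A \<subseteq> S \<and> A \<inter> \<Lambda> \<noteq> {}} - ?I))"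
    by (rule summable_on_Un_disjoint) auto
  moreover have "?I \<union> ({A. finite A \<and> A \<subseteq> S \<and> A \<inter> \<Lambda> \<noteq> {}} - ?I) = {A. finite A \<and> A \<subseteq> S \<and> A \<inter> insert i \<Lambda> \<noteq> {}}"
    by auto
  ultimately show ?case by simp
qed

section \<open>Layers and the interactions inside them\<close>

locale multiplicative_potential =
  fixes U :: "nat set \<Rightarrow> (nat \<Rightarrow> real) \<Rightarrow> real" and \<A> :: "nat set set" and J :: "nat set \<Rightarrow> real"
  assumes potential_U: "potential {1..} U" and generated: "generated_by U \<A> J"
    and finite_base_primes: "finite (base_primes \<A>)"
begin

abbreviation P :: "nat set" where "P \<equiv> base_primes \<A>"
abbreviation sites :: "(nat \<Rightarrow> nat) set" where "sites \<equiv> orthant (card P)"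

definition site :: "nat \<Rightarrow> (nat \<Rightarrow> nat) \<Rightarrow> nat" where
  "site r x = r * prime_monomial P x"

definition layer :: "nat \<Rightarrow> (nat \<Rightarrow> real) \<Rightarrow> (nat \<Rightarrow> nat) \<Rightarrow> real" where
  "layer r \<sigma> = (\<lambda>x\<in>sites. \<sigma> (site r x))"

lemma base_primes_prime: "p \<in> P \<Longrightarrow> prime p"
  by (auto simp: base_primes_def in_prime_factors_iff)

lemma monomial_bij: "bij_betw (prime_monomial P) sites (smooth_numbers P)"
  using prime_monomial_bij[OF finite_base_primes base_primes_prime] by simp

lemma monomial_ge_1: "1 \<le> prime_monomial P x"
  using prime_monomial_ge_1[OF finite_base_primes base_primes_prime] by simp

lemma monomial_smooth: "x \<in> sites \<Longrightarrow> prime_monomial P x \<in> smooth_numbers P"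
  using monomial_bij by (auto simp: bij_betw_def)

lemma site_ge_1: "1 \<le> r \<Longrightarrow> 1 \<le> site r x"
  using monomial_ge_1[of x] by (simp add: site_def)

lemma site_add: "site r (\<lambda>k. x k + y k) = site r y * prime_monomial P x"
  by (simp add: site_def prime_monomial_add)

lemma site_unique:
  assumes "r \<in> rough_numbers P" "r' \<in> rough_numbers P" "x \<in> sites" "x' \<in> sites" "site r x = site r' x'"
  shows "r = r' \<and> x = x'"
proof -
  have "r = r' \<and> prime_monomial P x = prime_monomial P x'"
    using assms by (intro rough_smooth_unique[of r P _ r']) (auto simp: site_def monomial_smooth)
  then show ?thesis using monomial_bij assms by (auto simp: bij_betw_def inj_on_def)
qed

lemma site_inj: "r \<in> rough_numbers P \<Longrightarrow> inj_on (site r) sites"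
  by (auto simp: inj_on_def dest: site_unique)

lemma site_exists:
  assumes "1 \<le> i"
  obtains r x where "r \<in> rough_numbers P" "x \<in> sites" "i = site r x"
proof -
  obtain r s where "r \<in> rough_numbers P" "s \<in> smooth_numbers P" "i = r * s"
    using rough_smooth_exists[OF assms] by blast
  moreover have "s \<in> prime_monomial P ` sites" using calculation monomial_bij by (simp add: bij_betw_def)
  ultimately show ?thesis using that by (auto simp: site_def)
qed

lemma potential_zero:
  assumes "finite B" "B \<subseteq> {1..}" "\<sigma> \<in> spin_configs {1..}"
    and "\<And>i A. i \<ge> 1 \<Longrightarrow> A \<in> \<A> \<Longrightarrow> B \<noteq> (*) i ` A"
  shows "U B \<sigma> = 0"
proof -
  have "\<nexists>i A. i \<ge> 1 \<and> A \<in> \<A> \<and> B = (*) i ` A" using assms(4) by metis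
  then show ?thesis using generated assms(1-3) unfolding generated_by_def by simp
qed

lemma generator_facts:
  assumes "A \<in> \<A>"
  shows "finite A" "A \<subseteq> {1..}" "A \<noteq> {}" "A \<subseteq> smooth_numbers P"
proof -
  show fin: "finite A" "A \<subseteq> {1..}" using generated assms by (auto simp: generated_by_def)
  show "A \<subseteq> smooth_numbers P"
    using fin assms by (auto simp: smooth_numbers_def base_primes_def)
  have inj: "inj_on (\<lambda>(i::nat, A). (*) i ` A) ({1..} \<times> \<A>)" using generated by (simp add: generated_by_def)
  \<comment> \<open>Scaling the empty set by 1 and by 2 would give the same set, against
    injectivity.\<close>
  show "A \<noteq> {}"
    using inj_onD[OF inj, of "(1, A)" "(2, A)"] assms by auto
qed

lemma generator_eq: "A \<in> \<A> \<Longrightarrow> A = prime_monomial P ` exponent_set P A"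
  using generator_facts(4)[of A] monomial_bij by (auto simp: exponent_set_def bij_betw_def)

lemma exponent_set_sites: "exponent_set P A \<subseteq> sites"
  by (auto simp: exponent_set_def)

lemma translate_sites: "y \<in> sites \<Longrightarrow> translate y (exponent_set P A) \<subseteq> sites"
  using exponent_set_sites[of A] by (auto simp: translate_def orthant_def)

lemma site_translate:
  assumes "A \<in> \<A>"
  shows "site r ` translate y (exponent_set P A) = (*) (site r y) ` A"
proof -
  have "(*) (site r y) ` A = (*) (site r y) ` prime_monomial P ` exponent_set P A"
    using generator_eq[OF assms] by simp
  then show ?thesis unfolding translate_def image_image site_add by simp
qed

lemma generator_unique:
  assumes "1 \<le> i" "1 \<le> i'" "A \<in> \<A>" "A' \<in> \<A>" "(*) i ` A = (*) i' ` A'"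
  shows "i = i' \<and> A = A'"
proof -
  have inj: "inj_on (\<lambda>(i::nat, A). (*) i ` A) ({1..} \<times> \<A>)" using generated by (simp add: generated_by_def)
  show ?thesis using inj_onD[OF inj, of "(i, A)" "(i', A')"] assms by auto
qed

lemma layer_spin_configs:
  assumes "1 \<le> r" "\<sigma> \<in> spin_configs {1..}"
  shows "layer r \<sigma> \<in> spin_configs sites"
proof -
  have "site r x \<in> {1..}" for x using site_ge_1[OF assms(1)] by simp
  then have "\<sigma> (site r x) \<in> {-1, 1}" for x using assms(2) by (rule PiE_mem[rotated])
  then show ?thesis by (auto simp: layer_def)
qed

text \<open>Scaling does not mix layers: the elements of A are P-smooth, so every element of i A has
  the same rough part as i. A single common point with layer r therefore puts i itself into layer
  r.\<close>

lemma scaled_generator_in_layer: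
  assumes r: "r \<in> rough_numbers P" and i: "1 \<le> i" and A: "A \<in> \<A>"
    and meet: "(*) i ` A \<inter> site r ` sites \<noteq> {}"
  obtains y where "y \<in> sites" "i = site r y" "(*) i ` A = site r ` translate y (exponent_set P A)"
proof -
  obtain r' y where y: "r' \<in> rough_numbers P" "y \<in> sites" "i = site r' y" using site_exists[OF i] by blast
  obtain a x where a: "a \<in> A" "x \<in> sites" "i * a = site r x" using meet by auto
  then obtain z where z: "z \<in> exponent_set P A" "a = prime_monomial P z"
    using generator_eq[OF A] by blast
  have "site r' (\<lambda>k. z k + y k) = site r x" using a z y by (simp add: site_add)
  moreover have "(\<lambda>k. z k + y k) \<in> sites" using z y exponent_set_sites[of A] by (auto simp: orthant_def)
  ultimately have "r' = r" using site_unique[of r' r "\<lambda>k. z k + y k" x] y a r by blast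
  then show ?thesis using that[OF y(2)] y site_translate[OF A] by simp
qed

text \<open>Identifies V with the part of U that lives on layer r. If the set is a scaled generator,
  injectivity leaves exactly one pair (A, y) in the sum that defines \<open>layer_potential\<close>;
  otherwise there is none and both sides are 0.\<close>

lemma layer_potential_layer:
  assumes r: "r \<in> rough_numbers P" and B: "finite B" "B \<subseteq> sites" "B \<noteq> {}" and \<sigma>: "\<sigma> \<in> spin_configs {1..}"
  shows "layer_potential \<A> J B (layer r \<sigma>) = U (site r ` B) \<sigma>"
proof -
  have r1: "1 \<le> r" using rough_numbers_ge_1[OF r] .
  let ?T = "{(A, y). A \<in> \<A> \<and> y \<in> sites \<and> B = translate y (exponent_set P A)}"
  show ?thesis
  proof (cases "\<exists>i A. i \<ge> 1 \<and> A \<in> \<A> \<and> site r ` B = (*) i ` A")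
    case True
    then obtain i A where i: "i \<ge> 1" "A \<in> \<A>" "site r ` B = (*) i ` A" by blast
    have "(*) i ` A \<inter> site r ` sites \<noteq> {}" using i B by auto
    then obtain y where y: "y \<in> sites" "i = site r y" "(*) i ` A = site r ` translate y (exponent_set P A)"
      using scaled_generator_in_layer[OF r i(1,2)] by blast
    then have B_eq: "B = translate y (exponent_set P A)"
      using i(3) B(2) translate_sites[OF y(1)] by (metis inj_on_image_eq_iff site_inj[OF r])
    have "?T = {(A, y)}"
    proof (intro set_eqI iffI)
      fix q assume "q \<in> ?T"
      then obtain A' y' where q: "q = (A', y')" "A' \<in> \<A>" "y' \<in> sites" "B = translate y' (exponent_set P A')" by auto
      then have "(*) (site r y') ` A' = (*) i ` A" using site_translate[OF q(2), of r y'] i(3) by simp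
      then have "site r y' = site r y" "A' = A"
        using generator_unique[OF site_ge_1[OF r1] i(1) q(2) i(2)] y(2) by auto
      then show "q \<in> {(A, y)}" using site_unique[OF r r q(3) y(1)] q by auto
    qed (use i y B_eq in auto)
    then have "layer_potential \<A> J B (layer r \<sigma>) =
        J A * (\<Prod>x\<in>exponent_set P A. layer r \<sigma> (\<lambda>k. x k + y k))"
      by (simp add: layer_potential_def)
    also have "(\<Prod>x\<in>exponent_set P A. layer r \<sigma> (\<lambda>k. x k + y k)) =
        (\<Prod>x\<in>exponent_set P A. mult_shift i \<sigma> (prime_monomial P x))"
    proof (rule prod.cong[OF refl])
      fix x assume "x \<in> exponent_set P A"
      then have "(\<lambda>k. x k + y k) \<in> sites" using exponent_set_sites[of A] y by (auto simp: orthant_def)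
      then show "layer r \<sigma> (\<lambda>k. x k + y k) = mult_shift i \<sigma> (prime_monomial P x)"
        using monomial_ge_1[of x] y by (simp add: layer_def mult_shift_def site_add)
    qed
    also have "\<dots> = (\<Prod>j\<in>A. mult_shift i \<sigma> j)"
    proof -
      have "inj_on (prime_monomial P) (exponent_set P A)"
        using monomial_bij exponent_set_sites[of A] by (auto simp: bij_betw_def intro: inj_on_subset)
      then have "(\<Prod>x\<in>exponent_set P A. mult_shift i \<sigma> (prime_monomial P x)) =
          (\<Prod>j\<in>prime_monomial P ` exponent_set P A. mult_shift i \<sigma> j)"
        by (simp add: prod.reindex)
      then show ?thesis using generator_eq[OF i(2)] by simp
    qed
    also have "J A * \<dots> = U (site r ` B) \<sigma>"
      using generated i \<sigma> by (simp add: generated_by_def)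
    finally show ?thesis .
  next
    case False
    have "?T = {}"
    proof -
      have False if "A \<in> \<A>" "y \<in> sites" "B = translate y (exponent_set P A)" for A y
        using False that site_translate[OF that(1), of r y] site_ge_1[OF r1] by blast
      then show ?thesis by auto
    qed
    then have "layer_potential \<A> J B (layer r \<sigma>) = 0" by (simp only: layer_potential_def sum.empty)
    moreover have "U (site r ` B) \<sigma> = 0"
    proof -
      have "finite (site r ` B)" "site r ` B \<subseteq> {1..}" using B site_ge_1[OF r1] by auto
      then show ?thesis using False by (intro potential_zero[OF _ _ \<sigma>]) auto
    qed
    ultimately show ?thesis by simp
  qed
qed

text \<open>An interaction that meets the window without being the image of a set of sites vanishes,
  by \<open>scaled_generator_in_layer\<close>; the others are reindexed along \<open>site r\<close>.
  Summability of V is inherited from U along the same reindexing.\<close>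

lemma
  assumes r: "r \<in> rough_numbers P" and \<Lambda>: "finite \<Lambda>" "\<Lambda> \<subseteq> sites" and \<sigma>: "\<sigma> \<in> spin_configs {1..}"
  shows hamiltonian_layer: "hamiltonian {1..} U (site r ` \<Lambda>) \<sigma> = hamiltonian sites (layer_potential \<A> J) \<Lambda> (layer r \<sigma>)"
    and layer_potential_summable: "(\<lambda>B. layer_potential \<A> J B (layer r \<sigma>)) summable_on
      {B. finite B \<and> B \<subseteq> sites \<and> B \<inter> \<Lambda> \<noteq> {}}"
proof -
  have r1: "1 \<le> r" using rough_numbers_ge_1[OF r] .
  let ?B = "{B. finite B \<and> B \<subseteq> sites \<and> B \<inter> \<Lambda> \<noteq> {}}"
  let ?A = "{A. finite A \<and> A \<subseteq> {1..} \<and> A \<inter> site r ` \<Lambda> \<noteq> {}}"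
  have inj: "inj_on ((`) (site r)) ?B"
    using site_inj[OF r] by (auto simp: inj_on_def inj_on_image_eq_iff)
  have sub: "(`) (site r) ` ?B \<subseteq> ?A"
    using site_ge_1[OF r1] by (auto simp: disjoint_iff)
  have eq: "layer_potential \<A> J B (layer r \<sigma>) = U (site r ` B) \<sigma>" if "B \<in> ?B" for B
    using that by (intro layer_potential_layer[OF r _ _ _ \<sigma>]) auto
  have zero: "U A \<sigma> = 0" if A: "A \<in> ?A - (`) (site r) ` ?B" for A
  proof (rule ccontr)
    assume "U A \<sigma> \<noteq> 0"
    then obtain i A0 where i: "i \<ge> 1" "A0 \<in> \<A>" "A = (*) i ` A0"
      using potential_zero[OF _ _ \<sigma>, of A] A by auto
    moreover have "A \<inter> site r ` sites \<noteq> {}" using A \<Lambda>(2) by blast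
    ultimately obtain y where y: "y \<in> sites" "A = site r ` translate y (exponent_set P A0)"
      using scaled_generator_in_layer[OF r i(1,2)] by blast
    have sub': "translate y (exponent_set P A0) \<subseteq> sites" by (rule translate_sites[OF y(1)])
    have "finite (translate y (exponent_set P A0))"
      using A y(2) finite_image_iff[OF inj_on_subset[OF site_inj[OF r] sub']] by auto
    moreover have "translate y (exponent_set P A0) \<inter> \<Lambda> \<noteq> {}"
    proof -
      obtain l b where "l \<in> \<Lambda>" "b \<in> translate y (exponent_set P A0)" "site r l = site r b"
      proof -
        obtain l where l: "l \<in> \<Lambda>" "site r l \<in> A" using A by auto
        then have "site r l \<in> site r ` translate y (exponent_set P A0)" using y(2) by simp
        then show ?thesis using l(1) that by blast
      qed
      then show ?thesis using site_unique[OF r r, of l b] \<Lambda> sub' by auto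
    qed
    ultimately show False using A y(2) sub' by auto
  qed
  have "hamiltonian sites (layer_potential \<A> J) \<Lambda> (layer r \<sigma>) = infsum ((\<lambda>A. U A \<sigma>) \<circ> (`) (site r)) ?B"
    unfolding hamiltonian_def by (intro infsum_cong) (simp add: eq)
  also have "\<dots> = infsum (\<lambda>A. U A \<sigma>) ((`) (site r) ` ?B)" by (rule infsum_reindex[OF inj, symmetric])
  also have "\<dots> = infsum (\<lambda>A. U A \<sigma>) ?A"
    using sub zero by (intro infsum_cong_neutral) auto
  finally show "hamiltonian {1..} U (site r ` \<Lambda>) \<sigma> = hamiltonian sites (layer_potential \<A> J) \<Lambda> (layer r \<sigma>)"
    by (simp add: hamiltonian_def)
  have "(\<lambda>A. U A \<sigma>) summable_on ?A"
    using \<Lambda> \<sigma> site_ge_1[OF r1] by (intro potential_summable[OF potential_U]) auto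
  then have "(\<lambda>A. U A \<sigma>) summable_on ((`) (site r) ` ?B)" using sub by (rule summable_on_subset_banach)
  then have "((\<lambda>A. U A \<sigma>) \<circ> (`) (site r)) summable_on ?B" by (simp only: summable_on_reindex[OF inj])
  then show "(\<lambda>B. layer_potential \<A> J B (layer r \<sigma>)) summable_on ?B"
    by (rule summable_on_cong[THEN iffD1, rotated]) (simp add: eq)
qed

end

section \<open>Gibbs weights and events of a single layer\<close>

context multiplicative_potential
begin

definition push :: "nat \<Rightarrow> (nat \<Rightarrow> nat) set \<Rightarrow> ((nat \<Rightarrow> nat) \<Rightarrow> real) \<Rightarrow> nat \<Rightarrow> real" where
  "push r \<Lambda> \<zeta> = (\<lambda>j\<in>site r ` \<Lambda>. \<zeta> (the_inv_into sites (site r) j))"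

lemma push_site:
  "r \<in> rough_numbers P \<Longrightarrow> \<Lambda> \<subseteq> sites \<Longrightarrow> x \<in> \<Lambda> \<Longrightarrow> push r \<Lambda> \<zeta> (site r x) = \<zeta> x"
  using the_inv_into_f_f[OF site_inj, of r x] by (auto simp: push_def)

lemma push_spin_configs:
  assumes "r \<in> rough_numbers P" "\<Lambda> \<subseteq> sites" "\<zeta> \<in> spin_configs \<Lambda>"
  shows "push r \<Lambda> \<zeta> \<in> spin_configs (site r ` \<Lambda>)"
proof (rule PiE_I)
  fix j assume "j \<in> site r ` \<Lambda>"
  then obtain x where "x \<in> \<Lambda>" "j = site r x" by auto
  then show "push r \<Lambda> \<zeta> j \<in> {-1, 1}" using push_site[OF assms(1,2)] PiE_mem[OF assms(3)] by simp
qed (simp add: push_def)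

lemma push_bij:
  assumes r: "r \<in> rough_numbers P" and \<Lambda>: "\<Lambda> \<subseteq> sites"
  shows "bij_betw (push r \<Lambda>) (spin_configs \<Lambda>) (spin_configs (site r ` \<Lambda>))"
proof (rule bij_betwI[where g = "\<lambda>\<xi>. \<lambda>x\<in>\<Lambda>. \<xi> (site r x)"])
  show "push r \<Lambda> \<in> spin_configs \<Lambda> \<rightarrow> spin_configs (site r ` \<Lambda>)"
    using push_spin_configs[OF r \<Lambda>] by blast
  show "(\<lambda>\<xi>. \<lambda>x\<in>\<Lambda>. \<xi> (site r x)) \<in> spin_configs (site r ` \<Lambda>) \<rightarrow> spin_configs \<Lambda>"
  proof
    fix \<xi> assume \<xi>: "\<xi> \<in> spin_configs (site r ` \<Lambda>)"
    have "\<xi> (site r x) \<in> {-1, 1}" if "x \<in> \<Lambda>" for x using PiE_mem[OF \<xi> imageI[OF that]] .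
    then show "(\<lambda>x\<in>\<Lambda>. \<xi> (site r x)) \<in> spin_configs \<Lambda>" by (subst restrict_PiE_iff) simp
  qed
  show "(\<lambda>x\<in>\<Lambda>. push r \<Lambda> \<zeta> (site r x)) = \<zeta>" if "\<zeta> \<in> spin_configs \<Lambda>" for \<zeta>
  proof
    fix x show "(\<lambda>x\<in>\<Lambda>. push r \<Lambda> \<zeta> (site r x)) x = \<zeta> x"
      using push_site[OF r \<Lambda>, of x \<zeta>] PiE_arb[OF that, of x] by (cases "x \<in> \<Lambda>") auto
  qed
  show "push r \<Lambda> (\<lambda>x\<in>\<Lambda>. \<xi> (site r x)) = \<xi>" if \<xi>: "\<xi> \<in> spin_configs (site r ` \<Lambda>)" for \<xi>
  proof
    fix j show "push r \<Lambda> (\<lambda>x\<in>\<Lambda>. \<xi> (site r x)) j = \<xi> j"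
    proof (cases "j \<in> site r ` \<Lambda>")
      case True
      then obtain x where "x \<in> \<Lambda>" "j = site r x" by auto
      then show ?thesis using push_site[OF r \<Lambda>] by simp
    qed (simp add: push_def PiE_arb[OF \<xi>])
  qed
qed

lemma layer_merge:
  assumes r: "r \<in> rough_numbers P" and \<Lambda>: "\<Lambda> \<subseteq> sites"
  shows "layer r (merge (site r ` \<Lambda>) ({1..} - site r ` \<Lambda>) (push r \<Lambda> \<xi>, \<eta>)) =
    merge \<Lambda> (sites - \<Lambda>) (\<xi>, layer r \<eta>)"
proof
  fix x
  have mem: "site r x \<in> site r ` \<Lambda> \<longleftrightarrow> x \<in> \<Lambda>" if "x \<in> sites"
    using inj_on_image_mem_iff[OF site_inj[OF r] that \<Lambda>] .
  have "site r x \<in> {1..}" using site_ge_1[OF rough_numbers_ge_1[OF r]] by simp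
  then show "layer r (merge (site r ` \<Lambda>) ({1..} - site r ` \<Lambda>) (push r \<Lambda> \<xi>, \<eta>)) x =
    merge \<Lambda> (sites - \<Lambda>) (\<xi>, layer r \<eta>) x"
    using mem push_site[OF r \<Lambda>, of x \<xi>] \<Lambda> by (auto simp: layer_def merge_def)
qed

text \<open>The numerators agree by \<open>hamiltonian_layer\<close>, the normalising sums because
  \<open>push\<close> is a bijection between the configurations on the two windows. So in a window
  of layer r the weight of U sees the outside only through layer r.\<close>

lemma gibbs_weight_layer:
  assumes r: "r \<in> rough_numbers P" and \<Lambda>: "finite \<Lambda>" "\<Lambda> \<subseteq> sites"
    and \<zeta>: "\<zeta> \<in> spin_configs \<Lambda>" and \<eta>: "\<eta> \<in> spin_configs {1..}"
  shows "gibbs_weight {1..} U (site r ` \<Lambda>) (push r \<Lambda> \<zeta>) \<eta> =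
    gibbs_weight sites (layer_potential \<A> J) \<Lambda> \<zeta> (layer r \<eta>)"
proof -
  have sub: "site r ` \<Lambda> \<subseteq> {1..}" using site_ge_1[OF rough_numbers_ge_1[OF r]] by auto
  have eq: "hamiltonian {1..} U (site r ` \<Lambda>) (merge (site r ` \<Lambda>) ({1..} - site r ` \<Lambda>) (push r \<Lambda> \<xi>, \<eta>)) =
      hamiltonian sites (layer_potential \<A> J) \<Lambda> (merge \<Lambda> (sites - \<Lambda>) (\<xi>, layer r \<eta>))"
    if "\<xi> \<in> spin_configs \<Lambda>" for \<xi>
    using hamiltonian_layer[OF r \<Lambda> merge_spin_configs[OF push_spin_configs[OF r \<Lambda>(2) that] \<eta> sub]]
    unfolding layer_merge[OF r \<Lambda>(2)] .
  show ?thesis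
    unfolding gibbs_weight_def
    unfolding sum.reindex_bij_betw[OF push_bij[OF r \<Lambda>(2)], symmetric] eq[OF \<zeta>]
    by (intro arg_cong2[where f = "(/)"] sum.cong refl) (simp only: eq)
qed

lemma restrict_layer_eq_iff:
  assumes r: "r \<in> rough_numbers P" and \<Lambda>: "\<Lambda> \<subseteq> sites" and \<zeta>: "\<zeta> \<in> spin_configs \<Lambda>"
  shows "restrict (layer r \<sigma>) \<Lambda> = \<zeta> \<longleftrightarrow> restrict \<sigma> (site r ` \<Lambda>) = push r \<Lambda> \<zeta>"
proof -
  have "restrict (layer r \<sigma>) \<Lambda> = \<zeta> \<longleftrightarrow> (\<forall>x\<in>\<Lambda>. \<sigma> (site r x) = \<zeta> x)"
    using \<Lambda> PiE_arb[OF \<zeta>] by (auto simp: layer_def fun_eq_iff restrict_def)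
  also have "\<dots> \<longleftrightarrow> (\<forall>j\<in>site r ` \<Lambda>. \<sigma> j = push r \<Lambda> \<zeta> j)"
    using push_site[OF r \<Lambda>] by simp
  also have "\<dots> \<longleftrightarrow> restrict \<sigma> (site r ` \<Lambda>) = push r \<Lambda> \<zeta>"
    by (auto simp: fun_eq_iff restrict_def push_def)
  finally show ?thesis .
qed

lemma countable_sites: "countable sites"
  using monomial_bij by (intro countable_image_inj_on[of "prime_monomial P"]) (auto simp: bij_betw_def)

text \<open>Lets facts about configurations of the form \<open>layer 1 \<sigma>\<close>, such as
  \<open>layer_potential_summable\<close>, be used for every configuration on the orthant. The spins
  off layer 1 are set to 1.\<close>

lemma layer_extension:
  assumes "\<tau> \<in> spin_configs sites"
  obtains \<sigma> where "\<sigma> \<in> spin_configs {1..}" "layer 1 \<sigma> = \<tau>"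
proof -
  define \<sigma> where "\<sigma> = (\<lambda>j\<in>{1..}. if j \<in> site 1 ` sites then push 1 sites \<tau> j else 1)"
  have "push 1 sites \<tau> \<in> spin_configs (site 1 ` sites)" using assms by (intro push_spin_configs) auto
  then have "push 1 sites \<tau> j \<in> {-1, 1}" if "j \<in> site 1 ` sites" for j using that by (rule PiE_mem)
  then have "\<sigma> \<in> spin_configs {1..}" unfolding \<sigma>_def by (subst restrict_PiE_iff) auto
  moreover have "layer 1 \<sigma> = \<tau>"
  proof
    fix x show "layer 1 \<sigma> x = \<tau> x"
      using push_site[of 1 sites x \<tau>] site_ge_1[of 1 x] PiE_arb[OF assms, of x]
      by (cases "x \<in> sites") (auto simp: layer_def \<sigma>_def)
  qed
  ultimately show ?thesis by (rule that)
qed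

lemma layer_potential_measurable: "layer_potential \<A> J B \<in> borel_measurable (spin_algebra sites)"
  unfolding layer_potential_def[abs_def] case_prod_unfold
proof (intro borel_measurable_sum borel_measurable_times borel_measurable_const borel_measurable_prod
    borel_measurable_spin_coordinate)
  fix q x assume "q \<in> {q. fst q \<in> \<A> \<and> snd q \<in> sites \<and> B = translate (snd q) (exponent_set P (fst q))}"
    and "x \<in> exponent_set P (fst q)"
  then show "(\<lambda>k. x k + snd q k) \<in> sites" using exponent_set_sites[of "fst q"] by (auto simp: orthant_def)
qed

lemma hamiltonian_merge_measurable:
  assumes \<Lambda>: "finite \<Lambda>" "\<Lambda> \<subseteq> sites" and \<xi>: "\<xi> \<in> spin_configs \<Lambda>"
  shows "(\<lambda>\<eta>. hamiltonian sites (layer_potential \<A> J) \<Lambda> (merge \<Lambda> (sites - \<Lambda>) (\<xi>, \<eta>)))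
    \<in> borel_measurable (outside_algebra sites \<Lambda>)"
  unfolding hamiltonian_def
proof (rule borel_measurable_infsum)
  have "countable {B. finite B \<and> B \<subseteq> sites}"
    using countable_Collect_finite_subset[OF countable_sites] by simp
  then show "countable {B. finite B \<and> B \<subseteq> sites \<and> B \<inter> \<Lambda> \<noteq> {}}" by (rule countable_subset[rotated]) auto
  show "(\<lambda>\<eta>. layer_potential \<A> J B (merge \<Lambda> (sites - \<Lambda>) (\<xi>, \<eta>))) \<in> borel_measurable (outside_algebra sites \<Lambda>)" for B
    by (rule measurable_compose[OF merge_outside_measurable[OF \<xi> \<Lambda>(2)] layer_potential_measurable])
  fix \<eta> assume "\<eta> \<in> space (outside_algebra sites \<Lambda>)"
  then have "merge \<Lambda> (sites - \<Lambda>) (\<xi>, \<eta>) \<in> spin_configs sites"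
    using merge_spin_configs[OF \<xi> _ \<Lambda>(2)] by simp
  then obtain \<sigma> where \<sigma>: "\<sigma> \<in> spin_configs {1..}" "layer 1 \<sigma> = merge \<Lambda> (sites - \<Lambda>) (\<xi>, \<eta>)"
    by (rule layer_extension)
  show "(\<lambda>B. layer_potential \<A> J B (merge \<Lambda> (sites - \<Lambda>) (\<xi>, \<eta>)))
      summable_on {B. finite B \<and> B \<subseteq> sites \<and> B \<inter> \<Lambda> \<noteq> {}}"
    using layer_potential_summable[OF _ \<Lambda> \<sigma>(1), of 1] \<sigma>(2) by simp
qed

lemma gibbs_weight_measurable:
  assumes \<Lambda>: "finite \<Lambda>" "\<Lambda> \<subseteq> sites" and \<zeta>: "\<zeta> \<in> spin_configs \<Lambda>"
  shows "gibbs_weight sites (layer_potential \<A> J) \<Lambda> \<zeta> \<in> borel_measurable (outside_algebra sites \<Lambda>)"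
proof -
  have "(\<lambda>\<eta>. exp (- hamiltonian sites (layer_potential \<A> J) \<Lambda> (merge \<Lambda> (sites - \<Lambda>) (\<xi>, \<eta>))))
      \<in> borel_measurable (outside_algebra sites \<Lambda>)" if "\<xi> \<in> spin_configs \<Lambda>" for \<xi>
    using hamiltonian_merge_measurable[OF \<Lambda> that] by measurable
  then show ?thesis
    unfolding gibbs_weight_def[abs_def] using \<zeta>
    by (intro borel_measurable_divide borel_measurable_sum) auto
qed

lemma layer_measurable:
  assumes "1 \<le> r" shows "layer r \<in> spin_algebra {1..} \<rightarrow>\<^sub>M spin_algebra sites"
  unfolding layer_def[abs_def] using site_ge_1[OF assms] by (intro reindex_measurable) auto

text \<open>Different layers occupy disjoint sites, so a window in layer r leaves every other layer
  entirely outside.\<close>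

lemma layer_outside_measurable:
  assumes "r \<in> rough_numbers P" "r' \<in> rough_numbers P" "r \<noteq> r'" "\<Lambda> \<subseteq> sites"
  shows "layer r' \<in> outside_algebra {1..} (site r ` \<Lambda>) \<rightarrow>\<^sub>M spin_algebra sites"
  unfolding layer_def[abs_def]
proof (rule reindex_outside_measurable)
  fix x assume "x \<in> sites"
  then have "site r' x \<notin> site r ` \<Lambda>" using assms site_unique[of r' r x] by blast
  then show "site r' x \<in> {1..} - site r ` \<Lambda>"
    using site_ge_1[OF rough_numbers_ge_1[OF assms(2)], of x] by simp
qed

lemma layer_preimage_outside:
  assumes r: "r \<in> rough_numbers P" and \<Lambda>: "\<Lambda> \<subseteq> sites" and C: "C \<in> sets (outside_algebra sites \<Lambda>)"
  shows "layer r -` C \<inter> spin_configs {1..} \<in> sets (outside_algebra {1..} (site r ` \<Lambda>))"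
proof -
  have "layer r \<in> outside_algebra {1..} (site r ` \<Lambda>) \<rightarrow>\<^sub>M outside_algebra sites \<Lambda>"
    unfolding outside_algebra_def[of sites]
  proof (rule measurable_vimage_algebra2)
    show "layer r \<in> space (outside_algebra {1..} (site r ` \<Lambda>)) \<rightarrow> spin_configs sites"
      using layer_spin_configs[OF rough_numbers_ge_1[OF r]] by simp
    have "(\<lambda>\<sigma>. \<lambda>x\<in>sites - \<Lambda>. \<sigma> (site r x)) \<in> outside_algebra {1..} (site r ` \<Lambda>) \<rightarrow>\<^sub>M spin_algebra (sites - \<Lambda>)"
    proof (rule reindex_outside_measurable)
      fix x assume "x \<in> sites - \<Lambda>"
      then show "site r x \<in> {1..} - site r ` \<Lambda>"
        using site_ge_1[OF rough_numbers_ge_1[OF r], of x] inj_on_image_mem_iff[OF site_inj[OF r] _ \<Lambda>, of x] by auto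
    qed
    moreover have "restrict (layer r \<sigma>) (sites - \<Lambda>) = (\<lambda>x\<in>sites - \<Lambda>. \<sigma> (site r x))" for \<sigma>
      by (auto simp: layer_def)
    ultimately show "(\<lambda>\<sigma>. restrict (layer r \<sigma>) (sites - \<Lambda>)) \<in>
        outside_algebra {1..} (site r ` \<Lambda>) \<rightarrow>\<^sub>M spin_algebra (sites - \<Lambda>)" by simp
  qed
  from measurable_sets[OF this C] show ?thesis by simp
qed

end

subsection \<open>Independence of the layers\<close>

lemma cylinder_measurable:
  assumes "finite \<Lambda>" "\<Lambda> \<subseteq> S"
  shows "{\<sigma> \<in> spin_configs S. restrict \<sigma> \<Lambda> = \<zeta>} \<in> sets (spin_algebra S)"
proof (cases "\<zeta> \<in> extensional \<Lambda>")
  case True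
  have "{\<sigma> \<in> spin_configs S. restrict \<sigma> \<Lambda> = \<zeta>} = {\<sigma> \<in> space (spin_algebra S). \<forall>x\<in>\<Lambda>. \<sigma> x = \<zeta> x}"
    using True by (auto simp: fun_eq_iff restrict_def extensional_def)
  moreover have "{\<sigma> \<in> space (spin_algebra S). \<sigma> x = \<zeta> x} \<in> sets (spin_algebra S)" if "x \<in> \<Lambda>" for x
  proof -
    have [measurable]: "(\<lambda>\<sigma>. \<sigma> x) \<in> borel_measurable (spin_algebra S)"
      using that assms by (intro borel_measurable_spin_coordinate) auto
    show ?thesis by measurable
  qed
  ultimately show ?thesis by (simp only:) (intro sets.sets_Collect_finite_All assms(1), auto)
next
  case False
  then have "{\<sigma> \<in> spin_configs S. restrict \<sigma> \<Lambda> = \<zeta>} = {}" using restrict_extensional by blast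
  then show ?thesis by (simp only: sets.empty_sets)
qed

lemma outside_subalgebra: "sets M = sets (spin_algebra S) \<Longrightarrow> subalgebra M (outside_algebra S \<Lambda>)"
  using outside_algebra_subset[of S \<Lambda>] sets_eq_imp_space_eq[of M "spin_algebra S"] by (simp add: subalgebra_def)

lemma gibbs_measureD:
  assumes "gibbs_measure S W M"
  shows "prob_space M" "sets M = sets (spin_algebra S)" "space M = spin_configs S"
proof -
  show "prob_space M" "sets M = sets (spin_algebra S)"
    using assms by (auto simp: gibbs_measure_def space_prob_algebra)
  then show "space M = spin_configs S" using sets_eq_imp_space_eq[of M "spin_algebra S"] by simp
qed

text \<open>The Gibbs property integrated over an event D outside the window. In this form
  conditional expectations are gone and the identity can be carried from U to V;
  \<open>gibbs_measureI\<close> is the way back.\<close>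

lemma gibbs_measure_cylinder:
  assumes gibbs: "gibbs_measure S W M" and \<Lambda>: "finite \<Lambda>" "\<Lambda> \<subseteq> S" "\<zeta> \<in> spin_configs \<Lambda>"
    and D: "D \<in> sets (outside_algebra S \<Lambda>)" and meas: "gibbs_weight S W \<Lambda> \<zeta> \<in> borel_measurable M"
  shows "measure M (D \<inter> {\<sigma> \<in> spin_configs S. restrict \<sigma> \<Lambda> = \<zeta>}) =
    (\<integral>\<eta>. indicat_real D \<eta> * gibbs_weight S W \<Lambda> \<zeta> \<eta> \<partial>M)"
proof -
  note M = gibbs_measureD[OF gibbs]
  interpret prob_space M by (rule M)
  interpret finite_measure_subalgebra M "outside_algebra S \<Lambda>"
    by unfold_locales (rule outside_subalgebra[OF M(2)])
  let ?E = "{\<sigma> \<in> spin_configs S. restrict \<sigma> \<Lambda> = \<zeta>}"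
  have E: "?E \<in> sets M" using cylinder_measurable[OF \<Lambda>(1,2)] M by simp
  have DM: "D \<in> sets M" using D outside_algebra_subset M by blast
  have "measure M (D \<inter> ?E) = (\<integral>\<eta>. indicat_real (D \<inter> ?E) \<eta> \<partial>M)"
    using DM E by simp
  also have "\<dots> = (\<integral>\<eta>\<in>D. indicat_real ?E \<eta> \<partial>M)"
    unfolding set_lebesgue_integral_def
    by (intro Bochner_Integration.integral_cong refl) (simp add: indicator_def)
  also have "\<dots> = (\<integral>\<eta>\<in>D. real_cond_exp M (outside_algebra S \<Lambda>) (indicator ?E) \<eta> \<partial>M)"
    using E by (intro real_cond_exp_intA D) (simp add: emeasure_eq_measure less_top[symmetric])
  also have "\<dots> = (\<integral>\<eta>. indicat_real D \<eta> * gibbs_weight S W \<Lambda> \<zeta> \<eta> \<partial>M)"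
    unfolding set_lebesgue_integral_def real_scaleR_def
  proof (rule integral_cong_AE)
    have "AE \<eta> in M. real_cond_exp M (outside_algebra S \<Lambda>) (indicator ?E) \<eta> = gibbs_weight S W \<Lambda> \<zeta> \<eta>"
      using gibbs \<Lambda> by (simp add: gibbs_measure_def)
    then show "AE \<eta> in M. indicator D \<eta> * real_cond_exp M (outside_algebra S \<Lambda>) (indicator ?E) \<eta> =
        indicator D \<eta> * gibbs_weight S W \<Lambda> \<zeta> \<eta>" by eventually_elim simp
  qed (use DM meas in \<open>auto intro!: borel_measurable_times borel_measurable_indicator borel_measurable_cond_exp2\<close>)
  finally show ?thesis .
qed

lemma gibbs_measureI:
  assumes M: "prob_space M" "sets M = sets (spin_algebra S)"
    and meas: "\<And>\<Lambda> \<zeta>. finite \<Lambda> \<Longrightarrow> \<Lambda> \<subseteq> S \<Longrightarrow> \<zeta> \<in> spin_configs \<Lambda> \<Longrightarrow>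
        gibbs_weight S W \<Lambda> \<zeta> \<in> borel_measurable (outside_algebra S \<Lambda>)"
    and eq: "\<And>\<Lambda> \<zeta> D. finite \<Lambda> \<Longrightarrow> \<Lambda> \<subseteq> S \<Longrightarrow> \<zeta> \<in> spin_configs \<Lambda> \<Longrightarrow> D \<in> sets (outside_algebra S \<Lambda>) \<Longrightarrow>
        measure M (D \<inter> {\<sigma> \<in> spin_configs S. restrict \<sigma> \<Lambda> = \<zeta>}) =
        (\<integral>\<eta>. indicat_real D \<eta> * gibbs_weight S W \<Lambda> \<zeta> \<eta> \<partial>M)"
  shows "gibbs_measure S W M"
  unfolding gibbs_measure_def
proof (intro conjI allI impI)
  show "M \<in> space (prob_algebra (spin_algebra S))" using M by (simp add: space_prob_algebra)
  interpret prob_space M by (rule M)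
  fix \<Lambda> \<zeta> assume "finite \<Lambda> \<and> \<Lambda> \<subseteq> S \<and> \<zeta> \<in> spin_configs \<Lambda>"
  then have \<Lambda>: "finite \<Lambda>" "\<Lambda> \<subseteq> S" "\<zeta> \<in> spin_configs \<Lambda>" by auto
  interpret finite_measure_subalgebra M "outside_algebra S \<Lambda>"
    by unfold_locales (rule outside_subalgebra[OF M(2)])
  let ?E = "{\<sigma> \<in> spin_configs S. restrict \<sigma> \<Lambda> = \<zeta>}"
  have E: "?E \<in> sets M" using cylinder_measurable[OF \<Lambda>(1,2)] M by simp
  have gM: "gibbs_weight S W \<Lambda> \<zeta> \<in> borel_measurable M"
    by (rule measurable_from_subalg[OF outside_subalgebra[OF M(2)] meas[OF \<Lambda>]])
  show "AE \<eta> in M. real_cond_exp M (outside_algebra S \<Lambda>) (indicator ?E) \<eta> = gibbs_weight S W \<Lambda> \<zeta> \<eta>"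
  proof (rule real_cond_exp_charact)
    fix D assume D: "D \<in> sets (outside_algebra S \<Lambda>)"
    then have DM: "D \<in> sets M" using outside_algebra_subset M by blast
    have "(\<integral>\<eta>\<in>D. indicat_real ?E \<eta> \<partial>M) = (\<integral>\<eta>. indicat_real (D \<inter> ?E) \<eta> \<partial>M)"
      unfolding set_lebesgue_integral_def
    by (intro Bochner_Integration.integral_cong refl) (simp add: indicator_def)
    also have "\<dots> = measure M (D \<inter> ?E)" using DM E by simp
    finally show "(\<integral>\<eta>\<in>D. indicat_real ?E \<eta> \<partial>M) = (\<integral>\<eta>\<in>D. gibbs_weight S W \<Lambda> \<zeta> \<eta> \<partial>M)"
      by (simp add: eq[OF \<Lambda> D] set_lebesgue_integral_def)
  next
    show "integrable M (indicator ?E :: _ \<Rightarrow> real)" using E by (simp add: emeasure_eq_measure less_top[symmetric])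
    show "integrable M (gibbs_weight S W \<Lambda> \<zeta>)"
      using gibbs_weight_bounds[OF \<Lambda>(1,3)] by (intro integrable_const_bound[of _ 1] gM) auto
  qed (rule meas[OF \<Lambda>])
qed

context multiplicative_potential
begin

text \<open>The law of layer r under \<mu> given B, written through a density so that its integrals
  reduce to integrals against \<mu>.\<close>

definition conditioned_law :: "(nat \<Rightarrow> real) measure \<Rightarrow> (nat \<Rightarrow> real) set \<Rightarrow> nat \<Rightarrow> ((nat \<Rightarrow> nat) \<Rightarrow> real) measure" where
  "conditioned_law \<mu> B r =
    distr (density \<mu> (\<lambda>\<sigma>. ennreal (indicator B \<sigma> / measure \<mu> B))) (spin_algebra sites) (layer r)"

lemma
  assumes gibbs: "gibbs_measure {1..} U \<mu>" and r: "1 \<le> r" and B: "B \<in> sets \<mu>" "measure \<mu> B > 0"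
  shows prob_space_conditioned_law: "prob_space (conditioned_law \<mu> B r)"
    and integral_conditioned_law: "g \<in> borel_measurable (spin_algebra sites) \<Longrightarrow>
      (\<integral>\<tau>. g \<tau> \<partial>conditioned_law \<mu> B r) = (\<integral>\<sigma>. indicat_real B \<sigma> * g (layer r \<sigma>) \<partial>\<mu>) / measure \<mu> B"
proof -
  note \<mu> = gibbs_measureD[OF gibbs]
  interpret \<mu>: prob_space \<mu> by (rule \<mu>)
  let ?q = "\<lambda>\<sigma>. indicator B \<sigma> / measure \<mu> B"
  have q: "?q \<in> borel_measurable \<mu>" using B(1) by simp
  have layer: "layer r \<in> \<mu> \<rightarrow>\<^sub>M spin_algebra sites"
    using layer_measurable[OF r] measurable_cong_sets[OF \<mu>(2) refl] by blast
  have "emeasure (density \<mu> (\<lambda>\<sigma>. ennreal (?q \<sigma>))) (space \<mu>) = (\<integral>\<^sup>+\<sigma>. ennreal (?q \<sigma>) \<partial>\<mu>)"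
    using q by (subst emeasure_density) (auto intro!: nn_integral_cong)
  also have "\<dots> = ennreal (\<integral>\<sigma>. ?q \<sigma> \<partial>\<mu>)"
    using B by (intro nn_integral_eq_integral) (auto simp: \<mu>.emeasure_eq_measure less_top[symmetric])
  also have "(\<integral>\<sigma>. ?q \<sigma> \<partial>\<mu>) = 1" using B by simp
  finally have p: "prob_space (density \<mu> (\<lambda>\<sigma>. ennreal (?q \<sigma>)))" by (intro prob_spaceI) simp
  then show "prob_space (conditioned_law \<mu> B r)"
    unfolding conditioned_law_def using layer by (intro prob_space.prob_space_distr) simp_all
  assume g: "g \<in> borel_measurable (spin_algebra sites)"
  have gl: "(\<lambda>\<sigma>. g (layer r \<sigma>)) \<in> borel_measurable \<mu>" by (rule measurable_compose[OF layer g])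
  have "(\<integral>\<tau>. g \<tau> \<partial>conditioned_law \<mu> B r) = (\<integral>\<sigma>. g (layer r \<sigma>) \<partial>density \<mu> (\<lambda>\<sigma>. ennreal (?q \<sigma>)))"
    unfolding conditioned_law_def using layer g by (intro integral_distr) simp_all
  also have "\<dots> = (\<integral>\<sigma>. ?q \<sigma> *\<^sub>R g (layer r \<sigma>) \<partial>\<mu>)"
    using q gl B(2) by (intro integral_density) auto
  finally show "(\<integral>\<tau>. g \<tau> \<partial>conditioned_law \<mu> B r) = (\<integral>\<sigma>. indicat_real B \<sigma> * g (layer r \<sigma>) \<partial>\<mu>) / measure \<mu> B"
    by simp
qed

text \<open>Intersecting with B turns an event outside a window of layer r into another such event,
  so the integrated Gibbs identity of \<mu> still applies. By \<open>gibbs_weight_layer\<close> its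
  right-hand side is a function of layer r, and it becomes the identity for V.\<close>

lemma conditioned_law_gibbs:
  assumes gibbs: "gibbs_measure {1..} U \<mu>" and r: "r \<in> rough_numbers P"
    and B: "B \<in> sets \<mu>" "measure \<mu> B > 0"
    and out: "\<And>\<Lambda>. finite \<Lambda> \<Longrightarrow> \<Lambda> \<subseteq> sites \<Longrightarrow> B \<in> sets (outside_algebra {1..} (site r ` \<Lambda>))"
  shows "gibbs_measure sites (layer_potential \<A> J) (conditioned_law \<mu> B r)"
proof (rule gibbs_measureI)
  note \<mu> = gibbs_measureD[OF gibbs]
  note r1 = rough_numbers_ge_1[OF r]
  interpret \<mu>: prob_space \<mu> by (rule \<mu>)
  show "prob_space (conditioned_law \<mu> B r)" by (rule prob_space_conditioned_law[OF gibbs r1 B])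
  show sets_law: "sets (conditioned_law \<mu> B r) = sets (spin_algebra sites)" by (simp add: conditioned_law_def)
  fix \<Lambda> \<zeta> assume \<Lambda>: "finite \<Lambda>" "\<Lambda> \<subseteq> sites" and \<zeta>: "\<zeta> \<in> spin_configs \<Lambda>"
  show "gibbs_weight sites (layer_potential \<A> J) \<Lambda> \<zeta> \<in> borel_measurable (outside_algebra sites \<Lambda>)"
    by (rule gibbs_weight_measurable[OF \<Lambda> \<zeta>])
  fix D assume D: "D \<in> sets (outside_algebra sites \<Lambda>)"
  let ?V = "layer_potential \<A> J"
  let ?E = "{\<tau> \<in> spin_configs sites. restrict \<tau> \<Lambda> = \<zeta>}"
  let ?E' = "{\<sigma> \<in> spin_configs {1..}. restrict \<sigma> (site r ` \<Lambda>) = push r \<Lambda> \<zeta>}"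
  let ?D' = "B \<inter> (layer r -` D \<inter> spin_configs {1..})"
  have DS: "D \<in> sets (spin_algebra sites)" using D outside_algebra_subset by blast
  have gV: "gibbs_weight sites ?V \<Lambda> \<zeta> \<in> borel_measurable (spin_algebra sites)"
    by (rule measurable_from_subalg[OF outside_subalgebra[OF refl] gibbs_weight_measurable[OF \<Lambda> \<zeta>]])
  have E: "?E \<in> sets (spin_algebra sites)" by (rule cylinder_measurable[OF \<Lambda>])
  have D': "?D' \<in> sets (outside_algebra {1..} (site r ` \<Lambda>))"
    using out[OF \<Lambda>] layer_preimage_outside[OF r \<Lambda>(2) D] by (rule sets.Int)
  have sub: "site r ` \<Lambda> \<subseteq> {1..}" using site_ge_1[OF r1] by auto
  have eqU: "gibbs_weight {1..} U (site r ` \<Lambda>) (push r \<Lambda> \<zeta>) \<sigma> = gibbs_weight sites ?V \<Lambda> \<zeta> (layer r \<sigma>)"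
    if "\<sigma> \<in> space \<mu>" for \<sigma> using that \<mu>(3) by (intro gibbs_weight_layer[OF r \<Lambda> \<zeta>]) simp
  have layer: "layer r \<in> \<mu> \<rightarrow>\<^sub>M spin_algebra sites"
    using layer_measurable[OF r1] measurable_cong_sets[OF \<mu>(2) refl] by blast
  have gU: "gibbs_weight {1..} U (site r ` \<Lambda>) (push r \<Lambda> \<zeta>) \<in> borel_measurable \<mu>"
    using measurable_compose[OF layer gV] by (subst measurable_cong[OF eqU])
  have "measure (conditioned_law \<mu> B r) (D \<inter> ?E) = (\<integral>\<tau>. indicat_real (D \<inter> ?E) \<tau> \<partial>conditioned_law \<mu> B r)"
    using DS E sets_law by simp
  also have "\<dots> = (\<integral>\<sigma>. indicat_real B \<sigma> * indicator (D \<inter> ?E) (layer r \<sigma>) \<partial>\<mu>) / measure \<mu> B"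
    using DS E by (intro integral_conditioned_law[OF gibbs r1 B] borel_measurable_indicator sets.Int)
  also have "(\<integral>\<sigma>. indicat_real B \<sigma> * indicator (D \<inter> ?E) (layer r \<sigma>) \<partial>\<mu>) =
      (\<integral>\<sigma>. indicat_real (?D' \<inter> ?E') \<sigma> \<partial>\<mu>)"
  proof (rule Bochner_Integration.integral_cong[OF refl])
    fix \<sigma> assume \<sigma>: "\<sigma> \<in> space \<mu>"
    then have "layer r \<sigma> \<in> spin_configs sites" using \<mu>(3) by (intro layer_spin_configs[OF r1]) simp
    then show "indicator B \<sigma> * indicator (D \<inter> ?E) (layer r \<sigma>) = (indicator (?D' \<inter> ?E') \<sigma> :: real)"
      using \<sigma> \<mu>(3) restrict_layer_eq_iff[OF r \<Lambda>(2) \<zeta>, of \<sigma>] by (simp add: indicator_def)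
  qed
  also have "\<dots> = measure \<mu> (?D' \<inter> ?E')"
  proof -
    have "?D' \<in> sets \<mu>" using D' outside_algebra_subset \<mu>(2) by blast
    moreover have "?E' \<in> sets \<mu>" using cylinder_measurable[OF _ sub] \<Lambda> \<mu>(2) by simp
    ultimately show ?thesis by simp
  qed
  also have "\<dots> = (\<integral>\<sigma>. indicat_real ?D' \<sigma> * gibbs_weight {1..} U (site r ` \<Lambda>) (push r \<Lambda> \<zeta>) \<sigma> \<partial>\<mu>)"
    using \<Lambda> by (intro gibbs_measure_cylinder[OF gibbs _ sub push_spin_configs[OF r \<Lambda>(2) \<zeta>] D' gU]) simp
  also have "\<dots> = (\<integral>\<sigma>. indicat_real B \<sigma> * (indicator D (layer r \<sigma>) * gibbs_weight sites ?V \<Lambda> \<zeta> (layer r \<sigma>)) \<partial>\<mu>)"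
    by (intro Bochner_Integration.integral_cong refl) (simp only: eqU, use \<mu>(3) in \<open>simp add: indicator_def\<close>)
  also have "\<dots> / measure \<mu> B = (\<integral>\<tau>. indicat_real D \<tau> * gibbs_weight sites ?V \<Lambda> \<zeta> \<tau> \<partial>conditioned_law \<mu> B r)"
    using DS gV by (intro integral_conditioned_law[OF gibbs r1 B, symmetric] borel_measurable_times borel_measurable_indicator)
  finally show "measure (conditioned_law \<mu> B r) (D \<inter> ?E) =
    (\<integral>\<tau>. indicat_real D \<tau> * gibbs_weight sites ?V \<Lambda> \<zeta> \<tau> \<partial>conditioned_law \<mu> B r)" .
qed

text \<open>For B of positive measure, uniqueness forces the conditioned law to be one and the same
  \<nu>, whatever r and B are. This single product formula yields both the common law and the
  independence of the layers.\<close>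

lemma layer_law:
  assumes unique: "layer_unique \<A> J" and gibbs: "gibbs_measure {1..} U \<mu>"
  shows "\<exists>\<nu>. prob_space \<nu> \<and> sets \<nu> = sets (spin_algebra sites) \<and>
    (\<forall>r\<in>rough_numbers P. \<forall>B\<in>sets \<mu>.
      (\<forall>\<Lambda>. finite \<Lambda> \<longrightarrow> \<Lambda> \<subseteq> sites \<longrightarrow> B \<in> sets (outside_algebra {1..} (site r ` \<Lambda>))) \<longrightarrow>
      (\<forall>C\<in>sets (spin_algebra sites). measure \<mu> (B \<inter> (layer r -` C \<inter> space \<mu>)) = measure \<mu> B * measure \<nu> C))"
proof -
  note \<mu> = gibbs_measureD[OF gibbs]
  interpret \<mu>: prob_space \<mu> by (rule \<mu>)
  obtain \<nu> where \<nu>: "gibbs_measure sites (layer_potential \<A> J) \<nu>"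
      "\<And>\<nu>'. gibbs_measure sites (layer_potential \<A> J) \<nu>' \<Longrightarrow> \<nu>' = \<nu>"
    using unique unfolding layer_unique_def by blast
  note \<nu>' = gibbs_measureD[OF \<nu>(1)]
  have "measure \<mu> (B \<inter> (layer r -` C \<inter> space \<mu>)) = measure \<mu> B * measure \<nu> C"
    if r: "r \<in> rough_numbers P" and B: "B \<in> sets \<mu>"
      and out: "\<And>\<Lambda>. finite \<Lambda> \<Longrightarrow> \<Lambda> \<subseteq> sites \<Longrightarrow> B \<in> sets (outside_algebra {1..} (site r ` \<Lambda>))"
      and C: "C \<in> sets (spin_algebra sites)" for r B C
  proof -
    note r1 = rough_numbers_ge_1[OF r]
    have "layer r \<in> \<mu> \<rightarrow>\<^sub>M spin_algebra sites"
      using layer_measurable[OF r1] measurable_cong_sets[OF \<mu>(2) refl] by blast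
    then have BC: "B \<inter> (layer r -` C \<inter> space \<mu>) \<in> sets \<mu>" using B C by (intro sets.Int measurable_sets) auto
    show ?thesis
    proof (cases "measure \<mu> B = 0")
      case True
      have "measure \<mu> (B \<inter> (layer r -` C \<inter> space \<mu>)) \<le> measure \<mu> B"
        using B by (intro \<mu>.finite_measure_mono) auto
      then show ?thesis using True by (simp add: measure_le_0_iff)
    next
      case False
      then have pos: "measure \<mu> B > 0" by (simp add: zero_less_measure_iff)
      have "conditioned_law \<mu> B r = \<nu>" by (rule \<nu>(2)[OF conditioned_law_gibbs[OF gibbs r B pos out]])
      then have "measure \<nu> C = (\<integral>\<tau>. indicat_real C \<tau> \<partial>conditioned_law \<mu> B r)" using C \<nu>' sets.sets_into_space[of C "spin_algebra sites"] by (simp add: Int_absorb2)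
      also have "\<dots> = (\<integral>\<sigma>. indicat_real B \<sigma> * indicator C (layer r \<sigma>) \<partial>\<mu>) / measure \<mu> B"
        using C by (intro integral_conditioned_law[OF gibbs r1 B pos]) simp
      also have "(\<integral>\<sigma>. indicat_real B \<sigma> * indicator C (layer r \<sigma>) \<partial>\<mu>) =
          (\<integral>\<sigma>. indicat_real (B \<inter> (layer r -` C \<inter> space \<mu>)) \<sigma> \<partial>\<mu>)"
        by (intro Bochner_Integration.integral_cong refl) (simp add: indicator_def)
      also have "\<dots> = measure \<mu> (B \<inter> (layer r -` C \<inter> space \<mu>))" using BC by simp
      finally show ?thesis using pos by simp
    qed
  qed
  then show ?thesis using \<nu>'(1,2) by (intro exI[of _ \<nu>]) simp
qed

theorem layers_iid:
  assumes unique: "layer_unique \<A> J" and gibbs: "gibbs_measure {1..} U \<mu>"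
  obtains \<nu> where "prob_space \<nu>" "sets \<nu> = sets (spin_algebra sites)"
    and "prob_space.indep_vars \<mu> (\<lambda>_. spin_algebra sites) layer (rough_numbers P)"
    and "\<forall>r\<in>rough_numbers P. distr \<mu> (spin_algebra sites) (layer r) = \<nu>"
proof -
  note \<mu> = gibbs_measureD[OF gibbs]
  interpret \<mu>: prob_space \<mu> by (rule \<mu>)
  obtain \<nu> where \<nu>: "prob_space \<nu>" "sets \<nu> = sets (spin_algebra sites)"
    and law0: "\<forall>r\<in>rough_numbers P. \<forall>B\<in>sets \<mu>.
      (\<forall>\<Lambda>. finite \<Lambda> \<longrightarrow> \<Lambda> \<subseteq> sites \<longrightarrow> B \<in> sets (outside_algebra {1..} (site r ` \<Lambda>))) \<longrightarrow>
      (\<forall>C\<in>sets (spin_algebra sites). measure \<mu> (B \<inter> (layer r -` C \<inter> space \<mu>)) = measure \<mu> B * measure \<nu> C)"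
    using layer_law[OF unique gibbs] by blast
  have law: "measure \<mu> (B \<inter> (layer r -` C \<inter> space \<mu>)) = measure \<mu> B * measure \<nu> C"
    if "r \<in> rough_numbers P" "B \<in> sets \<mu>"
      "\<And>\<Lambda>. finite \<Lambda> \<Longrightarrow> \<Lambda> \<subseteq> sites \<Longrightarrow> B \<in> sets (outside_algebra {1..} (site r ` \<Lambda>))"
      "C \<in> sets (spin_algebra sites)" for r B C
    using law0 that by simp
  interpret \<nu>: prob_space \<nu> by (rule \<nu>)
  have layer: "layer r \<in> \<mu> \<rightarrow>\<^sub>M spin_algebra sites" if "r \<in> rough_numbers P" for r
    using layer_measurable[OF rough_numbers_ge_1[OF that]] measurable_cong_sets[OF \<mu>(2) refl] by blast
  have marginal: "measure \<mu> (layer r -` C \<inter> space \<mu>) = measure \<nu> C"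
    if "r \<in> rough_numbers P" "C \<in> sets (spin_algebra sites)" for r C
  proof -
    have "space \<mu> \<in> sets (outside_algebra {1..} \<Lambda>)" for \<Lambda>
      using sets.top[of "outside_algebra {1..} \<Lambda>"] \<mu>(3) by simp
    then have "measure \<mu> (space \<mu> \<inter> (layer r -` C \<inter> space \<mu>)) = measure \<mu> (space \<mu>) * measure \<nu> C"
      by (intro law[OF that(1) _ _ that(2)]) auto
    then show ?thesis by (simp add: \<mu>.prob_space Int_absorb1)
  qed
  have distr: "distr \<mu> (spin_algebra sites) (layer r) = \<nu>" if r: "r \<in> rough_numbers P" for r
  proof (rule measure_eqI)
    fix C assume "C \<in> sets (distr \<mu> (spin_algebra sites) (layer r))"
    then have C: "C \<in> sets (spin_algebra sites)" by simp
    then show "emeasure (distr \<mu> (spin_algebra sites) (layer r)) C = emeasure \<nu> C"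
      using marginal[OF r C] layer[OF r] by (simp add: emeasure_distr \<mu>.emeasure_eq_measure \<nu>.emeasure_eq_measure)
  qed (simp add: \<nu>(2))
  \<comment> \<open>The layers are added one at a time: an event about the layers in K lies outside
    every window of a layer r that is not in K.\<close>
  have joint: "measure \<mu> {\<sigma> \<in> space \<mu>. \<forall>j\<in>K. layer j \<sigma> \<in> C j} = (\<Prod>j\<in>K. measure \<nu> (C j))"
    if "finite K" "K \<subseteq> rough_numbers P" "\<And>j. j \<in> K \<Longrightarrow> C j \<in> sets (spin_algebra sites)" for K C
    using that
  proof (induction K)
    case empty
    then show ?case by (simp add: \<mu>.prob_space)
  next
    case (insert r K)
    let ?B = "{\<sigma> \<in> space \<mu>. \<forall>j\<in>K. layer j \<sigma> \<in> C j}"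
    have out: "?B \<in> sets (outside_algebra {1..} (site r ` \<Lambda>))" if "\<Lambda> \<subseteq> sites" for \<Lambda>
    proof -
      have "{\<sigma> \<in> space (outside_algebra {1..} (site r ` \<Lambda>)). layer j \<sigma> \<in> C j} \<in> sets (outside_algebra {1..} (site r ` \<Lambda>))"
        if "j \<in> K" for j
      proof -
        have "layer j \<in> outside_algebra {1..} (site r ` \<Lambda>) \<rightarrow>\<^sub>M spin_algebra sites"
          using insert.hyps insert.prems that \<open>\<Lambda> \<subseteq> sites\<close> by (intro layer_outside_measurable) auto
        then have "layer j -` C j \<inter> space (outside_algebra {1..} (site r ` \<Lambda>)) \<in> sets (outside_algebra {1..} (site r ` \<Lambda>))"
          using insert.prems(2) that by (intro measurable_sets) auto
        moreover have "layer j -` C j \<inter> space (outside_algebra {1..} (site r ` \<Lambda>)) =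
            {\<sigma> \<in> space (outside_algebra {1..} (site r ` \<Lambda>)). layer j \<sigma> \<in> C j}" by auto
        ultimately show ?thesis by (simp only:)
      qed
      then have "{\<sigma> \<in> space (outside_algebra {1..} (site r ` \<Lambda>)). \<forall>j\<in>K. layer j \<sigma> \<in> C j}
          \<in> sets (outside_algebra {1..} (site r ` \<Lambda>))"
        by (intro sets.sets_Collect_finite_All insert.hyps(1)) auto
      moreover have "{\<sigma> \<in> space (outside_algebra {1..} (site r ` \<Lambda>)). \<forall>j\<in>K. layer j \<sigma> \<in> C j} = ?B" using \<mu>(3) by simp
      ultimately show ?thesis by (simp only:)
    qed
    have "?B \<in> sets \<mu>" using out[of "{}"] outside_algebra_subset \<mu>(2) by blast
    then have "measure \<mu> (?B \<inter> (layer r -` C r \<inter> space \<mu>)) = measure \<mu> ?B * measure \<nu> (C r)"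
      using insert.prems out by (intro law) auto
    moreover have "?B \<inter> (layer r -` C r \<inter> space \<mu>) = {\<sigma> \<in> space \<mu>. \<forall>j\<in>insert r K. layer j \<sigma> \<in> C j}" by auto
    ultimately show ?case using insert by simp
  qed
  have "\<mu>.indep_vars (\<lambda>_. spin_algebra sites) layer (rough_numbers P)"
    unfolding \<mu>.indep_vars_def2
  proof (intro conjI ballI \<mu>.indep_setsI)
    fix r assume r: "r \<in> rough_numbers P"
    show "layer r \<in> \<mu> \<rightarrow>\<^sub>M spin_algebra sites" by (rule layer[OF r])
    show "{layer r -` A \<inter> space \<mu> |A. A \<in> sets (spin_algebra sites)} \<subseteq> \<mu>.events"
      using measurable_sets[OF layer[OF r]] by auto
  next
    fix A K assume K: "K \<noteq> {}" "K \<subseteq> rough_numbers P" "finite K"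
      and "\<forall>j\<in>K. A j \<in> {layer j -` A \<inter> space \<mu> |A. A \<in> sets (spin_algebra sites)}"
    then have "\<forall>j\<in>K. \<exists>C. C \<in> sets (spin_algebra sites) \<and> A j = layer j -` C \<inter> space \<mu>" by auto
    then obtain C where C: "\<And>j. j \<in> K \<Longrightarrow> C j \<in> sets (spin_algebra sites)" "\<And>j. j \<in> K \<Longrightarrow> A j = layer j -` C j \<inter> space \<mu>"
      by metis
    have "(\<Inter>j\<in>K. A j) = {\<sigma> \<in> space \<mu>. \<forall>j\<in>K. layer j \<sigma> \<in> C j}" using C(2) K(1) by auto
    then have "measure \<mu> (\<Inter>j\<in>K. A j) = (\<Prod>j\<in>K. measure \<nu> (C j))" using joint[OF K(3,2) C(1)] by simp
    also have "\<dots> = (\<Prod>j\<in>K. measure \<mu> (A j))"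
      using K C marginal by (intro prod.cong) auto
    finally show "measure \<mu> (\<Inter>j\<in>K. A j) = (\<Prod>j\<in>K. measure \<mu> (A j))" .
  qed
  then show ?thesis using that[OF \<nu>] distr by blast
qed

end

subsection \<open>Large deviation bounds\<close>

text \<open>Reduces a bound by an infimum, possibly infinite, to bounds by the real numbers below
  it.\<close>

lemma ereal_le_uminus_dense:
  fixes L i :: ereal
  assumes "\<And>\<alpha>::real. ereal \<alpha> < i \<Longrightarrow> L \<le> - ereal \<alpha>"
  shows "L \<le> - i"
proof (rule ccontr)
  assume "\<not> L \<le> - i"
  then have "- L < i" by (metis ereal_uminus_less_reorder not_le)
  then obtain \<alpha> where \<alpha>: "- L < ereal \<alpha>" "ereal \<alpha> < i" using ereal_dense2 by blast
  then have "L \<le> - ereal \<alpha>" using assms by blast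
  moreover have "- ereal \<alpha> < L" using \<alpha>(1) by (metis ereal_uminus_less_reorder)
  ultimately show False by simp
qed

lemma scaled_ereal_ln_le:
  assumes "0 \<le> p" "p \<le> exp (real N * a)" "N \<ge> 1"
  shows "ereal (1 / real N) * ereal_ln p \<le> ereal a"
proof (cases "p = 0")
  case False
  then have "ln p \<le> real N * a" using assms by (metis less_eq_real_def ln_exp ln_mono)
  then show ?thesis using False assms by (simp add: ereal_ln_def field_simps)
qed (use assms in \<open>simp add: ereal_ln_def\<close>)

lemma scaled_ereal_ln_ge:
  assumes "exp (real N * a) \<le> p" "N \<ge> 1"
  shows "ereal a \<le> ereal (1 / real N) * ereal_ln p"
proof -
  have "p > 0" using assms(1) exp_gt_zero less_le_trans by blast
  then have "real N * a \<le> ln p" using assms by (metis exp_le_cancel_iff exp_ln)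
  then show ?thesis using \<open>p > 0\<close> assms by (simp add: ereal_ln_def field_simps)
qed

lemma (in prob_space) expectation_exp_pos:
  assumes "integrable M (\<lambda>\<omega>. exp (f \<omega>))"
  shows "0 < expectation (\<lambda>\<omega>. exp (f \<omega> :: real))"
proof -
  have "expectation (\<lambda>\<omega>. exp (f \<omega>)) \<noteq> 0"
  proof
    assume "expectation (\<lambda>\<omega>. exp (f \<omega>)) = 0"
    then have "AE \<omega> in M. exp (f \<omega>) = 0" using assms by (subst (asm) integral_nonneg_eq_0_iff_AE) auto
    then have "AE \<omega> in M. False" by simp
    then show False using AE_False by (simp add: AE_False)
  qed
  then show ?thesis by (simp add: less_le)
qed

text \<open>The functions \<Phi> a stand for t x on the line and for the integral of f on the space
  of measures, so one statement serves both principles. Where the rate exceeds \<beta>, some a has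
  \<Phi> a x - p a > \<beta>; these open half-spaces cover F \<inter> K, and finitely many of them
  suffice for a union bound. Confinement of Y N to the compact set K takes the place of exponential
  tightness.\<close>

lemma ldp_upper_bound:
  fixes Y :: "nat \<Rightarrow> 'a \<Rightarrow> 'x" and \<Phi> :: "'i \<Rightarrow> 'x \<Rightarrow> real"
  assumes "prob_space M"
    and K: "compactin X K" "\<And>N \<omega>. N \<ge> 1 \<Longrightarrow> \<omega> \<in> space M \<Longrightarrow> Y N \<omega> \<in> K"
    and meas: "\<And>N G. N \<ge> 1 \<Longrightarrow> openin X G \<Longrightarrow> {\<omega> \<in> space M. Y N \<omega> \<in> G} \<in> sets M"
    and cont: "\<And>a. a \<in> A \<Longrightarrow> continuous_map X euclideanreal (\<Phi> a)"
    and int: "\<And>a N. a \<in> A \<Longrightarrow> N \<ge> 1 \<Longrightarrow> integrable M (\<lambda>\<omega>. exp (real N * \<Phi> a (Y N \<omega>)))"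
    and lim: "\<And>a. a \<in> A \<Longrightarrow>
        (\<lambda>N. (1 / real N) * ln (\<integral>\<omega>. exp (real N * \<Phi> a (Y N \<omega>)) \<partial>M)) \<longlonglongrightarrow> p a"
    and I: "\<And>x. x \<in> topspace X \<Longrightarrow> I x = (SUP a\<in>A. ereal (\<Phi> a x - p a))"
    and F: "closedin X F"
  shows "limsup (\<lambda>N. ereal (1 / real N) * ereal_ln (measure M {\<omega> \<in> space M. Y N \<omega> \<in> F}))
          \<le> - (INF x\<in>F. I x)"
proof (rule ereal_le_uminus_dense)
  interpret prob_space M by fact
  fix \<alpha> :: real assume "ereal \<alpha> < (INF x\<in>F. I x)"
  then obtain \<beta> where \<beta>: "ereal \<alpha> < ereal \<beta>" "ereal \<beta> < (INF x\<in>F. I x)" using ereal_dense2 by blast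
  \<comment> \<open>Half of the gap: one \<eta> absorbs the error in the cumulants, the other the
    logarithm of the number of half-spaces, and 2 \<eta> - \<beta> = - \<alpha>.\<close>
  define \<eta> where "\<eta> = (\<beta> - \<alpha>) / 2"
  have \<eta>: "\<eta> > 0" using \<beta> by (simp add: \<eta>_def)
  define V where "V a = {x \<in> topspace X. \<Phi> a x > p a + \<beta>}" for a
  have V: "openin X (V a)" if "a \<in> A" for a
    using openin_continuous_map_preimage[OF cont[OF that], of "{p a + \<beta><..}"] by (simp add: V_def)
  have FX: "F \<subseteq> topspace X" using F by (rule closedin_subset)
  have "F \<inter> K \<subseteq> \<Union>(V ` A)"
  proof
    fix x assume x: "x \<in> F \<inter> K"
    then have "ereal \<beta> < I x" using \<beta>(2) by (meson INF_lower IntD1 less_le_trans)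
    then have "ereal \<beta> < (SUP a\<in>A. ereal (\<Phi> a x - p a))" using I[of x] x FX by auto
    then obtain a where "a \<in> A" "ereal \<beta> < ereal (\<Phi> a x - p a)" unfolding less_SUP_iff by blast
    then have "x \<in> V a" using x FX by (auto simp: V_def)
    then show "x \<in> \<Union>(V ` A)" using \<open>a \<in> A\<close> by blast
  qed
  moreover have "compactin X (F \<inter> K)" using F K(1) by (rule closed_Int_compactin)
  ultimately obtain \<V> where "finite \<V>" "\<V> \<subseteq> V ` A" "F \<inter> K \<subseteq> \<Union>\<V>"
    using V unfolding compactin_def by (metis (no_types, lifting) imageE)
  then obtain B where B: "finite B" "B \<subseteq> A" "F \<inter> K \<subseteq> \<Union>(V ` B)"
    by (metis finite_subset_image)
  define E where "E a N = (\<integral>\<omega>. exp (real N * \<Phi> a (Y N \<omega>)) \<partial>M)" for a N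
  have "\<forall>\<^sub>F N in sequentially. \<forall>a\<in>B. (1 / real N) * ln (E a N) < p a + \<eta>"
    using B lim \<eta> by (intro eventually_ball_finite ballI) (auto simp: E_def intro!: order_tendstoD)
  \<comment> \<open>The summand 1 keeps the logarithm meaningful when the cover is empty.\<close>
  moreover have "\<forall>\<^sub>F N in sequentially. ln (real (card B) + 1) / real N < \<eta>"
    using \<eta> lim_const_over_n[of "ln (real (card B) + 1)"] by (intro order_tendstoD) auto
  ultimately have "\<forall>\<^sub>F N in sequentially.
      ereal (1 / real N) * ereal_ln (prob {\<omega> \<in> space M. Y N \<omega> \<in> F}) \<le> ereal (- \<alpha>)"
    using eventually_ge_at_top[of 1]
  proof eventually_elim
    case (elim N)
    have chernoff: "prob {\<omega> \<in> space M. Y N \<omega> \<in> V a} \<le> exp (real N * (\<eta> - \<beta>))" if a: "a \<in> B" for a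
    proof -
      have aA: "a \<in> A" using a B by auto
      note int_a = int[OF aA elim(3)]
      have Va: "{\<omega> \<in> space M. Y N \<omega> \<in> V a} \<in> sets M" using meas[OF elim(3) V[OF aA]] .
      have "E a N > 0"
        unfolding E_def using int_a by (intro expectation_exp_pos)
      have "prob {\<omega> \<in> space M. Y N \<omega> \<in> V a} * exp (real N * (p a + \<beta>)) =
          (\<integral>\<omega>. exp (real N * (p a + \<beta>)) * indicator {\<omega> \<in> space M. Y N \<omega> \<in> V a} \<omega> \<partial>M)"
        using Va by (simp add: mult.commute)
      also have "\<dots> \<le> E a N"
        unfolding E_def
      proof (rule integral_mono)
        show "integrable M (\<lambda>\<omega>. exp (real N * (p a + \<beta>)) * indicator {\<omega> \<in> space M. Y N \<omega> \<in> V a} \<omega>)"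
          using Va by (intro integrable_mult_right) (simp add: emeasure_eq_measure less_top[symmetric])
        fix \<omega> assume "\<omega> \<in> space M"
        show "exp (real N * (p a + \<beta>)) * indicator {\<omega> \<in> space M. Y N \<omega> \<in> V a} \<omega> \<le> exp (real N * \<Phi> a (Y N \<omega>))"
          by (auto simp: indicator_def V_def intro!: mult_left_mono)
      qed (rule int_a)
      also have "\<dots> = exp (real N * ((1 / real N) * ln (E a N)))"
        using \<open>E a N > 0\<close> elim(3) by simp
      also have "\<dots> \<le> exp (real N * (p a + \<eta>))"
        using elim(1) a elim(3) by (intro exp_le_cancel_iff[THEN iffD2] mult_left_mono) auto
      finally have "prob {\<omega> \<in> space M. Y N \<omega> \<in> V a} \<le> exp (real N * (p a + \<eta>)) / exp (real N * (p a + \<beta>))"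
        by (simp add: pos_le_divide_eq)
      also have "\<dots> = exp (real N * (\<eta> - \<beta>))" by (simp add: exp_diff[symmetric] algebra_simps)
      finally show ?thesis .
    qed
    have "prob {\<omega> \<in> space M. Y N \<omega> \<in> F} \<le> prob (\<Union>a\<in>B. {\<omega> \<in> space M. Y N \<omega> \<in> V a})"
      using B K(2)[OF elim(3)] meas[OF elim(3)] V by (intro finite_measure_mono) (auto intro!: sets.finite_UN)
    also have "\<dots> \<le> (\<Sum>a\<in>B. prob {\<omega> \<in> space M. Y N \<omega> \<in> V a})"
      using B meas[OF elim(3)] V by (intro finite_measure_subadditive_finite) auto
    also have "\<dots> \<le> (\<Sum>a\<in>B. exp (real N * (\<eta> - \<beta>)))" by (intro sum_mono chernoff)
    also have "\<dots> \<le> (real (card B) + 1) * exp (real N * (\<eta> - \<beta>))" by simp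
    also have "\<dots> = exp (ln (real (card B) + 1) + real N * (\<eta> - \<beta>))" by (simp add: exp_add)
    also have "\<dots> \<le> exp (real N * (- \<alpha>))"
    proof -
      have "ln (real (card B) + 1) \<le> real N * \<eta>" using elim(2,3) by (simp add: divide_less_eq mult.commute)
      then have "ln (real (card B) + 1) + real N * (\<eta> - \<beta>) \<le> real N * \<eta> + real N * (\<eta> - \<beta>)" by simp
      also have "\<dots> = real N * (2 * \<eta> - \<beta>)" by (simp add: algebra_simps)
      also have "2 * \<eta> - \<beta> = - \<alpha>" by (simp add: \<eta>_def diff_divide_distrib)
      finally show ?thesis by simp
    qed
    finally show ?case using elim(3) by (intro scaled_ereal_ln_le) auto
  qed
  then have "limsup (\<lambda>N. ereal (1 / real N) * ereal_ln (prob {\<omega> \<in> space M. Y N \<omega> \<in> F})) \<le> ereal (- \<alpha>)"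
    by (rule Limsup_bounded)
  then show "limsup (\<lambda>N. ereal (1 / real N) * ereal_ln (prob {\<omega> \<in> space M. Y N \<omega> \<in> F})) \<le> - ereal \<alpha>"
    by simp
qed

text \<open>Sublevel sets are intersections of closed half-spaces. The index z is the zero
  functional in both applications; it gives nonnegativity and keeps the intersection nonempty as a
  family.\<close>

lemma rate_function_SUP:
  fixes \<Phi> :: "'i \<Rightarrow> 'x \<Rightarrow> real"
  assumes cont: "\<And>a. a \<in> A \<Longrightarrow> continuous_map X euclideanreal (\<Phi> a)"
    and I: "\<And>x. x \<in> topspace X \<Longrightarrow> I x = (SUP a\<in>A. ereal (\<Phi> a x - p a))"
    and z: "z \<in> A" "\<And>x. x \<in> topspace X \<Longrightarrow> \<Phi> z x - p z \<ge> 0"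
  shows "rate_function X I"
  unfolding rate_function_def
proof (intro conjI ballI allI)
  fix x assume x: "x \<in> topspace X"
  have "0 \<le> ereal (\<Phi> z x - p z)" using z x by simp
  also have "\<dots> \<le> I x" unfolding I[OF x] using z by (intro SUP_upper)
  finally show "0 \<le> I x" .
next
  fix c :: real
  have "{x \<in> topspace X. I x \<le> ereal c} = (\<Inter>a\<in>A. {x \<in> topspace X. \<Phi> a x \<in> {..c + p a}})"
    using z I by (auto simp: SUP_le_iff algebra_simps)
  moreover have "closedin X (\<Inter>a\<in>A. {x \<in> topspace X. \<Phi> a x \<in> {..c + p a}})"
    using z by (intro closedin_INT closedin_continuous_map_preimage[OF cont]) auto
  ultimately show "closedin X {x \<in> topspace X. I x \<le> ereal c}" by simp
qed

text \<open>A first-order condition without derivatives: a small s with the sign of a makes the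
  linear term win unless a = 0. The size |a| / (2 (b + 1)) gives u b < |a| also when b = 0.\<close>

lemma linear_le_quadratic_imp_zero:
  fixes a b s0 :: real
  assumes "s0 > 0" "b \<ge> 0" "\<And>s. \<bar>s\<bar> \<le> s0 \<Longrightarrow> s * a \<le> s\<^sup>2 * b"
  shows "a = 0"
proof (rule ccontr)
  assume a: "a \<noteq> 0"
  define u where "u = min s0 (\<bar>a\<bar> / (2 * (b + 1)))"
  have u: "u > 0" "u \<le> s0" "u \<le> \<bar>a\<bar> / (2 * (b + 1))" using assms a by (auto simp: u_def)
  have "sgn a * u * a \<le> (sgn a * u)\<^sup>2 * b" using u assms(3)[of "sgn a * u"] a by (simp add: abs_mult)
  moreover have "sgn a * u * a = u * \<bar>a\<bar>" using a by (simp add: sgn_if abs_if)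
  moreover have "(sgn a * u)\<^sup>2 = u * u" using a by (simp add: power2_eq_square sgn_if)
  ultimately have "u * \<bar>a\<bar> \<le> u * (u * b)" by (simp only: mult.assoc)
  then have "\<bar>a\<bar> \<le> u * b" using u by simp
  also have "\<dots> \<le> \<bar>a\<bar> / (2 * (b + 1)) * b" using u assms by (intro mult_right_mono) auto
  also have "\<dots> = \<bar>a\<bar> * (b / (2 * (b + 1)))" by simp
  also have "\<dots> < \<bar>a\<bar> * 1" using a assms by (intro mult_strict_left_mono) (auto simp: field_simps)
  finally show False by simp
qed


section \<open>Exponential tilting of finitely many bounded statistics\<close>

locale bounded_statistics = prob_space M for M :: "'a measure" +
  fixes X :: "nat \<Rightarrow> nat \<Rightarrow> 'a \<Rightarrow> real" and m :: nat and B :: real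
  assumes stat_measurable: "\<And>N j. j < m \<Longrightarrow> X N j \<in> borel_measurable M"
    and stat_bound: "\<And>N j \<omega>. j < m \<Longrightarrow> \<omega> \<in> space M \<Longrightarrow> \<bar>X N j \<omega>\<bar> \<le> B"
    and B_pos: "B > 0"
begin

text \<open>Several statistics are tilted jointly because a basic weak neighbourhood restricts
  finitely many integrals at once. The parameter is a sequence of which only the first m entries
  count.\<close>

definition combination :: "nat \<Rightarrow> (nat \<Rightarrow> real) \<Rightarrow> 'a \<Rightarrow> real" where
  "combination N t \<omega> = (\<Sum>j<m. t j * X N j \<omega>)"

definition cumulant :: "nat \<Rightarrow> (nat \<Rightarrow> real) \<Rightarrow> real" where
  "cumulant N t = (1 / real N) * ln (expectation (\<lambda>\<omega>. exp (real N * combination N t \<omega>)))"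

lemma combination_measurable [measurable]: "combination N t \<in> borel_measurable M"
  unfolding combination_def[abs_def] using stat_measurable
  by (intro borel_measurable_sum borel_measurable_times) auto

lemma combination_diff_le:
  assumes "\<omega> \<in> space M"
  shows "combination N s \<omega> - combination N t \<omega> \<le> B * (\<Sum>j<m. \<bar>s j - t j\<bar>)"
proof -
  have "combination N s \<omega> - combination N t \<omega> = (\<Sum>j<m. (s j - t j) * X N j \<omega>)"
    by (simp add: combination_def sum_subtractf[symmetric] left_diff_distrib)
  also have "\<dots> \<le> (\<Sum>j<m. \<bar>s j - t j\<bar> * B)"
  proof (rule sum_mono)
    fix j assume "j \<in> {..<m}"
    then have "\<bar>(s j - t j) * X N j \<omega>\<bar> \<le> \<bar>s j - t j\<bar> * B"
      using stat_bound[OF _ assms] by (simp add: abs_mult mult_left_mono)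
    then show "(s j - t j) * X N j \<omega> \<le> \<bar>s j - t j\<bar> * B" by linarith
  qed
  finally show ?thesis by (simp add: sum_distrib_left mult.commute)
qed

lemma exp_combination_integrable: "integrable M (\<lambda>\<omega>. exp (real N * combination N t \<omega>))"
proof (rule integrable_const_bound[of _ "exp (real N * (B * (\<Sum>j<m. \<bar>t j\<bar>)))"])
  have "combination N t \<omega> \<le> B * (\<Sum>j<m. \<bar>t j\<bar>)" if "\<omega> \<in> space M" for \<omega>
    using combination_diff_le[OF that, of N t "\<lambda>_. 0"] by (simp add: combination_def)
  then show "AE \<omega> in M. norm (exp (real N * combination N t \<omega>)) \<le> exp (real N * (B * (\<Sum>j<m. \<bar>t j\<bar>)))"
    by (intro AE_I2) (simp add: mult_left_mono)
qed simp

lemma expectation_exp_combination_pos: "0 < expectation (\<lambda>\<omega>. exp (real N * combination N t \<omega>))"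
  by (rule expectation_exp_pos) (rule exp_combination_integrable)

lemma expectation_exp_combination:
  "N \<ge> 1 \<Longrightarrow> expectation (\<lambda>\<omega>. exp (real N * combination N t \<omega>)) = exp (real N * cumulant N t)"
  using expectation_exp_combination_pos[of N t] by (simp add: cumulant_def)

lemma cumulant_zero [simp]: "cumulant N (\<lambda>_. 0) = 0"
  by (simp add: cumulant_def combination_def prob_space)

text \<open>The Lipschitz constant is free of N. This equicontinuity is what upgrades pointwise
  convergence of the cumulants in \<open>rate_le_uniform\<close>.\<close>

lemma cumulant_diff_le:
  assumes "N \<ge> 1"
  shows "cumulant N s - cumulant N t \<le> B * (\<Sum>j<m. \<bar>s j - t j\<bar>)"
proof -
  let ?L = "B * (\<Sum>j<m. \<bar>s j - t j\<bar>)"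
  have "exp (real N * cumulant N s) \<le> expectation (\<lambda>\<omega>. exp (real N * ?L) * exp (real N * combination N t \<omega>))"
    unfolding expectation_exp_combination[OF assms, symmetric]
  proof (rule integral_mono)
    fix \<omega> assume "\<omega> \<in> space M"
    then have "combination N s \<omega> \<le> ?L + combination N t \<omega>" using combination_diff_le[of \<omega> N s t] by simp
    then have "real N * combination N s \<omega> \<le> real N * ?L + real N * combination N t \<omega>"
      using mult_left_mono[of "combination N s \<omega>" "?L + combination N t \<omega>" "real N"] by (simp add: algebra_simps)
    then show "exp (real N * combination N s \<omega>) \<le> exp (real N * ?L) * exp (real N * combination N t \<omega>)"
      by (simp add: exp_add[symmetric])
  qed (auto intro: exp_combination_integrable)
  also have "\<dots> = exp (real N * (?L + cumulant N t))"
    by (simp add: expectation_exp_combination[OF assms] distrib_left exp_add)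
  finally have "real N * cumulant N s \<le> real N * (?L + cumulant N t)" by simp
  then show ?thesis using assms by (simp add: mult_le_cancel_left)
qed

lemma cumulant_abs_diff_le:
  assumes "N \<ge> 1"
  shows "\<bar>cumulant N s - cumulant N t\<bar> \<le> B * (\<Sum>j<m. \<bar>s j - t j\<bar>)"
  using cumulant_diff_le[OF assms, of s t] cumulant_diff_le[OF assms, of t s]
  by (simp add: abs_minus_commute abs_le_iff)

lemma continuous_cumulant:
  assumes "N \<ge> 1"
  shows "continuous_on S (cumulant N)"
  unfolding continuous_on_def
proof
  fix t assume "t \<in> S"
  have "continuous_on S (\<lambda>s::nat \<Rightarrow> real. B * (\<Sum>j<m. \<bar>s j - t j\<bar>))"
    by (intro continuous_intros continuous_on_product_coordinates[THEN continuous_on_subset] subset_UNIV)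
  then have "((\<lambda>s. B * (\<Sum>j<m. \<bar>s j - t j\<bar>)) \<longlongrightarrow> 0) (at t within S)"
    using \<open>t \<in> S\<close> by (auto simp: continuous_on_def)
  then have "((\<lambda>s. cumulant N s - cumulant N t) \<longlongrightarrow> 0) (at t within S)"
    by (rule Lim_null_comparison[rotated]) (simp add: cumulant_abs_diff_le[OF assms])
  then show "(cumulant N \<longlongrightarrow> cumulant N t) (at t within S)" by (simp add: LIM_zero_iff)
qed

text \<open>Finitely many parameters settle the limit up to \<eta> / 2, and Lipschitz bounds carry
  the estimate to nearby ones for another \<eta> / 2. Uniformity is needed because the tilt used in
  the lower bound changes with N.\<close>

lemma rate_le_uniform:
  assumes conv: "\<And>t. (\<lambda>N. cumulant N t) \<longlonglongrightarrow> p t"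
    and rate: "\<And>t. (\<Sum>j<m. t j * x j) - p t \<le> c"
    and S: "compact S" and "\<eta> > 0"
  shows "\<forall>\<^sub>F N in sequentially. \<forall>t\<in>S. (\<Sum>j<m. t j * x j) - cumulant N t \<le> c + \<eta>"
proof -
  \<comment> \<open>In the radius, the weight \<open>\<bar>x j\<bar>\<close> pays for the linear
    term and B for the cumulant.\<close>
  define V where "V t = {s::nat \<Rightarrow> real. (\<Sum>j<m. \<bar>s j - t j\<bar> * (\<bar>x j\<bar> + B)) < \<eta> / 2}" for t
  have "open (V t)" for t
    unfolding V_def
    by (intro open_Collect_less continuous_intros continuous_on_product_coordinates)
  moreover have "t \<in> V t" for t using \<open>\<eta> > 0\<close> by (simp add: V_def)
  then have "S \<subseteq> (\<Union>t\<in>S. V t)" by blast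
  ultimately obtain T where T: "T \<subseteq> S" "finite T" "S \<subseteq> (\<Union>t\<in>T. V t)"
    by (rule compactE_image[OF S])
  have "\<forall>\<^sub>F N in sequentially. \<forall>t\<in>T. (\<Sum>j<m. t j * x j) - cumulant N t < c + \<eta> / 2"
  proof (intro eventually_ball_finite ballI T)
    fix t
    have "(\<lambda>N. (\<Sum>j<m. t j * x j) - cumulant N t) \<longlonglongrightarrow> (\<Sum>j<m. t j * x j) - p t"
      by (intro tendsto_intros conv)
    moreover have "(\<Sum>j<m. t j * x j) - p t < c + \<eta> / 2" using rate[of t] \<open>\<eta> > 0\<close> by linarith
    ultimately show "\<forall>\<^sub>F N in sequentially. (\<Sum>j<m. t j * x j) - cumulant N t < c + \<eta> / 2"
      by (rule order_tendstoD)
  qed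
  then show ?thesis using eventually_ge_at_top[of 1]
  proof eventually_elim
    case (elim N)
    show ?case
    proof
      fix s assume "s \<in> S"
      then obtain t where t: "t \<in> T" "s \<in> V t" using T by blast
      have "(\<Sum>j<m. s j * x j) - (\<Sum>j<m. t j * x j) \<le> (\<Sum>j<m. \<bar>s j - t j\<bar> * \<bar>x j\<bar>)"
        unfolding sum_subtractf[symmetric] left_diff_distrib[symmetric] abs_mult[symmetric]
        by (intro sum_mono) simp
      moreover have "cumulant N t - cumulant N s \<le> (\<Sum>j<m. \<bar>s j - t j\<bar> * B)"
        using cumulant_diff_le[OF elim(2), of t s] by (simp add: sum_distrib_left abs_minus_commute mult.commute)
      moreover have "(\<Sum>j<m. \<bar>s j - t j\<bar> * \<bar>x j\<bar>) + (\<Sum>j<m. \<bar>s j - t j\<bar> * B) < \<eta> / 2"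
        using t(2) by (simp add: V_def distrib_left sum.distrib)
      ultimately show "(\<Sum>j<m. s j * x j) - cumulant N s \<le> c + \<eta>" using elim(1) t(1) by fastforce
    qed
  qed
qed

text \<open>Pinning the entries from m on to 0 makes the box a product of compact sets in the space
  of all sequences.\<close>

lemma compact_box: "compact {t::nat \<Rightarrow> real. (\<forall>j<m. \<bar>t j\<bar> \<le> R) \<and> (\<forall>j\<ge>m. t j = 0)}"
proof -
  have "{t::nat \<Rightarrow> real. (\<forall>j<m. \<bar>t j\<bar> \<le> R) \<and> (\<forall>j\<ge>m. t j = 0)} =
      (\<Pi>\<^sub>E j\<in>UNIV. if j < m then {-R..R} else {0})"
  proof -
    have "(j < m \<longrightarrow> \<bar>t j\<bar> \<le> R) \<and> (m \<le> j \<longrightarrow> t j = 0) \<longleftrightarrow> t j \<in> (if j < m then {-R..R} else {0})"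
      for t :: "nat \<Rightarrow> real" and j
      by (simp add: abs_le_iff) linarith
    then show ?thesis unfolding PiE_UNIV_domain Pi_def by blast
  qed
  moreover have "compactin (product_topology (\<lambda>_. euclidean) UNIV) (\<Pi>\<^sub>E j\<in>UNIV. if j < m then {-R..R} else {0::real})"
    by (subst compactin_PiE) (auto simp: compactin_euclidean_iff)
  ultimately show ?thesis
    by (simp add: euclidean_product_topology compactin_euclidean_iff)
qed


text \<open>Exponential Markov inequality under the measure with density proportional to
  \<open>exp (real N * combination N t \<omega>)\<close>. Raising t j by s \<sigma> tests the
  deviation from d, which acts as the tilted mean; the sign \<sigma> covers both tails. S is the
  variance proxy, so the decay is governed by N / S rather than by N.\<close>

lemma tilted_tail_bound:
  assumes N: "N \<ge> 1" and j: "j < m" and \<sigma>: "\<bar>\<sigma>\<bar> = 1" and u: "0 < u" "u \<le> B" and S: "S \<ge> 1"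
    and d: "\<And>s. \<bar>s\<bar> * (B * S) \<le> 1 \<Longrightarrow>
        cumulant N (t(j := t j + s)) - cumulant N t \<le> s * d + s\<^sup>2 * (B\<^sup>2 * S)"
  shows "expectation (\<lambda>\<omega>. indicator {\<omega> \<in> space M. u \<le> \<sigma> * (X N j \<omega> - d)} \<omega> * exp (real N * combination N t \<omega>))
    \<le> exp (real N * cumulant N t) * exp (- (u\<^sup>2 / (4 * B\<^sup>2)) * (real N / S))"
proof -
  \<comment> \<open>The minimiser of - s u + s^2 B^2 S, with minimum - u^2 / (4 B^2 S). It is
    admissible because s B S = u / (2 B) \<le> 1, by u \<le> B.\<close>
  define s where "s = u / (2 * B\<^sup>2 * S)"
  have s: "s > 0" using u B_pos S by (simp add: s_def)
  let ?t = "t(j := t j + s * \<sigma>)"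
  note [measurable] = stat_measurable[OF j]
  have comb: "combination N ?t \<omega> = combination N t \<omega> + s * \<sigma> * X N j \<omega>" for \<omega>
  proof -
    have "combination N ?t \<omega> = (\<Sum>i<m. t i * X N i \<omega> + (if i = j then s * \<sigma> * X N j \<omega> else 0))"
      unfolding combination_def by (intro sum.cong) (auto simp: distrib_right)
    then show ?thesis using j by (simp add: sum.distrib combination_def)
  qed
  have "expectation (\<lambda>\<omega>. indicator {\<omega> \<in> space M. u \<le> \<sigma> * (X N j \<omega> - d)} \<omega> * exp (real N * combination N t \<omega>))
    \<le> expectation (\<lambda>\<omega>. exp (- real N * s * (u + \<sigma> * d)) * exp (real N * combination N ?t \<omega>))"
  proof (rule integral_mono)
    show "integrable M (\<lambda>\<omega>. indicator {\<omega> \<in> space M. u \<le> \<sigma> * (X N j \<omega> - d)} \<omega> * exp (real N * combination N t \<omega>))"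
      by (rule Bochner_Integration.integrable_bound[OF exp_combination_integrable[of N t]])
        (auto simp: indicator_def)
    fix \<omega> assume "\<omega> \<in> space M"
    show "indicator {\<omega> \<in> space M. u \<le> \<sigma> * (X N j \<omega> - d)} \<omega> * exp (real N * combination N t \<omega>)
      \<le> exp (- real N * s * (u + \<sigma> * d)) * exp (real N * combination N ?t \<omega>)"
    proof (cases "u \<le> \<sigma> * (X N j \<omega> - d)")
      case True
      then have "0 \<le> real N * s * (\<sigma> * (X N j \<omega> - d) - u)" using s by simp
      then have "real N * combination N t \<omega> \<le> - real N * s * (u + \<sigma> * d) + real N * combination N ?t \<omega>"
        unfolding comb by (simp add: algebra_simps)
      then show ?thesis using True by (simp add: indicator_def exp_add[symmetric])
    qed (simp add: indicator_def)
  qed (auto intro: exp_combination_integrable)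
  also have "\<dots> = exp (- real N * s * (u + \<sigma> * d) + real N * cumulant N ?t)"
    unfolding exp_add by (simp add: expectation_exp_combination[OF N])
  also have "\<dots> \<le> exp (real N * cumulant N t + - (u\<^sup>2 / (4 * B\<^sup>2)) * (real N / S))"
  proof -
    have "\<bar>s * \<sigma>\<bar> * (B * S) = u / (2 * B)" using s \<sigma> B_pos S u by (simp add: abs_mult s_def power2_eq_square)
    also have "\<dots> \<le> 1" using u B_pos by (simp add: divide_le_eq)
    finally have "cumulant N ?t - cumulant N t \<le> s * \<sigma> * d + (s * \<sigma>)\<^sup>2 * (B\<^sup>2 * S)" by (rule d)
    moreover have "(s * \<sigma>)\<^sup>2 = s\<^sup>2" using \<sigma> by (metis power2_abs power_mult_distrib power_one mult.right_neutral)
    ultimately have "cumulant N ?t - cumulant N t \<le> s * \<sigma> * d + s\<^sup>2 * (B\<^sup>2 * S)" by (simp only:)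
    moreover have "s\<^sup>2 * (B\<^sup>2 * S) = s * u - u\<^sup>2 / (4 * B\<^sup>2) / S"
      using B_pos S by (simp add: s_def field_simps power2_eq_square)
    moreover have "- s * (u + \<sigma> * d) = - (s * u) - s * \<sigma> * d" by (simp add: algebra_simps)
    ultimately have "- s * (u + \<sigma> * d) + cumulant N ?t \<le> cumulant N t - u\<^sup>2 / (4 * B\<^sup>2) / S"
      by linarith
    then have "real N * (- s * (u + \<sigma> * d) + cumulant N ?t) \<le> real N * (cumulant N t - u\<^sup>2 / (4 * B\<^sup>2) / S)"
      by (intro mult_left_mono) auto
    then show ?thesis by (simp add: algebra_simps)
  qed
  finally show ?thesis by (simp only: exp_add)
qed

text \<open>The quadratic penalty forces the supremum to be attained; stationarity is read off from the
  second-order bound, without derivatives.\<close>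
lemma regularised_maximiser:
  assumes N: "N \<ge> 1" and \<epsilon>: "\<epsilon> > 0" and S: "S > 0" and R: "R = 2 * (B + (\<Sum>j<m. \<bar>x j\<bar>)) / \<epsilon> + 1"
    and le: "\<And>t. (\<forall>j<m. \<bar>t j\<bar> \<le> R) \<Longrightarrow> (\<forall>j\<ge>m. t j = 0) \<Longrightarrow> (\<Sum>j<m. t j * x j) - cumulant N t \<le> c"
    and sec: "\<And>t j. j < m \<Longrightarrow> \<exists>d. \<forall>s. \<bar>s\<bar> * (B * S) \<le> 1 \<longrightarrow>
        cumulant N (t(j := t j + s)) - cumulant N t \<le> s * d + s\<^sup>2 * (B\<^sup>2 * S)"
  obtains t where "\<And>j. j < m \<Longrightarrow> \<bar>t j\<bar> \<le> R"
    and "(\<Sum>j<m. t j * (x j - \<epsilon> * t j)) - cumulant N t \<le> c"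
    and "\<And>j. j < m \<Longrightarrow> \<epsilon> * (t j)\<^sup>2 \<le> 2 * c"
    and "\<And>j s. j < m \<Longrightarrow> \<bar>s\<bar> * (B * S) \<le> 1 \<Longrightarrow>
        cumulant N (t(j := t j + s)) - cumulant N t \<le> s * (x j - \<epsilon> * t j) + s\<^sup>2 * (B\<^sup>2 * S)"
proof -
  \<comment> \<open>C bounds the slope in t j of the linear term minus the cumulant; beyond 2 C /
    \<epsilon> the penalty outweighs it. R is one unit larger, which leaves room for perturbations
    of size at most 1.\<close>
  define C where "C = B + (\<Sum>j<m. \<bar>x j\<bar>)"
  have C: "\<bar>x j\<bar> + B \<le> C" if "j < m" for j
    using that member_le_sum[of j "{..<m}" "\<lambda>j. \<bar>x j\<bar>"] by (simp add: C_def)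
  have "C > 0" using B_pos by (simp add: C_def add_pos_nonneg sum_nonneg)
  then have R1: "R \<ge> 1" using \<epsilon> by (simp add: R C_def[symmetric])
  define \<phi> where "\<phi> t = (\<Sum>j<m. t j * x j - \<epsilon> * (t j)\<^sup>2 / 2) - cumulant N t" for t
  define Box where "Box = {t::nat \<Rightarrow> real. (\<forall>j<m. \<bar>t j\<bar> \<le> R) \<and> (\<forall>j\<ge>m. t j = 0)}"
  have zero: "(\<lambda>_. 0) \<in> Box" using R1 by (simp add: Box_def)
  have "continuous_on Box \<phi>"
    unfolding \<phi>_def
    by (intro continuous_intros continuous_cumulant N
        continuous_on_product_coordinates[THEN continuous_on_subset] subset_UNIV) auto
  then obtain t where t: "t \<in> Box" "\<And>s. s \<in> Box \<Longrightarrow> \<phi> s \<le> \<phi> t"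
    using continuous_attains_sup[of Box \<phi>] compact_box[of R] zero unfolding Box_def[symmetric] by blast
  have upd: "\<phi> (t(j := b)) = \<phi> t + (b * x j - \<epsilon> * b\<^sup>2 / 2) - (t j * x j - \<epsilon> * (t j)\<^sup>2 / 2)
      - (cumulant N (t(j := b)) - cumulant N t)" if "j < m" for j b
  proof -
    have "(\<Sum>i<m. (t(j := b)) i * x i - \<epsilon> * ((t(j := b)) i)\<^sup>2 / 2) =
      (b * x j - \<epsilon> * b\<^sup>2 / 2) + (\<Sum>i\<in>{..<m} - {j}. t i * x i - \<epsilon> * (t i)\<^sup>2 / 2)"
      using that by (subst sum.remove[of _ j]) auto
    moreover have "(\<Sum>i<m. t i * x i - \<epsilon> * (t i)\<^sup>2 / 2) =
      (t j * x j - \<epsilon> * (t j)\<^sup>2 / 2) + (\<Sum>i\<in>{..<m} - {j}. t i * x i - \<epsilon> * (t i)\<^sup>2 / 2)"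
      using that by (subst sum.remove[of _ j]) auto
    ultimately show ?thesis unfolding \<phi>_def by linarith
  qed
  \<comment> \<open>Otherwise resetting t j to 0 would save more penalty than the other terms can
    lose, against maximality.\<close>
  have interior: "\<bar>t j\<bar> \<le> R - 1" if j: "j < m" for j
  proof (rule ccontr)
    assume "\<not> \<bar>t j\<bar> \<le> R - 1"
    then have "2 * C / \<epsilon> < \<bar>t j\<bar>" by (simp add: R C_def)
    then have tj: "2 * C < \<epsilon> * \<bar>t j\<bar>" using \<epsilon> by (simp add: divide_less_eq mult.commute)
    have "\<phi> (t(j := 0)) \<le> \<phi> t" using t(1) R1 by (intro t(2)) (auto simp: Box_def)
    then have "\<epsilon> * (t j)\<^sup>2 / 2 \<le> t j * x j + (cumulant N (t(j := 0)) - cumulant N t)"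
      using upd[OF j, of 0] by simp
    also have "cumulant N (t(j := 0)) - cumulant N t \<le> B * \<bar>t j\<bar>"
    proof -
      have "(\<Sum>i<m. \<bar>(t(j := 0)) i - t i\<bar>) = (\<Sum>i<m. if i = j then \<bar>t j\<bar> else 0)"
        by (intro sum.cong) auto
      then show ?thesis using cumulant_diff_le[OF N, of "t(j := 0)" t] j by simp
    qed
    also have "t j * x j \<le> \<bar>t j\<bar> * \<bar>x j\<bar>" by (metis abs_ge_self abs_mult)
    finally have "\<bar>t j\<bar> * (\<epsilon> * \<bar>t j\<bar>) \<le> \<bar>t j\<bar> * (2 * (\<bar>x j\<bar> + B))"
      by (simp add: power2_eq_square algebra_simps)
    moreover have "\<bar>t j\<bar> * (2 * (\<bar>x j\<bar> + B)) \<le> \<bar>t j\<bar> * (2 * C)" using C[OF j] by (intro mult_left_mono) auto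
    ultimately have "\<bar>t j\<bar> * (\<epsilon> * \<bar>t j\<bar>) \<le> \<bar>t j\<bar> * (2 * C)" by linarith
    moreover have "\<bar>t j\<bar> > 0" using tj \<open>C > 0\<close> by (cases "t j = 0") auto
    ultimately show False using tj by simp
  qed
  have stationary: "cumulant N (t(j := t j + s)) - cumulant N t \<le> s * (x j - \<epsilon> * t j) + s\<^sup>2 * (B\<^sup>2 * S)"
    if j: "j < m" and s: "\<bar>s\<bar> * (B * S) \<le> 1" for j s
  proof -
    obtain d where d: "\<And>s. \<bar>s\<bar> * (B * S) \<le> 1 \<Longrightarrow>
        cumulant N (t(j := t j + s)) - cumulant N t \<le> s * d + s\<^sup>2 * (B\<^sup>2 * S)"
      using sec[OF j] by blast
    \<comment> \<open>Maximality bounds the increment of the cumulant from below by s (x j -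
      \<epsilon> t j), the assumption bounds it from above by s d, both up to order s^2. Two such
      slopes must coincide.\<close>
    have "x j - \<epsilon> * t j - d = 0"
    proof (rule linear_le_quadratic_imp_zero)
      show "0 < min 1 (1 / (B * S))" using B_pos S by simp
      show "0 \<le> B\<^sup>2 * S + \<epsilon> / 2" using S \<epsilon> by simp
      fix s assume s: "\<bar>s\<bar> \<le> min 1 (1 / (B * S))"
      then have "\<bar>s\<bar> * (B * S) \<le> 1" using B_pos S by (simp add: pos_le_divide_eq)
      then have 1: "cumulant N (t(j := t j + s)) - cumulant N t \<le> s * d + s\<^sup>2 * (B\<^sup>2 * S)" by (rule d)
      have "\<bar>t j + s\<bar> \<le> R" using interior[OF j] s abs_triangle_ineq[of "t j" s] by linarith
      then have "\<phi> (t(j := t j + s)) \<le> \<phi> t" using t(1) j by (intro t(2)) (auto simp: Box_def)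
      then show "s * (x j - \<epsilon> * t j - d) \<le> s\<^sup>2 * (B\<^sup>2 * S + \<epsilon> / 2)"
        using upd[OF j, of "t j + s"] 1 by (simp add: power2_eq_square algebra_simps add_divide_distrib)
    qed
    then show ?thesis using d[OF s] by simp
  qed
  have box_le: "(\<Sum>j<m. t j * x j) - cumulant N t \<le> c" using t(1) le by (simp add: Box_def)
  have sq: "\<epsilon> * (t j)\<^sup>2 \<le> 2 * c" if j: "j < m" for j
  proof -
    \<comment> \<open>Comparison with the zero parameter, at which \<phi> vanishes, bounds the whole
      penalty by c.\<close>
    have "0 \<le> \<phi> t" using t(2)[OF zero] by (simp add: \<phi>_def)
    then have "(\<Sum>j<m. \<epsilon> * (t j)\<^sup>2 / 2) \<le> c" using box_le by (simp add: \<phi>_def sum_subtractf)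
    moreover have "\<epsilon> * (t j)\<^sup>2 / 2 \<le> (\<Sum>j<m. \<epsilon> * (t j)\<^sup>2 / 2)"
      using j \<epsilon> by (intro member_le_sum[of j "{..<m}" "\<lambda>j. \<epsilon> * (t j)\<^sup>2 / 2"]) auto
    ultimately show ?thesis by linarith
  qed
  have "(\<Sum>j<m. t j * (x j - \<epsilon> * t j)) \<le> (\<Sum>j<m. t j * x j)"
    using \<epsilon> by (intro sum_mono) (simp add: right_diff_distrib mult.left_commute[of _ \<epsilon>])
  then have "(\<Sum>j<m. t j * (x j - \<epsilon> * t j)) - cumulant N t \<le> c" using box_le by linarith
  moreover have "\<bar>t j\<bar> \<le> R" if "j < m" for j using interior[OF that] by simp
  ultimately show ?thesis using that sq stationary by blast
qed


text \<open>Under the tilt at t the statistics concentrate at y = x - \<epsilon> t, by stationarity,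
  and not at x. Close to y the density of the tilted measure is at most exp (N (c + \<eta> / 2)), so
  undoing the tilt costs no more than that. Since t is chosen anew for each N, no limit of the
  maximisers has to be taken.\<close>

lemma ldp_lower_bound:
  fixes S :: "nat \<Rightarrow> real"
  assumes conv: "\<And>t. (\<lambda>N. cumulant N t) \<longlonglongrightarrow> p t"
    and sec: "\<And>N t j. N \<ge> 1 \<Longrightarrow> j < m \<Longrightarrow> \<exists>d. \<forall>s. \<bar>s\<bar> * (B * S N) \<le> 1 \<longrightarrow>
        cumulant N (t(j := t j + s)) - cumulant N t \<le> s * d + s\<^sup>2 * (B\<^sup>2 * S N)"
    and S1: "\<And>N. N \<ge> 1 \<Longrightarrow> S N \<ge> 1" and S0: "(\<lambda>N. S N / real N) \<longlonglongrightarrow> 0"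
    and rate: "\<And>t. (\<Sum>j<m. t j * x j) - p t \<le> c"
    and \<delta>: "\<delta> > 0" and \<eta>: "\<eta> > 0"
  shows "\<forall>\<^sub>F N in sequentially.
    exp (- real N * (c + \<eta>)) \<le> prob {\<omega> \<in> space M. \<forall>j<m. \<bar>X N j \<omega> - x j\<bar> < \<delta>}"
proof -
  have "p (\<lambda>_. 0) = 0" using conv[of "\<lambda>_. 0"] by (simp add: LIMSEQ_const_iff)
  then have c: "c \<ge> 0" using rate[of "\<lambda>_. 0"] by simp
  \<comment> \<open>Chosen so that (\<epsilon> t j)^2 \<le> 2 \<epsilon> (c + \<eta> / 4) <
    (\<delta> / 2)^2, that is, y stays within \<delta> / 2 of x.\<close>
  define \<epsilon> where "\<epsilon> = \<delta>\<^sup>2 / (8 * (c + \<eta> + 1))"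
  have \<epsilon>: "\<epsilon> > 0" using c \<eta> \<delta> by (simp add: \<epsilon>_def)
  define R where "R = 2 * (B + (\<Sum>j<m. \<bar>x j\<bar>)) / \<epsilon> + 1"
  have R: "R > 0" using \<epsilon> B_pos by (simp add: R_def add_nonneg_pos sum_nonneg)
  \<comment> \<open>The three bounds put the window around y inside the target, meet the condition
    of \<open>tilted_tail_bound\<close>, and keep the variation m R u of the exponent over the
    window below \<eta> / 4.\<close>
  define u where "u = min (min (\<delta> / 2) B) (\<eta> / (4 * (real m * R + 1)))"
  have mR: "real m * R + 1 > 0" using R by (simp add: add_nonneg_pos)
  have "0 < \<eta> / (4 * (real m * R + 1))" using \<eta> mR by (intro divide_pos_pos) auto
  then have "u > 0" using \<delta> B_pos unfolding u_def by simp
  moreover have "u \<le> min (\<delta> / 2) B" unfolding u_def by (rule min.cobounded1)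
  ultimately have u: "u > 0" "u \<le> \<delta> / 2" "u \<le> B" by simp_all
  have "u \<le> \<eta> / 4 / (real m * R + 1)" by (simp add: u_def)
  then have u4: "u * (real m * R + 1) \<le> \<eta> / 4" using mR by (simp only: pos_le_divide_eq)
  define k where "k = u\<^sup>2 / (4 * B\<^sup>2)"
  have k: "k > 0" using u B_pos by (simp add: k_def)
  \<comment> \<open>Each of the 2 m tail events may carry at most 1 / (4 m + 4) of the tilted mass,
    so that at least half of it remains on A.\<close>
  define l where "l = ln (4 * real m + 4)"
  have l: "l > 0" by (simp add: l_def)
  have "\<forall>\<^sub>F N in sequentially. \<forall>t\<in>{t. (\<forall>j<m. \<bar>t j\<bar> \<le> R) \<and> (\<forall>j\<ge>m. t j = 0)}.
      (\<Sum>j<m. t j * x j) - cumulant N t \<le> c + \<eta> / 4"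
    using \<eta> by (intro rate_le_uniform[OF conv rate compact_box]) simp
  \<comment> \<open>With the tail bound exp (- k N / S N), this makes every tail at most exp (-
    l).\<close>
  moreover have "\<forall>\<^sub>F N in sequentially. S N / real N < k / l"
    using k l by (intro order_tendstoD(2)[OF S0]) simp
  \<comment> \<open>Pays for the factor 1 / 2 that is lost to the tails.\<close>
  moreover have "\<forall>\<^sub>F N in sequentially. ln 2 / real N < \<eta> / 2"
    using \<eta> lim_const_over_n[of "ln (2::real)"] by (intro order_tendstoD) auto
  ultimately show ?thesis using eventually_ge_at_top[of 1]
  proof eventually_elim
    case (elim N)
    note N = elim(4)
    have SN: "S N \<ge> 1" using S1 N by simp
    obtain t where t: "\<And>j. j < m \<Longrightarrow> \<bar>t j\<bar> \<le> R"
      "(\<Sum>j<m. t j * (x j - \<epsilon> * t j)) - cumulant N t \<le> c + \<eta> / 4"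
      "\<And>j. j < m \<Longrightarrow> \<epsilon> * (t j)\<^sup>2 \<le> 2 * (c + \<eta> / 4)"
      "\<And>j s. j < m \<Longrightarrow> \<bar>s\<bar> * (B * S N) \<le> 1 \<Longrightarrow>
        cumulant N (t(j := t j + s)) - cumulant N t \<le> s * (x j - \<epsilon> * t j) + s\<^sup>2 * (B\<^sup>2 * S N)"
    proof (rule regularised_maximiser[of N \<epsilon> "S N" R x "c + \<eta> / 4"])
      show "(\<Sum>j<m. t j * x j) - cumulant N t \<le> c + \<eta> / 4"
        if "\<forall>j<m. \<bar>t j\<bar> \<le> R" "\<forall>j\<ge>m. t j = 0" for t
        using elim(1) that by blast
    qed (use N \<epsilon> SN R_def sec[OF N] in auto)
    define y where "y j = x j - \<epsilon> * t j" for j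
    have xy: "\<bar>x j - y j\<bar> < \<delta> / 2" if j: "j < m" for j
    proof (rule power2_less_imp_less)
      have "\<bar>x j - y j\<bar>\<^sup>2 = \<epsilon> * (\<epsilon> * (t j)\<^sup>2)" by (simp add: y_def power_mult_distrib power2_eq_square)
      also have "\<dots> \<le> \<epsilon> * (2 * (c + \<eta> / 4))" using t(3)[OF j] \<epsilon> by (intro mult_left_mono) auto
      also have "\<dots> < \<epsilon> * (2 * (c + \<eta> + 1))" using \<epsilon> \<eta> by (intro mult_strict_left_mono) auto
      also have "\<dots> = (\<delta> / 2)\<^sup>2" using c \<eta> by (simp add: \<epsilon>_def power_divide field_simps)
      finally show "\<bar>x j - y j\<bar>\<^sup>2 < (\<delta> / 2)\<^sup>2" .
    qed (use \<delta> in simp)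
    define w where "w \<omega> = exp (real N * combination N t \<omega>)" for \<omega>
    have w_int: "integrable M w" unfolding w_def by (rule exp_combination_integrable)
    have w_meas [measurable]: "w \<in> borel_measurable M" using w_int by auto
    have Ew: "expectation w = exp (real N * cumulant N t)"
      unfolding w_def by (rule expectation_exp_combination[OF N])
    have X_meas [measurable]: "(\<lambda>\<omega>. X N j \<omega>) \<in> borel_measurable M" if "j < m" for j
      using stat_measurable[OF that] .
    define A where "A = {\<omega> \<in> space M. \<forall>j<m. \<bar>X N j \<omega> - y j\<bar> < u}"
    have A_eq: "A = {\<omega> \<in> space M. \<forall>j\<in>{..<m}. \<bar>X N j \<omega> - y j\<bar> < u}" by (auto simp: A_def)
    have A [measurable]: "A \<in> sets M" unfolding A_eq by measurable
    define D where "D j \<sigma> = {\<omega> \<in> space M. u \<le> \<sigma> * (X N j \<omega> - y j)}" for j \<sigma>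
    have D [measurable]: "D j \<sigma> \<in> sets M" if "j < m" for j \<sigma>
      unfolding D_def using X_meas[OF that] by measurable
    have int_ind: "integrable M (\<lambda>\<omega>. indicator E \<omega> * w \<omega>)" if "E \<in> sets M" for E
      using integrable_mult_indicator[OF that w_int] by simp
    have small: "exp (- k * (real N / S N)) \<le> 1 / (4 * real m + 4)"
    proof -
      have "S N * l < k * real N" using elim(2) l N by (simp add: field_simps)
      then have "l \<le> k * (real N / S N)" using SN by (simp add: field_simps)
      then have "exp (- k * (real N / S N)) \<le> exp (- l)" by simp
      also have "\<dots> = 1 / (4 * real m + 4)" by (simp add: l_def exp_minus inverse_eq_divide)
      finally show ?thesis .
    qed
    have tail: "expectation (\<lambda>\<omega>. indicator (D j \<sigma>) \<omega> * w \<omega>) \<le> expectation w / (4 * real m + 4)"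
      if "j < m" "\<sigma> \<in> {1, - 1}" for j \<sigma>
    proof -
      have "expectation (\<lambda>\<omega>. indicator (D j \<sigma>) \<omega> * w \<omega>) \<le> expectation w * exp (- k * (real N / S N))"
        unfolding D_def w_def Ew[unfolded w_def] k_def
        by (rule tilted_tail_bound[OF N that(1)]) (use that u SN t(4) in \<open>auto simp: y_def\<close>)
      also have "\<dots> \<le> expectation w * (1 / (4 * real m + 4))"
        using small Ew by (intro mult_left_mono) auto
      finally show ?thesis by simp
    qed
    have "expectation w \<le> expectation (\<lambda>\<omega>. indicator A \<omega> * w \<omega> +
        (\<Sum>j<m. indicator (D j 1) \<omega> * w \<omega> + indicator (D j (- 1)) \<omega> * w \<omega>))"
    proof (rule integral_mono[OF w_int])
      show "integrable M (\<lambda>\<omega>. indicator A \<omega> * w \<omega> +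
          (\<Sum>j<m. indicator (D j 1) \<omega> * w \<omega> + indicator (D j (- 1)) \<omega> * w \<omega>))"
        by (intro Bochner_Integration.integrable_add Bochner_Integration.integrable_sum int_ind A D) auto
      fix \<omega> assume \<omega>: "\<omega> \<in> space M"
      have w0: "w \<omega> \<ge> 0" by (simp add: w_def)
      have nn: "indicator (D j 1) \<omega> * w \<omega> + indicator (D j (- 1)) \<omega> * w \<omega> \<ge> 0" for j
        using w0 by (simp add: indicator_def)
      show "w \<omega> \<le> indicator A \<omega> * w \<omega> + (\<Sum>j<m. indicator (D j 1) \<omega> * w \<omega> + indicator (D j (- 1)) \<omega> * w \<omega>)"
      proof (cases "\<omega> \<in> A")
        case True
        then show ?thesis using nn by (simp add: sum_nonneg)
      next
        case False
        then obtain j where j: "j < m" "\<bar>X N j \<omega> - y j\<bar> \<ge> u" using \<omega> by (auto simp: A_def not_less)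
        then have "\<omega> \<in> D j 1 \<or> \<omega> \<in> D j (- 1)" using \<omega> by (auto simp: D_def)
        then have "w \<omega> \<le> indicator (D j 1) \<omega> * w \<omega> + indicator (D j (- 1)) \<omega> * w \<omega>"
          using w0 by (auto simp: indicator_def)
        also have "\<dots> \<le> (\<Sum>j<m. indicator (D j 1) \<omega> * w \<omega> + indicator (D j (- 1)) \<omega> * w \<omega>)"
          using j nn by (intro member_le_sum) auto
        finally show ?thesis using w0 by (simp add: add_increasing)
      qed
    qed
    also have "\<dots> = expectation (\<lambda>\<omega>. indicator A \<omega> * w \<omega>) +
        (\<Sum>j<m. expectation (\<lambda>\<omega>. indicator (D j 1) \<omega> * w \<omega>) + expectation (\<lambda>\<omega>. indicator (D j (- 1)) \<omega> * w \<omega>))"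
      by (subst Bochner_Integration.integral_add, (intro Bochner_Integration.integrable_add Bochner_Integration.integrable_sum int_ind A D; simp)+,
          subst Bochner_Integration.integral_sum, (intro Bochner_Integration.integrable_add int_ind D; simp),
          intro arg_cong2[where f = "(+)"] sum.cong refl Bochner_Integration.integral_add int_ind D) auto
    also have "(\<Sum>j<m. expectation (\<lambda>\<omega>. indicator (D j 1) \<omega> * w \<omega>) + expectation (\<lambda>\<omega>. indicator (D j (- 1)) \<omega> * w \<omega>))
        \<le> (\<Sum>j<m. 2 * (expectation w / (4 * real m + 4)))"
    proof (rule sum_mono)
      fix j assume "j \<in> {..<m}"
      then show "expectation (\<lambda>\<omega>. indicator (D j 1) \<omega> * w \<omega>) + expectation (\<lambda>\<omega>. indicator (D j (- 1)) \<omega> * w \<omega>)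
        \<le> 2 * (expectation w / (4 * real m + 4))"
        using tail[of j 1] tail[of j "- 1"] by simp
    qed
    also have "\<dots> = expectation w * (2 * real m / (4 * real m + 4))" by simp
    also have "\<dots> \<le> expectation w * (1 / 2)"
      unfolding Ew by (intro mult_left_mono) (auto simp: field_simps)
    finally have "expectation w / 2 \<le> expectation (\<lambda>\<omega>. indicator A \<omega> * w \<omega>)" by simp
    also have "\<dots> \<le> expectation (\<lambda>\<omega>. exp (real N * (c + \<eta> / 2 + cumulant N t)) * indicator A \<omega>)"
    proof (rule integral_mono[OF int_ind[OF A]])
      fix \<omega> assume "\<omega> \<in> space M"
      show "indicator A \<omega> * w \<omega> \<le> exp (real N * (c + \<eta> / 2 + cumulant N t)) * indicator A \<omega>"
      proof (cases "\<omega> \<in> A")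
        case True
        have "combination N t \<omega> - (\<Sum>j<m. t j * y j) = (\<Sum>j<m. t j * (X N j \<omega> - y j))"
          by (simp add: combination_def sum_subtractf[symmetric] right_diff_distrib)
        also have "\<dots> \<le> (\<Sum>j<m. R * u)"
        proof (rule sum_mono)
          fix j assume "j \<in> {..<m}"
          then have "\<bar>t j\<bar> * \<bar>X N j \<omega> - y j\<bar> \<le> R * u"
            using t(1)[of j] True R by (intro mult_mono) (auto simp: A_def less_imp_le)
          then show "t j * (X N j \<omega> - y j) \<le> R * u" by (metis abs_ge_self abs_mult order_trans)
        qed
        also have "\<dots> \<le> \<eta> / 4" using u(1) u4 by (simp add: algebra_simps)
        finally have "combination N t \<omega> \<le> c + \<eta> / 2 + cumulant N t" using t(2) by (simp add: y_def)
        then have "w \<omega> \<le> exp (real N * (c + \<eta> / 2 + cumulant N t))"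
          by (simp add: w_def mult_left_mono)
        then show ?thesis using True by simp
      qed simp
    qed (simp add: emeasure_eq_measure less_top[symmetric])
    also have "\<dots> = exp (real N * (c + \<eta> / 2 + cumulant N t)) * prob A" by simp
    finally have "exp (real N * cumulant N t) * (1 / 2)
        \<le> exp (real N * cumulant N t) * (exp (real N * (c + \<eta> / 2)) * prob A)"
      by (simp add: Ew exp_add distrib_left mult_ac)
    then have half: "1 / 2 \<le> exp (real N * (c + \<eta> / 2)) * prob A" by (simp only: mult_le_cancel_left_pos exp_gt_zero)
    have "exp (- real N * (c + \<eta>)) = exp (- (real N * (\<eta> / 2))) * exp (- (real N * (c + \<eta> / 2)))"
      by (simp add: exp_add[symmetric] algebra_simps)
    also have "\<dots> \<le> exp (- ln 2) * exp (- (real N * (c + \<eta> / 2)))"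
    proof (rule mult_right_mono)
      have "ln 2 < real N * (\<eta> / 2)" using elim(3) N by (simp add: divide_less_eq mult.commute)
      then show "exp (- (real N * (\<eta> / 2))) \<le> exp (- ln 2)" by simp
    qed simp
    also have "\<dots> = (1 / 2) * exp (- (real N * (c + \<eta> / 2)))" by (simp add: exp_minus)
    also have "\<dots> \<le> (exp (real N * (c + \<eta> / 2)) * prob A) * exp (- (real N * (c + \<eta> / 2)))"
      using half by (intro mult_right_mono) auto
    also have "\<dots> = prob A" by (simp add: exp_minus)
    also have "\<dots> \<le> prob {\<omega> \<in> space M. \<forall>j<m. \<bar>X N j \<omega> - x j\<bar> < \<delta>}"
    proof (rule finite_measure_mono)
      show "A \<subseteq> {\<omega> \<in> space M. \<forall>j<m. \<bar>X N j \<omega> - x j\<bar> < \<delta>}"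
      proof safe
        fix \<omega> j assume "\<omega> \<in> A" "j < m"
        then have "\<bar>X N j \<omega> - y j\<bar> < u" by (simp add: A_def)
        then show "\<bar>X N j \<omega> - x j\<bar> < \<delta>" using xy[OF \<open>j < m\<close>] u(2) by linarith
      qed (simp add: A_def)
      have "{\<omega> \<in> space M. \<forall>j<m. \<bar>X N j \<omega> - x j\<bar> < \<delta>} = {\<omega> \<in> space M. \<forall>j\<in>{..<m}. \<bar>X N j \<omega> - x j\<bar> < \<delta>}"
        by auto
      then show "{\<omega> \<in> space M. \<forall>j<m. \<bar>X N j \<omega> - x j\<bar> < \<delta>} \<in> sets M" by simp
    qed
    finally show ?case .
  qed
qed

end

subsection \<open>Block decomposition of the logarithmic moments\<close>

text \<open>Locality with the set of coordinates kept explicit, because the primes in Q are read off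
  from it.\<close>

definition depends_on :: "nat set \<Rightarrow> ((nat \<Rightarrow> real) \<Rightarrow> real) \<Rightarrow> bool" where
  "depends_on K f \<longleftrightarrow> (\<forall>\<sigma>\<in>spin_configs {1..}. \<forall>\<tau>\<in>spin_configs {1..}. (\<forall>k\<in>K. \<sigma> k = \<tau> k) \<longrightarrow> f \<sigma> = f \<tau>)"

lemma local_function_iff: "local_function f \<longleftrightarrow> (\<exists>K. finite K \<and> K \<subseteq> {1..} \<and> depends_on K f)"
  by (simp add: local_function_def depends_on_def)

lemma depends_onD:
  "depends_on K f \<Longrightarrow> \<sigma> \<in> spin_configs {1..} \<Longrightarrow> \<tau> \<in> spin_configs {1..} \<Longrightarrow> (\<And>k. k \<in> K \<Longrightarrow> \<sigma> k = \<tau> k) \<Longrightarrow> f \<sigma> = f \<tau>"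
  unfolding depends_on_def by metis

lemma depends_on_mono:
  assumes "depends_on K f" "K \<subseteq> L" shows "depends_on L f"
  unfolding depends_on_def
proof (intro ballI impI)
  fix \<sigma> \<tau> assume "\<sigma> \<in> spin_configs {1..}" "\<tau> \<in> spin_configs {1..}" and eq: "\<forall>k\<in>L. \<sigma> k = \<tau> k"
  then show "f \<sigma> = f \<tau>" by (intro depends_onD[OF assms(1)]) (use eq assms(2) in blast)+
qed

lemma depends_on_sum:
  assumes "\<And>j. j \<in> I \<Longrightarrow> depends_on K (f j)"
  shows "depends_on K (\<lambda>\<sigma>. \<Sum>j\<in>I. t j * f j \<sigma>)"
  unfolding depends_on_def
proof (intro ballI impI)
  fix \<sigma> \<tau> assume "\<sigma> \<in> spin_configs {1..}" "\<tau> \<in> spin_configs {1..}" "\<forall>k\<in>K. \<sigma> k = \<tau> k"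
  then have "f j \<sigma> = f j \<tau>" if "j \<in> I" for j using depends_onD[OF assms[OF that]] by blast
  then show "(\<Sum>j\<in>I. t j * f j \<sigma>) = (\<Sum>j\<in>I. t j * f j \<tau>)" by (intro sum.cong) auto
qed

text \<open>Completes spins on K by the value 1, so that a function that reads only K can be
  evaluated on a partial configuration.\<close>

definition fill_up :: "nat set \<Rightarrow> (nat \<Rightarrow> real) \<Rightarrow> nat \<Rightarrow> real" where
  "fill_up K w = (\<lambda>j\<in>{1..}. if j \<in> K then w j else 1)"

lemma fill_up_spin_configs:
  assumes "\<And>j. j \<in> K \<Longrightarrow> 1 \<le> j \<Longrightarrow> w j \<in> {-1, 1}"
  shows "fill_up K w \<in> spin_configs {1..}"
  unfolding fill_up_def restrict_PiE_iff
proof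
  fix j :: nat assume "j \<in> {1..}"
  then show "(if j \<in> K then w j else 1) \<in> {- 1, 1}" using assms[of j] by (cases "j \<in> K") simp_all
qed

lemma fill_up_apply: "j \<in> K \<Longrightarrow> 1 \<le> j \<Longrightarrow> fill_up K w j = w j"
  by (simp add: fill_up_def)

lemma depends_on_finite_image:
  assumes "depends_on K f" "finite K" "K \<subseteq> {1..}"
  shows "finite (f ` spin_configs {1..})"
proof -
  have "f ` spin_configs {1..} \<subseteq> (\<lambda>w. f (fill_up K w)) ` spin_configs K"
  proof
    fix v assume "v \<in> f ` spin_configs {1..}"
    then obtain \<sigma> where \<sigma>: "\<sigma> \<in> spin_configs {1..}" "v = f \<sigma>" by auto
    have w: "\<sigma> j \<in> {-1, 1}" if "j \<in> K" for j using PiE_mem[OF \<sigma>(1)] that assms(3) by auto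
    then have "f \<sigma> = f (fill_up K (restrict \<sigma> K))"
      using assms(3) by (intro depends_onD[OF assms(1) \<sigma>(1)] fill_up_spin_configs) (auto simp: fill_up_apply)
    moreover have "restrict \<sigma> K \<in> spin_configs K" using w by (subst restrict_PiE_iff) simp
    ultimately show "v \<in> (\<lambda>w. f (fill_up K w)) ` spin_configs K" using \<sigma>(2) by blast
  qed
  then show ?thesis using finite_surj[OF finite_spin_configs[OF assms(2)]] by blast
qed

text \<open>Such a function is a finite combination of cylinder indicators, one for each
  configuration on K.\<close>

lemma depends_on_measurable:
  assumes "depends_on K f" "finite K" "K \<subseteq> {1..}"
  shows "f \<in> borel_measurable (spin_algebra {1..})"
proof -
  have eq: "f \<sigma> = (\<Sum>w\<in>spin_configs K. f (fill_up K w) * indicator {\<sigma> \<in> spin_configs {1..}. restrict \<sigma> K = w} \<sigma>)"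
    if "\<sigma> \<in> space (spin_algebra {1..})" for \<sigma>
  proof -
    have \<sigma>: "\<sigma> \<in> spin_configs {1..}" using that by simp
    have w: "\<sigma> j \<in> {-1, 1}" if "j \<in> K" for j using PiE_mem[OF \<sigma>] that assms(3) by auto
    then have "f \<sigma> = f (fill_up K (restrict \<sigma> K))"
      using assms(3) by (intro depends_onD[OF assms(1) \<sigma>] fill_up_spin_configs) (auto simp: fill_up_apply)
    moreover have "restrict \<sigma> K \<in> spin_configs K" using w by (subst restrict_PiE_iff) simp
    moreover have "(\<Sum>w\<in>spin_configs K. f (fill_up K w) * indicator {\<sigma> \<in> spin_configs {1..}. restrict \<sigma> K = w} \<sigma>) =
        (\<Sum>w\<in>spin_configs K. if restrict \<sigma> K = w then f (fill_up K w) else 0)"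
      using \<sigma> by (intro sum.cong) (auto simp: indicator_def)
    ultimately show ?thesis using finite_spin_configs[OF assms(2)] by simp
  qed
  show ?thesis
    by (subst measurable_cong[OF eq], assumption)
      (intro borel_measurable_sum borel_measurable_times borel_measurable_const borel_measurable_indicator
        cylinder_measurable assms)
qed

lemma depends_on_bounded:
  assumes "depends_on K f" "finite K" "K \<subseteq> {1..}"
  obtains M :: real where "M > 0" "\<And>\<sigma>. \<sigma> \<in> spin_configs {1..} \<Longrightarrow> \<bar>f \<sigma>\<bar> \<le> M"
proof -
  have "bounded (f ` spin_configs {1..})" using depends_on_finite_image[OF assms] by (rule finite_imp_bounded)
  then obtain M where M: "M > 0" "\<forall>v\<in>f ` spin_configs {1..}. norm v \<le> M" unfolding bounded_pos by blast
  then show ?thesis by (intro that[of M]) auto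
qed

lemma mult_shift_spin_configs:
  assumes "1 \<le> i" "\<sigma> \<in> spin_configs {1..}"
  shows "mult_shift i \<sigma> \<in> spin_configs {1..}"
proof -
  have "\<sigma> (i * j) \<in> {-1, 1}" if "j \<in> {1..}" for j
    using that assms(1) by (intro PiE_mem[OF assms(2)]) simp
  then show ?thesis unfolding mult_shift_def by (subst restrict_PiE_iff) simp
qed

lemma mult_shift_measurable:
  assumes "1 \<le> i" shows "mult_shift i \<in> spin_algebra {1..} \<rightarrow>\<^sub>M spin_algebra {1..}"
  unfolding mult_shift_def[abs_def]
proof (rule reindex_measurable)
  fix j :: nat assume "j \<in> {1..}"
  then show "i * j \<in> {1..}" using assms by simp
qed

section \<open>Second-order bound for exponential moments\<close>

lemma exp_le_quadratic:
  fixes u :: real assumes "\<bar>u\<bar> \<le> 1" shows "exp u \<le> 1 + u + u\<^sup>2"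
proof (cases "u \<ge> 0")
  case True
  then show ?thesis using exp_bound[of u] assms by simp
next
  case False
  have "1 + - u \<le> exp (- u)" by (rule exp_ge_add_one_self)
  then have "exp u \<le> 1 / (1 - u)" using False by (simp add: exp_minus field_simps)
  also have "\<dots> \<le> 1 + u + u\<^sup>2"
  proof -
    have "(1 + u + u\<^sup>2) * (1 - u) = 1 - u ^ 3" by (simp add: algebra_simps power2_eq_square power3_eq_cube)
    moreover have "u ^ 3 \<le> 0" using False by (simp add: power_le_zero_eq)
    ultimately show ?thesis using False by (simp add: divide_le_eq)
  qed
  finally show ?thesis .
qed

text \<open>The slope d is the mean of F under the tilt by H. From exp u \<le> 1 + u + u^2 and 1 + v
  \<le> exp v comes a quadratic term that involves only the bound on F, hence is uniform in the
  tilt.\<close>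

lemma (in prob_space) log_mgf_second_order:
  fixes H F :: "'a \<Rightarrow> real"
  assumes [measurable]: "H \<in> borel_measurable M" "F \<in> borel_measurable M"
    and H: "\<And>\<omega>. \<omega> \<in> space M \<Longrightarrow> \<bar>H \<omega>\<bar> \<le> a" and F: "\<And>\<omega>. \<omega> \<in> space M \<Longrightarrow> \<bar>F \<omega>\<bar> \<le> b"
  shows "\<exists>d. \<forall>s. \<bar>s\<bar> * b \<le> 1 \<longrightarrow>
    ln (expectation (\<lambda>\<omega>. exp (H \<omega> + s * F \<omega>))) - ln (expectation (\<lambda>\<omega>. exp (H \<omega>))) \<le> s * d + s\<^sup>2 * b\<^sup>2"
proof -
  let ?Z = "expectation (\<lambda>\<omega>. exp (H \<omega>))"
  have expH: "exp (H \<omega>) \<le> exp a" if "\<omega> \<in> space M" for \<omega> using H[OF that] by simp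
  have intH: "integrable M (\<lambda>\<omega>. exp (H \<omega>))"
    using expH by (intro integrable_const_bound[of _ "exp a"]) auto
  have Z: "?Z > 0" by (rule expectation_exp_pos[OF intH])
  have intFH: "integrable M (\<lambda>\<omega>. F \<omega> * exp (H \<omega>))"
  proof (rule integrable_const_bound[of _ "b * exp a"])
    show "AE \<omega> in M. norm (F \<omega> * exp (H \<omega>)) \<le> b * exp a"
      using F expH by (intro AE_I2) (auto simp: abs_mult intro!: mult_mono intro: order_trans[OF abs_ge_zero])
  qed simp
  define d where "d = expectation (\<lambda>\<omega>. F \<omega> * exp (H \<omega>)) / ?Z"
  show ?thesis
  proof (intro exI[of _ d] allI impI)
    fix s assume s: "\<bar>s\<bar> * b \<le> 1"
    have sF: "\<bar>s * F \<omega>\<bar> \<le> 1" if "\<omega> \<in> space M" for \<omega>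
      using mult_left_mono[OF F[OF that], of "\<bar>s\<bar>"] s by (simp add: abs_mult)
    have int: "integrable M (\<lambda>\<omega>. exp (H \<omega> + s * F \<omega>))"
    proof (rule integrable_const_bound[of _ "exp (a + 1)"])
      show "AE \<omega> in M. norm (exp (H \<omega> + s * F \<omega>)) \<le> exp (a + 1)"
      proof (rule AE_I2)
        fix \<omega> assume \<omega>: "\<omega> \<in> space M"
        have "H \<omega> + s * F \<omega> \<le> a + 1" using H[OF \<omega>] sF[OF \<omega>] by linarith
        then show "norm (exp (H \<omega> + s * F \<omega>)) \<le> exp (a + 1)" by simp
      qed
    qed simp
    have "expectation (\<lambda>\<omega>. exp (H \<omega> + s * F \<omega>)) \<le>
        expectation (\<lambda>\<omega>. (1 + s\<^sup>2 * b\<^sup>2) * exp (H \<omega>) + s * (F \<omega> * exp (H \<omega>)))"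
    proof (rule integral_mono[OF int])
      show "integrable M (\<lambda>\<omega>. (1 + s\<^sup>2 * b\<^sup>2) * exp (H \<omega>) + s * (F \<omega> * exp (H \<omega>)))"
        by (intro Bochner_Integration.integrable_add integrable_mult_right intH intFH)
      fix \<omega> assume \<omega>: "\<omega> \<in> space M"
      have "exp (s * F \<omega>) \<le> 1 + s * F \<omega> + (s * F \<omega>)\<^sup>2" by (rule exp_le_quadratic[OF sF[OF \<omega>]])
      also have "(s * F \<omega>)\<^sup>2 \<le> s\<^sup>2 * b\<^sup>2"
        unfolding power_mult_distrib using F[OF \<omega>] by (intro mult_left_mono power2_le_iff_abs_le[THEN iffD2]) auto
      finally have "exp (H \<omega>) * exp (s * F \<omega>) \<le> exp (H \<omega>) * (1 + s * F \<omega> + s\<^sup>2 * b\<^sup>2)"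
        by (intro mult_left_mono) auto
      then show "exp (H \<omega> + s * F \<omega>) \<le> (1 + s\<^sup>2 * b\<^sup>2) * exp (H \<omega>) + s * (F \<omega> * exp (H \<omega>))"
        by (simp add: exp_add algebra_simps)
    qed
    also have "\<dots> = (1 + s\<^sup>2 * b\<^sup>2) * ?Z + s * expectation (\<lambda>\<omega>. F \<omega> * exp (H \<omega>))"
      by (subst Bochner_Integration.integral_add) (auto intro: intH intFH)
    also have "\<dots> = ?Z * (1 + (s * d + s\<^sup>2 * b\<^sup>2))" using Z by (simp add: d_def field_simps)
    also have "\<dots> \<le> ?Z * exp (s * d + s\<^sup>2 * b\<^sup>2)" using Z exp_ge_add_one_self by (intro mult_left_mono) auto
    finally have "ln (expectation (\<lambda>\<omega>. exp (H \<omega> + s * F \<omega>))) \<le> ln (?Z * exp (s * d + s\<^sup>2 * b\<^sup>2))"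
      using expectation_exp_pos[OF int] Z by (subst ln_le_cancel_iff) auto
    also have "\<dots> = ln ?Z + (s * d + s\<^sup>2 * b\<^sup>2)" using Z by (simp add: ln_mult)
    finally show "ln (expectation (\<lambda>\<omega>. exp (H \<omega> + s * F \<omega>))) - ln ?Z \<le> s * d + s\<^sup>2 * b\<^sup>2" by simp
  qed
qed

lemma (in prob_space) indep_vars_reindex:
  assumes g: "inj_on g I" and ind: "indep_vars M' X (g ` I)"
  shows "indep_vars (\<lambda>i. M' (g i)) (\<lambda>i. X (g i)) I"
  unfolding indep_vars_def2
proof (intro conjI ballI indep_setsI)
  note ind' = ind[unfolded indep_vars_def2]
  fix i assume i: "i \<in> I"
  then show rv: "random_variable (M' (g i)) (X (g i))" using ind' by blast
  show "{X (g i) -` A \<inter> space M |A. A \<in> sets (M' (g i))} \<subseteq> events"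
    using measurable_sets[OF rv] by auto
next
  note ind' = ind[unfolded indep_vars_def2]
  fix A J assume J: "J \<noteq> {}" "J \<subseteq> I" "finite J"
    and A: "\<forall>j\<in>J. A j \<in> {X (g j) -` A \<inter> space M |A. A \<in> sets (M' (g j))}"
  have inv: "the_inv_into I g (g j) = j" if "j \<in> J" for j
    using that J(2) by (intro the_inv_into_f_f[OF g]) auto
  have "prob (\<Inter>k\<in>g ` J. A (the_inv_into I g k)) = (\<Prod>k\<in>g ` J. prob (A (the_inv_into I g k)))"
    by (rule indep_setsD[OF conjunct2[OF ind']]) (use J A inv in auto)
  also have "\<dots> = (\<Prod>j\<in>J. prob (A (the_inv_into I g (g j))))"
    using inj_on_subset[OF g J(2)] by (simp add: prod.reindex)
  finally show "prob (\<Inter>j\<in>J. A j) = (\<Prod>j\<in>J. prob (A j))" using inv by simp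
qed

section \<open>Layers for an enlarged set of primes\<close>

locale layer_unique_gibbs = multiplicative_potential U \<A> J + prob_space \<mu>
  for U \<A> J and \<mu> :: "(nat \<Rightarrow> real) measure" +
  assumes unique: "layer_unique \<A> J" and gibbs: "gibbs_measure {1..} U \<mu>"

locale layer_unique_gibbs_primes = layer_unique_gibbs +
  fixes Q :: "nat set"
  assumes Q: "finite Q" "\<And>p. p \<in> Q \<Longrightarrow> prime p" "base_primes \<A> \<subseteq> Q"
begin

abbreviation T :: "nat set" where "T \<equiv> smooth_numbers Q"

text \<open>A Q-layer, indexed by the smooth numbers themselves instead of exponent vectors, because
  shifts act on it by multiplication.\<close>

definition zoom :: "nat \<Rightarrow> (nat \<Rightarrow> real) \<Rightarrow> nat \<Rightarrow> real" where
  "zoom r \<sigma> = (\<lambda>t\<in>T. \<sigma> (r * t))"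

lemma sets_mu: "sets \<mu> = sets (spin_algebra {1..})" and space_mu: "space \<mu> = spin_configs {1..}"
  by (rule gibbs_measureD(2)[OF gibbs], rule gibbs_measureD(3)[OF gibbs])

lemma measurable_mu: "f \<in> spin_algebra {1..} \<rightarrow>\<^sub>M N \<Longrightarrow> f \<in> \<mu> \<rightarrow>\<^sub>M N"
  by (subst measurable_cong_sets[OF sets_mu refl])

lemma rough_Q_P: "r \<in> rough_numbers Q \<Longrightarrow> r \<in> rough_numbers P"
  using Q(3) unfolding rough_numbers_def by blast

text \<open>A \<open>Q\<close>-layer is a disjoint union of \<open>P\<close>-layers, indexed by the \<open>Q\<close>-smooth, \<open>P\<close>-rough numbers.\<close>

lemma zooms_iid:
  shows "indep_vars (\<lambda>_. spin_algebra T) zoom (rough_numbers Q)"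
    and "r \<in> rough_numbers Q \<Longrightarrow> distr \<mu> (spin_algebra T) (zoom r) = distr \<mu> (spin_algebra T) (zoom 1)"
proof -
  obtain \<nu> where \<nu>: "prob_space \<nu>" "sets \<nu> = sets (spin_algebra sites)"
    and ind: "indep_vars (\<lambda>_. spin_algebra sites) layer (rough_numbers P)"
    and law': "\<forall>r\<in>rough_numbers P. distr \<mu> (spin_algebra sites) (layer r) = \<nu>"
    by (rule layers_iid[OF unique gibbs])
  have law: "distr \<mu> (spin_algebra sites) (layer r) = \<nu>" if "r \<in> rough_numbers P" for r
    using law' that by blast
  \<comment> \<open>The Q-layer of r consists of the P-layers of r w with w in W. Below, each t in T
    is written as the site x t of the layer w t, and this choice does not depend on r.\<close>
  define W where "W = T \<inter> rough_numbers P"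
  have W1: "1 \<in> W" by (simp add: W_def)
  have rW: "r * w \<in> rough_numbers P" if "r \<in> rough_numbers Q" "w \<in> W" for r w
    using that rough_Q_P[OF that(1)] rough_numbers_ge_1 rough_numbers_mult_iff[of r w P] by (auto simp: W_def)
  have "\<exists>w x. w \<in> W \<and> x \<in> sites \<and> t = site w x" if t: "t \<in> T" for t
  proof -
    obtain w x where w: "w \<in> rough_numbers P" "x \<in> sites" "t = site w x"
      using site_exists[OF smooth_numbers_ge_1[OF t]] by blast
    then have "w \<in> T"
      using t rough_numbers_ge_1[OF w(1)] monomial_ge_1[of x] smooth_numbers_mult_iff[of w "prime_monomial P x" Q]
      by (simp add: site_def)
    then show ?thesis using w by (auto simp: W_def)
  qed
  then obtain w x where wx: "\<And>t. t \<in> T \<Longrightarrow> w t \<in> W" "\<And>t. t \<in> T \<Longrightarrow> x t \<in> sites" "\<And>t. t \<in> T \<Longrightarrow> t = site (w t) (x t)"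
    by metis
  have layer_wx: "layer (r * w t) \<sigma> (x t) = \<sigma> (r * t)" if "t \<in> T" for r t \<sigma>
    using wx(2)[OF that] wx(3)[OF that] by (simp add: layer_def site_def mult.assoc)
  define K where "K r = (\<lambda>w. r * w) ` W" for r
  have ind': "indep_vars (\<lambda>r. PiM (K r) (\<lambda>_. spin_algebra sites)) (\<lambda>r \<sigma>. restrict (\<lambda>i. layer i \<sigma>) (K r)) (rough_numbers Q)"
  proof (rule indep_vars_restrict[OF ind])
    show "K r \<subseteq> rough_numbers P" if "r \<in> rough_numbers Q" for r using rW that by (auto simp: K_def)
    \<comment> \<open>A common element of \<open>K r\<close> and \<open>K r'\<close> has two
      factorisations into a Q-rough and a Q-smooth part, so r = r'.\<close>
    show "disjoint_family_on K (rough_numbers Q)"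
      unfolding disjoint_family_on_def
    proof (intro ballI impI)
      fix r r' assume r: "r \<in> rough_numbers Q" "r' \<in> rough_numbers Q" "r \<noteq> r'"
      have False if "i \<in> K r" "i \<in> K r'" for i
        using that r rough_smooth_unique[of r Q _ r'] by (auto simp: K_def W_def)
      then show "K r \<inter> K r' = {}" by blast
    qed
  qed
  \<comment> \<open>Reassembles a Q-layer from its P-layers; measurability of this map carries the
    grouped independence over to \<open>zoom\<close>.\<close>
  define \<Theta> where "\<Theta> r y = (\<lambda>t\<in>T. y (r * w t) (x t))" for r :: nat and y :: "nat \<Rightarrow> (nat \<Rightarrow> nat) \<Rightarrow> real"
  have \<Theta>: "\<Theta> r \<in> PiM (K r) (\<lambda>_. spin_algebra sites) \<rightarrow>\<^sub>M spin_algebra T" for r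
    unfolding \<Theta>_def
  proof (rule measurable_into_spin_algebra)
    fix t assume t: "t \<in> T"
    have "r * w t \<in> K r" unfolding K_def by (rule imageI[OF wx(1)[OF t]])
    note comp = measurable_component_singleton[OF this, of "\<lambda>_. spin_algebra sites"]
    from measurable_compose[OF comp measurable_spin_coordinate[OF wx(2)[OF t]]] t
    show "(\<lambda>y. (\<lambda>t\<in>T. y (r * w t) (x t)) t) \<in> PiM (K r) (\<lambda>_. spin_algebra sites) \<rightarrow>\<^sub>M count_space {-1, 1}"
      by simp
  qed auto
  have "indep_vars (\<lambda>_. spin_algebra T) (\<lambda>r \<sigma>. \<Theta> r (restrict (\<lambda>i. layer i \<sigma>) (K r))) (rough_numbers Q)"
    by (rule indep_vars_compose2[OF ind' \<Theta>])
  moreover have "(\<lambda>r \<sigma>. \<Theta> r (restrict (\<lambda>i. layer i \<sigma>) (K r))) = zoom"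
    using wx(1) by (auto simp: fun_eq_iff \<Theta>_def zoom_def layer_wx K_def restrict_def)
  ultimately show "indep_vars (\<lambda>_. spin_algebra T) zoom (rough_numbers Q)" by simp
  \<comment> \<open>The right-hand side does not mention r: every Q-layer is the image of the same
    product of copies of \<nu> under one fixed map.\<close>
  have zoom_law: "distr \<mu> (spin_algebra T) (zoom r) = distr (PiM W (\<lambda>_. \<nu>)) (spin_algebra T) (\<lambda>y. \<lambda>t\<in>T. y (w t) (x t))"
    if r: "r \<in> rough_numbers Q" for r
  proof -
    have "inj_on (\<lambda>w. r * w) W" using rough_numbers_ge_1[OF r] by (auto simp: inj_on_def)
    moreover have "indep_vars (\<lambda>_. spin_algebra sites) layer ((\<lambda>w. r * w) ` W)"
      using rW[OF r] by (intro indep_vars_subset[OF ind]) auto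
    ultimately have "indep_vars (\<lambda>_. spin_algebra sites) (\<lambda>w \<sigma>. layer (r * w) \<sigma>) W"
      by (rule indep_vars_reindex)
    moreover have lm: "layer (r * w) \<in> \<mu> \<rightarrow>\<^sub>M spin_algebra sites" if "w \<in> W" for w
      by (rule measurable_mu[OF layer_measurable[OF rough_numbers_ge_1[OF rW[OF r that]]]])
    moreover have "W \<noteq> {}" using W1 by blast
    ultimately have "distr \<mu> (PiM W (\<lambda>_. spin_algebra sites)) (\<lambda>\<sigma>. \<lambda>w\<in>W. layer (r * w) \<sigma>) =
        PiM W (\<lambda>w. distr \<mu> (spin_algebra sites) (layer (r * w)))"
      using indep_vars_iff_distr_eq_PiM'[of W "\<lambda>w. layer (r * w)" "\<lambda>_. spin_algebra sites"] by blast
    also have "\<dots> = PiM W (\<lambda>_. \<nu>)" using rW[OF r] by (intro PiM_cong refl law) auto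
    finally have joint: "distr \<mu> (PiM W (\<lambda>_. spin_algebra sites)) (\<lambda>\<sigma>. \<lambda>w\<in>W. layer (r * w) \<sigma>) = PiM W (\<lambda>_. \<nu>)" .
    have m1: "(\<lambda>y. \<lambda>t\<in>T. y (w t) (x t)) \<in> PiM W (\<lambda>_. spin_algebra sites) \<rightarrow>\<^sub>M spin_algebra T"
      using \<Theta>[of 1] by (simp add: \<Theta>_def[abs_def] K_def)
    have m2: "(\<lambda>\<sigma>. \<lambda>w\<in>W. layer (r * w) \<sigma>) \<in> \<mu> \<rightarrow>\<^sub>M PiM W (\<lambda>_. spin_algebra sites)"
      using lm by (rule measurable_restrict)
    have "distr (PiM W (\<lambda>_. \<nu>)) (spin_algebra T) (\<lambda>y. \<lambda>t\<in>T. y (w t) (x t)) =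
        distr \<mu> (spin_algebra T) ((\<lambda>y. \<lambda>t\<in>T. y (w t) (x t)) \<circ> (\<lambda>\<sigma>. \<lambda>w\<in>W. layer (r * w) \<sigma>))"
      unfolding joint[symmetric] by (rule distr_distr[OF m1 m2])
    also have "(\<lambda>y. \<lambda>t\<in>T. y (w t) (x t)) \<circ> (\<lambda>\<sigma>. \<lambda>w\<in>W. layer (r * w) \<sigma>) = zoom r"
      using wx(1) by (auto simp: fun_eq_iff zoom_def layer_wx restrict_def)
    finally show ?thesis ..
  qed
  show "distr \<mu> (spin_algebra T) (zoom r) = distr \<mu> (spin_algebra T) (zoom 1)" if "r \<in> rough_numbers Q"
    unfolding zoom_law[OF that] zoom_law[OF one_in_rough_numbers(1)] ..
qed

end

section \<open>Blocks and their logarithmic moments\<close>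

context layer_unique_gibbs_primes
begin

text \<open>The shift of f by s, read off a configuration z on one layer. Spins off T are filled in
  by 1, which is harmless when f reads only coordinates in T.\<close>

definition shifted :: "((nat \<Rightarrow> real) \<Rightarrow> real) \<Rightarrow> nat \<Rightarrow> (nat \<Rightarrow> real) \<Rightarrow> real" where
  "shifted f s z = f (fill_up T (\<lambda>j. z (s * j)))"

definition block :: "((nat \<Rightarrow> real) \<Rightarrow> real) \<Rightarrow> nat \<Rightarrow> (nat \<Rightarrow> real) \<Rightarrow> real" where
  "block f n z = (\<Sum>s | s \<in> T \<and> s \<le> n. shifted f s z)"

lemma smooth_mult: "s \<in> T \<Longrightarrow> j \<in> T \<Longrightarrow> s * j \<in> T"
  using smooth_numbers_mult_iff[of s j Q] smooth_numbers_ge_1 by blast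

lemma fill_up_scaled:
  assumes "z \<in> spin_configs T" "s \<in> T"
  shows "fill_up T (\<lambda>j. z (s * j)) \<in> spin_configs {1..}"
  using PiE_mem[OF assms(1) smooth_mult[OF assms(2)]] by (intro fill_up_spin_configs)

lemma zoom_spin_configs:
  assumes "1 \<le> r" "\<sigma> \<in> spin_configs {1..}"
  shows "zoom r \<sigma> \<in> spin_configs T"
  unfolding zoom_def restrict_PiE_iff
proof
  fix t assume "t \<in> T"
  then have "r * t \<in> {1..}" using assms(1) smooth_numbers_ge_1[of t Q] by simp
  then show "\<sigma> (r * t) \<in> {-1, 1}" by (rule PiE_mem[OF assms(2)])
qed

lemma shifted_zoom:
  assumes f: "depends_on K f" "K \<subseteq> T" and \<sigma>: "\<sigma> \<in> spin_configs {1..}" and r: "1 \<le> r" and s: "s \<in> T"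
  shows "shifted f s (zoom r \<sigma>) = f (mult_shift (r * s) \<sigma>)"
  unfolding shifted_def
proof (rule depends_onD[OF f(1)])
  show "fill_up T (\<lambda>j. zoom r \<sigma> (s * j)) \<in> spin_configs {1..}"
    by (rule fill_up_scaled[OF zoom_spin_configs[OF r \<sigma>] s])
  have "1 \<le> r * s" using r smooth_numbers_ge_1[OF s] by simp
  then show "mult_shift (r * s) \<sigma> \<in> spin_configs {1..}" using \<sigma> by (rule mult_shift_spin_configs)
  fix k assume "k \<in> K"
  then have k: "k \<in> T" "1 \<le> k" using f(2) smooth_numbers_ge_1 by blast+
  then show "fill_up T (\<lambda>j. zoom r \<sigma> (s * j)) k = mult_shift (r * s) \<sigma> k"
    using smooth_mult[OF s k(1)] by (simp add: fill_up_apply zoom_def mult_shift_def mult.assoc)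
qed

lemma zoom_measurable: "1 \<le> r \<Longrightarrow> zoom r \<in> \<mu> \<rightarrow>\<^sub>M spin_algebra T"
proof (rule measurable_mu)
  assume r: "1 \<le> r"
  show "zoom r \<in> spin_algebra {1..} \<rightarrow>\<^sub>M spin_algebra T"
    unfolding zoom_def[abs_def]
  proof (rule reindex_measurable)
    fix t assume "t \<in> T"
    then show "r * t \<in> {1..}" using r smooth_numbers_ge_1[of t Q] by simp
  qed
qed

lemma shifted_measurable:
  assumes f: "f \<in> borel_measurable (spin_algebra {1..})" and s: "s \<in> T"
  shows "shifted f s \<in> borel_measurable (spin_algebra T)"
  unfolding shifted_def[abs_def]
proof (rule measurable_compose[OF _ f], rule measurable_into_spin_algebra)
  fix i :: nat assume i: "i \<in> {1..}"
  show "(\<lambda>z. fill_up T (\<lambda>j. z (s * j)) i) \<in> spin_algebra T \<rightarrow>\<^sub>M count_space {-1, 1}"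
  proof (cases "i \<in> T")
    case True
    then show ?thesis using i measurable_spin_coordinate[OF smooth_mult[OF s True]] by (simp add: fill_up_def)
  next
    case False
    then show ?thesis using i by (simp add: fill_up_def)
  qed
qed (simp add: fill_up_def)

lemma block_measurable:
  "f \<in> borel_measurable (spin_algebra {1..}) \<Longrightarrow> block f n \<in> borel_measurable (spin_algebra T)"
  unfolding block_def[abs_def] by (intro borel_measurable_sum shifted_measurable) auto

lemma block_bound:
  assumes M: "\<And>\<sigma>. \<sigma> \<in> spin_configs {1..} \<Longrightarrow> \<bar>f \<sigma>\<bar> \<le> M" and z: "z \<in> spin_configs T"
  shows "\<bar>block f n z\<bar> \<le> M * real (smooth_count Q n)"
proof -
  have "\<bar>block f n z\<bar> \<le> (\<Sum>s | s \<in> T \<and> s \<le> n. \<bar>shifted f s z\<bar>)" unfolding block_def by (rule sum_abs)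
  also have "\<dots> \<le> (\<Sum>s | s \<in> T \<and> s \<le> n. M)"
    unfolding shifted_def using fill_up_scaled[OF z] by (intro sum_mono M) simp
  finally show ?thesis by (simp add: smooth_count_def mult.commute)
qed

lemma block_linear: "block (\<lambda>\<sigma>. h \<sigma> + s * f \<sigma>) n z = block h n z + s * block f n z"
  by (simp add: block_def shifted_def sum.distrib sum_distrib_left)

lemma block_zoom_measurable:
  "f \<in> borel_measurable (spin_algebra {1..}) \<Longrightarrow> 1 \<le> r \<Longrightarrow> (\<lambda>\<sigma>. block f n (zoom r \<sigma>)) \<in> borel_measurable \<mu>"
  by (rule measurable_compose[OF zoom_measurable block_measurable])

lemma sum_shift_blocks:
  assumes "depends_on K f" "K \<subseteq> T" "\<sigma> \<in> spin_configs {1..}"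
  shows "(\<Sum>i=1..N. f (mult_shift i \<sigma>)) = (\<Sum>r | r \<in> rough_numbers Q \<and> r \<le> N. block f (N div r) (zoom r \<sigma>))"
  unfolding sum_rough_smooth[of _ N Q] block_def
  by (intro sum.cong refl shifted_zoom[OF assms(1,2,3), symmetric]) (use rough_numbers_ge_1[of _ Q] in auto)

text \<open>Only \<open>zoom 1\<close> appears because all layers have the same law; a block then
  depends on r through N div r alone.\<close>

definition block_log_mgf :: "((nat \<Rightarrow> real) \<Rightarrow> real) \<Rightarrow> nat \<Rightarrow> real" where
  "block_log_mgf f n = ln (expectation (\<lambda>\<sigma>. exp (block f n (zoom 1 \<sigma>))))"

lemma exp_block_integrable:
  assumes f: "f \<in> borel_measurable (spin_algebra {1..})"
    and M: "\<And>\<sigma>. \<sigma> \<in> spin_configs {1..} \<Longrightarrow> \<bar>f \<sigma>\<bar> \<le> M" and r: "1 \<le> r"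
  shows "integrable \<mu> (\<lambda>\<sigma>. exp (block f n (zoom r \<sigma>)))"
proof (rule integrable_const_bound[of _ "exp (M * real (smooth_count Q n))"])
  have "block f n (zoom r \<sigma>) \<le> M * real (smooth_count Q n)" if "\<sigma> \<in> space \<mu>" for \<sigma>
  proof -
    have z: "zoom r \<sigma> \<in> spin_configs T" using that space_mu by (intro zoom_spin_configs[OF r]) simp
    show ?thesis using block_bound[OF M z, where n = n] by (simp add: abs_le_iff)
  qed
  then show "AE \<sigma> in \<mu>. norm (exp (block f n (zoom r \<sigma>))) \<le> exp (M * real (smooth_count Q n))"
    by (intro AE_I2) simp
  show "(\<lambda>\<sigma>. exp (block f n (zoom r \<sigma>))) \<in> borel_measurable \<mu>"
    using block_zoom_measurable[OF f r] by measurable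
qed

text \<open>Blocks with different r are functions of independent layers, so the exponential moment
  factorises, and equality in law replaces each layer by the one of 1.\<close>

lemma log_moment_blocks:
  assumes f: "depends_on K f" "finite K" "K \<subseteq> T"
  shows "log_moment \<mu> f N = (1 / real N) * (\<Sum>r | r \<in> rough_numbers Q \<and> r \<le> N. block_log_mgf f (N div r))"
proof -
  have K1: "K \<subseteq> {1..}" using f(3) smooth_numbers_ge_1 by fastforce
  have fm: "f \<in> borel_measurable (spin_algebra {1..})" by (rule depends_on_measurable[OF f(1,2) K1])
  obtain M where M: "\<And>\<sigma>. \<sigma> \<in> spin_configs {1..} \<Longrightarrow> \<bar>f \<sigma>\<bar> \<le> M" by (rule depends_on_bounded[OF f(1,2) K1]) blast
  let ?R = "{r. r \<in> rough_numbers Q \<and> r \<le> N}"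
  have int: "integrable \<mu> (\<lambda>\<sigma>. exp (block f (N div r) (zoom r \<sigma>)))" if "r \<in> ?R" for r
    using that rough_numbers_ge_1 by (intro exp_block_integrable[OF fm M]) auto
  have exp_m: "(\<lambda>z. exp (block f n z)) \<in> borel_measurable (spin_algebra T)" for n
    using block_measurable[OF fm] by measurable
  have "expectation (\<lambda>\<sigma>. exp (\<Sum>i=1..N. f (mult_shift i \<sigma>))) =
      expectation (\<lambda>\<sigma>. \<Prod>r\<in>?R. exp (block f (N div r) (zoom r \<sigma>)))"
  proof (rule Bochner_Integration.integral_cong[OF refl])
    fix \<sigma> assume "\<sigma> \<in> space \<mu>"
    then have "\<sigma> \<in> spin_configs {1..}" using space_mu by simp
    then show "exp (\<Sum>i=1..N. f (mult_shift i \<sigma>)) = (\<Prod>r\<in>?R. exp (block f (N div r) (zoom r \<sigma>)))"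
      by (subst sum_shift_blocks[OF f(1,3)], assumption) (simp add: exp_sum)
  qed
  also have "\<dots> = (\<Prod>r\<in>?R. expectation (\<lambda>\<sigma>. exp (block f (N div r) (zoom r \<sigma>))))"
  proof (rule indep_vars_lebesgue_integral)
    have "indep_vars (\<lambda>_. spin_algebra T) zoom ?R"
      by (rule indep_vars_subset[OF zooms_iid(1)]) auto
    then show "indep_vars (\<lambda>_. borel) (\<lambda>r \<sigma>. exp (block f (N div r) (zoom r \<sigma>))) ?R"
      using exp_m by (rule indep_vars_compose2)
  qed (use int in auto)
  also have "\<dots> = (\<Prod>r\<in>?R. exp (block_log_mgf f (N div r)))"
  proof (rule prod.cong[OF refl])
    fix r assume r: "r \<in> ?R"
    then have r1: "1 \<le> r" using rough_numbers_ge_1 by auto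
    have "expectation (\<lambda>\<sigma>. exp (block f (N div r) (zoom r \<sigma>))) =
        (\<integral>z. exp (block f (N div r) z) \<partial>distr \<mu> (spin_algebra T) (zoom r))"
      using zoom_measurable[OF r1] exp_m by (rule integral_distr[symmetric])
    also have "\<dots> = (\<integral>z. exp (block f (N div r) z) \<partial>distr \<mu> (spin_algebra T) (zoom 1))"
      using zooms_iid(2)[of r] r by simp
    also have "\<dots> = expectation (\<lambda>\<sigma>. exp (block f (N div r) (zoom 1 \<sigma>)))"
      using zoom_measurable[of 1] exp_m by (intro integral_distr) auto
    also have "\<dots> = exp (block_log_mgf f (N div r))"
      unfolding block_log_mgf_def
      using expectation_exp_pos[OF exp_block_integrable[OF fm M, of 1 "N div r"]] by simp
    finally show "expectation (\<lambda>\<sigma>. exp (block f (N div r) (zoom r \<sigma>))) = exp (block_log_mgf f (N div r))" .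
  qed
  also have "\<dots> = exp (\<Sum>r\<in>?R. block_log_mgf f (N div r))" by (simp add: exp_sum)
  finally show ?thesis by (simp add: log_moment_def)
qed

text \<open>Enlarging a block from n to n + 1 adds a term only if n + 1 is smooth, and this term is
  at most M in absolute value. So \<open>block_log_mgf f\<close> has the increments that
  \<open>rough_average_convergent\<close> asks for.\<close>

lemma log_moment_convergent:
  assumes f: "depends_on K f" "finite K" "K \<subseteq> T"
  shows "convergent (log_moment \<mu> f)"
proof -
  have K1: "K \<subseteq> {1..}" using f(3) smooth_numbers_ge_1 by fastforce
  have fm: "f \<in> borel_measurable (spin_algebra {1..})" by (rule depends_on_measurable[OF f(1,2) K1])
  obtain M where M0: "M > 0" and M: "\<And>\<sigma>. \<sigma> \<in> spin_configs {1..} \<Longrightarrow> \<bar>f \<sigma>\<bar> \<le> M"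
    by (rule depends_on_bounded[OF f(1,2) K1]) blast
  note int = exp_block_integrable[OF fm M order_refl]
  note pos = expectation_exp_pos[OF int]
  have step: "\<bar>block_log_mgf f (Suc n) - block_log_mgf f n\<bar> \<le> (if Suc n \<in> smooth_numbers Q then M else 0)" for n
  proof (cases "Suc n \<in> T")
    case False
    then have "{s. s \<in> T \<and> s \<le> Suc n} = {s. s \<in> T \<and> s \<le> n}" by (auto simp: le_Suc_eq)
    then have "block f (Suc n) = block f n" by (simp add: block_def[abs_def])
    then show ?thesis using M0 by (simp add: block_log_mgf_def)
  next
    case True
    then have "{s. s \<in> T \<and> s \<le> Suc n} = insert (Suc n) {s. s \<in> T \<and> s \<le> n}" by (auto simp: le_Suc_eq)
    then have Suc: "block f (Suc n) z = shifted f (Suc n) z + block f n z" for z by (simp add: block_def)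
    have sh: "\<bar>shifted f (Suc n) (zoom 1 \<sigma>)\<bar> \<le> M" if "\<sigma> \<in> space \<mu>" for \<sigma>
      unfolding shifted_def using that space_mu by (intro M fill_up_scaled[OF zoom_spin_configs True]) auto
    have le: "ln (expectation (\<lambda>\<sigma>. exp (block f n' (zoom 1 \<sigma>)))) \<le> M + ln (expectation (\<lambda>\<sigma>. exp (block f n'' (zoom 1 \<sigma>))))"
      if "\<And>\<sigma>. \<sigma> \<in> space \<mu> \<Longrightarrow> block f n' (zoom 1 \<sigma>) \<le> M + block f n'' (zoom 1 \<sigma>)" for n' n''
    proof -
      have "expectation (\<lambda>\<sigma>. exp (block f n' (zoom 1 \<sigma>))) \<le> expectation (\<lambda>\<sigma>. exp M * exp (block f n'' (zoom 1 \<sigma>)))"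
        using that by (intro integral_mono integrable_mult_right int) (auto simp: exp_add[symmetric])
      then have "expectation (\<lambda>\<sigma>. exp (block f n' (zoom 1 \<sigma>))) \<le> exp M * expectation (\<lambda>\<sigma>. exp (block f n'' (zoom 1 \<sigma>)))"
        by simp
      then have "ln (expectation (\<lambda>\<sigma>. exp (block f n' (zoom 1 \<sigma>)))) \<le> ln (exp M * expectation (\<lambda>\<sigma>. exp (block f n'' (zoom 1 \<sigma>))))"
        using pos by (subst ln_le_cancel_iff) auto
      also have "\<dots> = M + ln (expectation (\<lambda>\<sigma>. exp (block f n'' (zoom 1 \<sigma>))))"
        using pos[of n''] by (subst ln_mult_pos) simp_all
      finally show ?thesis .
    qed
    have "block_log_mgf f (Suc n) \<le> M + block_log_mgf f n"
      unfolding block_log_mgf_def by (rule le) (use sh Suc in \<open>fastforce simp: abs_le_iff\<close>)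
    moreover have "block_log_mgf f n \<le> M + block_log_mgf f (Suc n)"
      unfolding block_log_mgf_def by (rule le) (use sh Suc in \<open>fastforce simp: abs_le_iff\<close>)
    ultimately show ?thesis using True by (simp add: abs_le_iff)
  qed
  have "block f 0 z = 0" for z
  proof -
    have "{s. s \<in> T \<and> s \<le> 0} = {}" using smooth_numbers_ge_1 by fastforce
    then show ?thesis by (simp only: block_def sum.empty)
  qed
  then have "block_log_mgf f 0 = 0" by (simp add: block_log_mgf_def prob_space)
  from rough_average_convergent[OF Q(1,2) this step]
  show ?thesis unfolding log_moment_blocks[OF f, abs_def] by simp
qed

text \<open>\<open>log_mgf_second_order\<close> is applied to each block separately and the bounds
  are added. The restriction on s is the one for the largest block, so it covers all of
  them.\<close>

lemma log_moment_second_order: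
  assumes h: "depends_on K h" and f: "depends_on K f" and K: "finite K" "K \<subseteq> T"
    and M: "\<And>\<sigma>. \<sigma> \<in> spin_configs {1..} \<Longrightarrow> \<bar>f \<sigma>\<bar> \<le> M" "M > 0" and N: "N \<ge> 1"
  shows "\<exists>d. \<forall>s. \<bar>s\<bar> * (M * real (smooth_count Q N)) \<le> 1 \<longrightarrow>
    log_moment \<mu> (\<lambda>\<sigma>. h \<sigma> + s * f \<sigma>) N - log_moment \<mu> h N \<le> s * d + s\<^sup>2 * (M\<^sup>2 * real (smooth_count Q N))"
proof -
  let ?R = "{r. r \<in> rough_numbers Q \<and> r \<le> N}"
  let ?b = "\<lambda>r. M * real (smooth_count Q (N div r))"
  have K1: "K \<subseteq> {1..}" using K(2) smooth_numbers_ge_1 by fastforce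
  note hm = depends_on_measurable[OF h K(1) K1] and fm = depends_on_measurable[OF f K(1) K1]
  obtain L where L: "\<And>\<sigma>. \<sigma> \<in> spin_configs {1..} \<Longrightarrow> \<bar>h \<sigma>\<bar> \<le> L" by (rule depends_on_bounded[OF h K(1) K1]) blast
  have z: "zoom 1 \<sigma> \<in> spin_configs T" if "\<sigma> \<in> space \<mu>" for \<sigma>
    using that space_mu by (intro zoom_spin_configs) auto
  have "\<exists>d. \<forall>s. \<bar>s\<bar> * ?b r \<le> 1 \<longrightarrow>
      block_log_mgf (\<lambda>\<sigma>. h \<sigma> + s * f \<sigma>) (N div r) - block_log_mgf h (N div r) \<le> s * d + s\<^sup>2 * (?b r)\<^sup>2" for r
    unfolding block_log_mgf_def block_linear
    by (rule log_mgf_second_order[OF block_zoom_measurable[OF hm order_refl] block_zoom_measurable[OF fm order_refl]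
          block_bound[OF L z] block_bound[OF M(1) z]])
  then obtain d where d: "\<And>r s. \<bar>s\<bar> * ?b r \<le> 1 \<Longrightarrow>
      block_log_mgf (\<lambda>\<sigma>. h \<sigma> + s * f \<sigma>) (N div r) - block_log_mgf h (N div r) \<le> s * d r + s\<^sup>2 * (?b r)\<^sup>2"
    by metis
  have b_le: "?b r \<le> M * real (smooth_count Q N)" for r
    using M(2) smooth_count_mono[OF div_le_dividend[of N r]] by (intro mult_left_mono) auto
  show ?thesis
  proof (intro exI allI impI)
    fix s assume s: "\<bar>s\<bar> * (M * real (smooth_count Q N)) \<le> 1"
    have sr: "\<bar>s\<bar> * ?b r \<le> 1" for r using mult_left_mono[OF b_le, of "\<bar>s\<bar>" r] s by linarith
    have hsf: "depends_on K (\<lambda>\<sigma>. h \<sigma> + s * f \<sigma>)"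
      using h f unfolding depends_on_def by metis
    have "(\<Sum>r\<in>?R. block_log_mgf (\<lambda>\<sigma>. h \<sigma> + s * f \<sigma>) (N div r)) - (\<Sum>r\<in>?R. block_log_mgf h (N div r))
        \<le> (\<Sum>r\<in>?R. s * d r + s\<^sup>2 * (?b r)\<^sup>2)"
      unfolding sum_subtractf[symmetric] by (intro sum_mono d sr)
    also have "\<dots> = s * (\<Sum>r\<in>?R. d r) + s\<^sup>2 * (\<Sum>r\<in>?R. (?b r)\<^sup>2)"
      by (simp add: sum.distrib sum_distrib_left)
    \<comment> \<open>One factor of each square is replaced by the size of the largest block; the
      other factors add up to N by \<open>sum_smooth_count\<close>.\<close>
    also have "(\<Sum>r\<in>?R. (?b r)\<^sup>2) \<le> (\<Sum>r\<in>?R. M\<^sup>2 * real (smooth_count Q N) * real (smooth_count Q (N div r)))"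
    proof (rule sum_mono)
      fix r
      have "(?b r)\<^sup>2 = M\<^sup>2 * (real (smooth_count Q (N div r)) * real (smooth_count Q (N div r)))"
        by (simp add: power2_eq_square)
      also have "\<dots> \<le> M\<^sup>2 * (real (smooth_count Q N) * real (smooth_count Q (N div r)))"
        using smooth_count_mono[OF div_le_dividend[of N r]] by (intro mult_left_mono mult_right_mono) auto
      finally show "(?b r)\<^sup>2 \<le> M\<^sup>2 * real (smooth_count Q N) * real (smooth_count Q (N div r))" by simp
    qed
    also have "\<dots> = M\<^sup>2 * real (smooth_count Q N) * real (\<Sum>r\<in>?R. smooth_count Q (N div r))"
      by (simp add: sum_distrib_left)
    also have "\<dots> = M\<^sup>2 * real (smooth_count Q N) * real N" by (simp only: sum_smooth_count)
    finally have total: "(\<Sum>r\<in>?R. block_log_mgf (\<lambda>\<sigma>. h \<sigma> + s * f \<sigma>) (N div r)) - (\<Sum>r\<in>?R. block_log_mgf h (N div r))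
        \<le> s * (\<Sum>r\<in>?R. d r) + s\<^sup>2 * (M\<^sup>2 * real (smooth_count Q N) * real N)"
      by (simp add: mult_left_mono)
    have "log_moment \<mu> (\<lambda>\<sigma>. h \<sigma> + s * f \<sigma>) N - log_moment \<mu> h N =
        (1 / real N) * ((\<Sum>r\<in>?R. block_log_mgf (\<lambda>\<sigma>. h \<sigma> + s * f \<sigma>) (N div r)) - (\<Sum>r\<in>?R. block_log_mgf h (N div r)))"
      unfolding log_moment_blocks[OF hsf K] log_moment_blocks[OF h K] by (simp add: right_diff_distrib diff_divide_distrib)
    also have "\<dots> \<le> (1 / real N) * (s * (\<Sum>r\<in>?R. d r) + s\<^sup>2 * (M\<^sup>2 * real (smooth_count Q N) * real N))"
      using total by (rule mult_left_mono) simp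
    also have "\<dots> = s * ((1 / real N) * (\<Sum>r\<in>?R. d r)) + s\<^sup>2 * (M\<^sup>2 * real (smooth_count Q N))"
      using N by (simp add: field_simps)
    finally show "log_moment \<mu> (\<lambda>\<sigma>. h \<sigma> + s * f \<sigma>) N - log_moment \<mu> h N
        \<le> s * ((1 / real N) * (\<Sum>r\<in>?R. d r)) + s\<^sup>2 * (M\<^sup>2 * real (smooth_count Q N))" .
  qed
qed

end

subsection \<open>The weak topology\<close>

abbreviation (input) \<Omega> :: "(nat \<Rightarrow> real) topology" where "\<Omega> \<equiv> spin_topology {1..}"

lemma topspace_spin_topology [simp]: "topspace (spin_topology S) = spin_configs S"
  by (simp add: spin_topology_def)

lemma compact_space_spin_topology: "compact_space (spin_topology S)"
  unfolding spin_topology_def by (simp add: compact_space_product_topology compact_space_discrete_topology)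

definition cylinder :: "nat \<Rightarrow> (nat \<Rightarrow> real) \<Rightarrow> (nat \<Rightarrow> real) set" where
  "cylinder n \<sigma> = {\<tau> \<in> spin_configs {1..}. \<forall>k\<in>{1..n}. \<tau> k = \<sigma> k}"

lemma openin_agree_set:
  assumes "finite K" "K \<subseteq> {1..}"
  shows "openin \<Omega> {\<tau> \<in> spin_configs {1..}. \<forall>k\<in>K. \<tau> k = \<sigma> k}"
proof -
  have "openin \<Omega> {\<tau> \<in> topspace \<Omega>. \<tau> k \<in> {\<sigma> k} \<inter> {-1, 1}}" if "k \<in> K" for k
  proof (rule openin_continuous_map_preimage)
    show "continuous_map \<Omega> (discrete_topology {-1, 1}) (\<lambda>\<tau>. \<tau> k)"
      unfolding spin_topology_def using that assms(2) by (intro continuous_map_product_coordinates) auto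
  qed simp
  then have "openin \<Omega> ((\<Inter>k\<in>K. {\<tau> \<in> topspace \<Omega>. \<tau> k \<in> {\<sigma> k} \<inter> {-1, 1}}) \<inter> topspace \<Omega>)"
    by (intro openin_INT assms(1))
  moreover have "(\<Inter>k\<in>K. {\<tau> \<in> topspace \<Omega>. \<tau> k \<in> {\<sigma> k} \<inter> {-1, 1}}) \<inter> topspace \<Omega> =
      {\<tau> \<in> spin_configs {1..}. \<forall>k\<in>K. \<tau> k = \<sigma> k}"
  proof -
    have "\<tau> k \<in> {-1, 1}" if "\<tau> \<in> spin_configs {1..}" "k \<in> K" for \<tau> k using that assms(2) PiE_mem by blast
    then show ?thesis by auto
  qed
  ultimately show ?thesis by simp
qed

lemma openin_cylinder: "openin \<Omega> (cylinder n \<sigma>)"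
  unfolding cylinder_def by (rule openin_agree_set) auto

lemma cylinder_basis:
  assumes "openin \<Omega> G" "\<sigma> \<in> G"
  obtains n where "cylinder n \<sigma> \<subseteq> G"
proof -
  obtain U where U: "finite {i \<in> {1..}. U i \<noteq> {-1, 1::real}}" "\<sigma> \<in> Pi\<^sub>E {1..} U" "Pi\<^sub>E {1..} U \<subseteq> G"
    using assms unfolding spin_topology_def openin_product_topology_alt by auto
  define n where "n = Max (insert 0 {i \<in> {1..}. U i \<noteq> {-1, 1::real}})"
  have n: "i \<le> n" if "i \<in> {1..}" "U i \<noteq> {-1, 1}" for i
    unfolding n_def using U(1) that by (intro Max_ge) auto
  have "cylinder n \<sigma> \<subseteq> Pi\<^sub>E {1..} U"
  proof
    fix \<tau> assume \<tau>: "\<tau> \<in> cylinder n \<sigma>"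
    then have \<tau>': "\<tau> \<in> spin_configs {1..}" by (simp add: cylinder_def)
    show "\<tau> \<in> Pi\<^sub>E {1..} U"
    proof (rule PiE_I)
      fix i :: nat assume i: "i \<in> {1..}"
      show "\<tau> i \<in> U i"
      proof (cases "U i = {-1, 1}")
        case True
        then show ?thesis using PiE_mem[OF \<tau>' i] by simp
      next
        case False
        then have "\<tau> i = \<sigma> i" using \<tau> i n by (simp add: cylinder_def)
        then show ?thesis using PiE_mem[OF U(2) i] by simp
      qed
    next
      fix i assume "i \<notin> {1::nat..}"
      then show "\<tau> i = undefined" by (rule PiE_arb[OF \<tau>'])
    qed
  qed
  then show ?thesis using that U(3) by blast
qed

text \<open>An open set is the union of the cylinders that it contains, and there are only countably
  many cylinders, one for each finite word.\<close>

lemma openin_spin_topology_sets: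
  assumes G: "openin \<Omega> G"
  shows "G \<in> sets (spin_algebra {1..})"
proof -
  have GS: "G \<subseteq> spin_configs {1..}" using openin_subset[OF G] by simp
  define I where "I = {(n, w). w \<in> spin_configs {1..n} \<and> {\<sigma> \<in> spin_configs {1..}. restrict \<sigma> {1..n} = w} \<subseteq> G}"
  have "I \<subseteq> (SIGMA n:UNIV. spin_configs {1..n})" by (auto simp: I_def)
  moreover have "countable (SIGMA n:(UNIV::nat set). spin_configs {1..n})"
    by (rule countable_SIGMA) (simp_all add: countable_finite finite_spin_configs)
  ultimately have I: "countable I" by (rule countable_subset)
  have "G = (\<Union>(n, w)\<in>I. {\<sigma> \<in> spin_configs {1..}. restrict \<sigma> {1..n} = w})"
  proof
    show "G \<subseteq> (\<Union>(n, w)\<in>I. {\<sigma> \<in> spin_configs {1..}. restrict \<sigma> {1..n} = w})"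
    proof
      fix \<sigma> assume \<sigma>: "\<sigma> \<in> G"
      then obtain n where n: "cylinder n \<sigma> \<subseteq> G" using cylinder_basis[OF G] by blast
      have \<sigma>S: "\<sigma> \<in> spin_configs {1..}" using \<sigma> GS by blast
      have "restrict \<sigma> {1..n} \<in> spin_configs {1..n}"
        unfolding restrict_PiE_iff using PiE_mem[OF \<sigma>S] by simp
      moreover have "{\<tau> \<in> spin_configs {1..}. restrict \<tau> {1..n} = restrict \<sigma> {1..n}} \<subseteq> cylinder n \<sigma>"
      proof
        fix \<tau> assume \<tau>: "\<tau> \<in> {\<tau> \<in> spin_configs {1..}. restrict \<tau> {1..n} = restrict \<sigma> {1..n}}"
        then have "\<tau> k = \<sigma> k" if "k \<in> {1..n}" for k using that by (metis (mono_tags) mem_Collect_eq restrict_apply')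
        then show "\<tau> \<in> cylinder n \<sigma>" using \<tau> by (simp add: cylinder_def)
      qed
      ultimately have "(n, restrict \<sigma> {1..n}) \<in> I" using n unfolding I_def by blast
      then show "\<sigma> \<in> (\<Union>(n, w)\<in>I. {\<sigma> \<in> spin_configs {1..}. restrict \<sigma> {1..n} = w})"
        using \<sigma>S by (intro UN_I[of "(n, restrict \<sigma> {1..n})"]) auto
    qed
  qed (auto simp: I_def)
  moreover have "(\<Union>(n, w)\<in>I. {\<sigma> \<in> spin_configs {1..}. restrict \<sigma> {1..n} = w}) \<in> sets (spin_algebra {1..})"
    unfolding case_prod_unfold
  proof (rule sets.countable_UN''[OF I])
    show "{\<sigma> \<in> spin_configs {1..}. restrict \<sigma> {1..fst q} = snd q} \<in> sets (spin_algebra {1..})" for q :: "nat \<times> (nat \<Rightarrow> real)"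
      by (rule cylinder_measurable) auto
  qed
  ultimately show ?thesis by simp
qed

lemma continuous_map_spin_measurable:
  assumes "continuous_map \<Omega> euclideanreal g"
  shows "g \<in> borel_measurable (spin_algebra {1..})"
proof (rule borel_measurableI)
  fix V :: "real set" assume "open V"
  then have "openin \<Omega> {\<sigma> \<in> topspace \<Omega>. g \<sigma> \<in> V}"
    using assms by (intro openin_continuous_map_preimage) auto
  then have "{\<sigma> \<in> topspace \<Omega>. g \<sigma> \<in> V} \<in> sets (spin_algebra {1..})" by (rule openin_spin_topology_sets)
  moreover have "{\<sigma> \<in> topspace \<Omega>. g \<sigma> \<in> V} = g -` V \<inter> space (spin_algebra {1..})" by auto
  ultimately show "g -` V \<inter> space (spin_algebra {1..}) \<in> sets (spin_algebra {1..})" by simp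
qed

lemma depends_on_continuous:
  assumes "depends_on K f" "finite K" "K \<subseteq> {1..}"
  shows "continuous_map \<Omega> euclideanreal f"
  unfolding continuous_map_def
proof (intro conjI allI impI)
  fix V :: "real set"
  show "openin \<Omega> {\<sigma> \<in> topspace \<Omega>. f \<sigma> \<in> V}"
  proof (subst openin_subopen, intro ballI)
    fix \<sigma> assume \<sigma>: "\<sigma> \<in> {\<sigma> \<in> topspace \<Omega>. f \<sigma> \<in> V}"
    let ?C = "{\<tau> \<in> spin_configs {1..}. \<forall>k\<in>K. \<tau> k = \<sigma> k}"
    have "openin \<Omega> ?C" by (rule openin_agree_set[OF assms(2,3)])
    moreover have "\<sigma> \<in> ?C" using \<sigma> by simp
    moreover have "?C \<subseteq> {\<sigma> \<in> topspace \<Omega>. f \<sigma> \<in> V}"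
    proof
      fix \<tau> assume \<tau>: "\<tau> \<in> ?C"
      then have "f \<tau> = f \<sigma>" using \<sigma> by (intro depends_onD[OF assms(1)]) auto
      then show "\<tau> \<in> {\<sigma> \<in> topspace \<Omega>. f \<sigma> \<in> V}" using \<tau> \<sigma> by simp
    qed
    ultimately show "\<exists>T. openin \<Omega> T \<and> \<sigma> \<in> T \<and> T \<subseteq> {\<sigma> \<in> topspace \<Omega>. f \<sigma> \<in> V}" by blast
  qed
qed auto

definition localise :: "nat \<Rightarrow> ((nat \<Rightarrow> real) \<Rightarrow> real) \<Rightarrow> (nat \<Rightarrow> real) \<Rightarrow> real" where
  "localise n g \<sigma> = g (fill_up {1..n} \<sigma>)"

lemma depends_on_localise: "depends_on {1..n} (localise n g)"
  unfolding depends_on_def localise_def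
proof (intro ballI impI)
  fix \<sigma> \<tau> :: "nat \<Rightarrow> real" assume "\<forall>k\<in>{1..n}. \<sigma> k = \<tau> k"
  then have "fill_up {1..n} \<sigma> = fill_up {1..n} \<tau>" by (auto simp: fill_up_def fun_eq_iff)
  then show "g (fill_up {1..n} \<sigma>) = g (fill_up {1..n} \<tau>)" by simp
qed

lemma local_function_localise: "local_function (localise n g)"
  unfolding local_function_iff using depends_on_localise by (intro exI[of _ "{1..n}"]) auto

lemma fill_up_truncate:
  assumes "\<sigma> \<in> spin_configs {1..}"
  shows "fill_up {1..n} \<sigma> \<in> spin_configs {1..}"
  using PiE_mem[OF assms] by (intro fill_up_spin_configs) simp

text \<open>Compactness does the work of uniform continuity: finitely many cylinders on which g
  varies little cover the space, and n is the largest of their lengths. A configuration and its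
  truncation at n then lie in a common cylinder.\<close>

lemma localise_approx:
  assumes g: "continuous_map \<Omega> euclideanreal g" and \<epsilon>: "\<epsilon> > 0"
  obtains n where "\<And>\<sigma>. \<sigma> \<in> spin_configs {1..} \<Longrightarrow> \<bar>g \<sigma> - localise n g \<sigma>\<bar> \<le> \<epsilon>"
proof -
  define V where "V \<sigma> = {\<tau> \<in> topspace \<Omega>. g \<tau> \<in> ball (g \<sigma>) (\<epsilon> / 2)}" for \<sigma>
  have V: "openin \<Omega> (V \<sigma>)" for \<sigma>
    unfolding V_def by (rule openin_continuous_map_preimage[OF g]) simp
  have "\<exists>n. cylinder n \<sigma> \<subseteq> V \<sigma>" if \<sigma>: "\<sigma> \<in> spin_configs {1..}" for \<sigma>
  proof -
    have "\<sigma> \<in> V \<sigma>" using \<sigma> \<epsilon> by (simp add: V_def)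
    then show ?thesis using cylinder_basis[OF V] by metis
  qed
  then obtain m where m: "\<And>\<sigma>. \<sigma> \<in> spin_configs {1..} \<Longrightarrow> cylinder (m \<sigma>) \<sigma> \<subseteq> V \<sigma>" by metis
  let ?\<C> = "(\<lambda>\<sigma>. cylinder (m \<sigma>) \<sigma>) ` spin_configs {1..}"
  have op: "\<forall>C\<in>?\<C>. openin \<Omega> C" using openin_cylinder by blast
  have cov: "topspace \<Omega> \<subseteq> \<Union>?\<C>"
  proof
    fix \<sigma> assume "\<sigma> \<in> topspace \<Omega>"
    then have "\<sigma> \<in> spin_configs {1..}" by simp
    moreover have "\<sigma> \<in> cylinder (m \<sigma>) \<sigma>" using calculation by (simp add: cylinder_def)
    ultimately show "\<sigma> \<in> \<Union>?\<C>" by blast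
  qed
  have "compactin \<Omega> (topspace \<Omega>)" using compact_space_spin_topology by (simp add: compact_space_def)
  then obtain \<F> where \<F>: "finite \<F>" "\<F> \<subseteq> ?\<C>" "topspace \<Omega> \<subseteq> \<Union>\<F>"
    using op cov unfolding compactin_def by (elim conjE allE[of _ ?\<C>]) blast
  obtain F where F: "finite F" "F \<subseteq> spin_configs {1..}" "\<F> = (\<lambda>\<sigma>. cylinder (m \<sigma>) \<sigma>) ` F"
    using finite_subset_image[OF \<F>(1,2)] by blast
  define n where "n = Max (insert 0 (m ` F))"
  have n: "m \<sigma> \<le> n" if "\<sigma> \<in> F" for \<sigma> unfolding n_def using F(1) that by (intro Max_ge) auto
  show ?thesis
  proof (rule that)
    fix \<tau> :: "nat \<Rightarrow> real" assume \<tau>: "\<tau> \<in> spin_configs {1..}"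
    then obtain \<sigma> where \<sigma>: "\<sigma> \<in> F" "\<tau> \<in> cylinder (m \<sigma>) \<sigma>" using \<F>(3) F(3) by auto
    have "fill_up {1..n} \<tau> \<in> cylinder (m \<sigma>) \<sigma>"
      using \<sigma> n[OF \<sigma>(1)] fill_up_truncate[OF \<tau>, of n] by (simp add: cylinder_def fill_up_apply)
    then have "\<tau> \<in> V \<sigma>" "fill_up {1..n} \<tau> \<in> V \<sigma>" using \<sigma> m F(2) by blast+
    then have "dist (g \<sigma>) (g \<tau>) < \<epsilon> / 2" "dist (g \<sigma>) (localise n g \<tau>) < \<epsilon> / 2"
      unfolding V_def localise_def by simp_all
    then show "\<bar>g \<tau> - localise n g \<tau>\<bar> \<le> \<epsilon>" unfolding dist_real_def by linarith
  qed
qed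

lemma (in prob_space) integral_uniform_close:
  fixes g h :: "'a \<Rightarrow> real"
  assumes "integrable M g" "integrable M h" "\<And>\<omega>. \<omega> \<in> space M \<Longrightarrow> \<bar>g \<omega> - h \<omega>\<bar> \<le> e"
  shows "\<bar>expectation g - expectation h\<bar> \<le> e"
proof -
  have "\<bar>expectation g - expectation h\<bar> = \<bar>expectation (\<lambda>\<omega>. g \<omega> - h \<omega>)\<bar>" using assms by simp
  also have "\<dots> \<le> expectation (\<lambda>\<omega>. \<bar>g \<omega> - h \<omega>\<bar>)" by (rule integral_abs_bound)
  also have "\<dots> \<le> expectation (\<lambda>_. e)" using assms by (intro integral_mono) auto
  finally show ?thesis by (simp add: prob_space)
qed

lemma spin_prob_spaceD:
  assumes "\<nu> \<in> space (prob_algebra (spin_algebra {1..}))"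
  shows "prob_space \<nu>" "sets \<nu> = sets (spin_algebra {1..})" "space \<nu> = spin_configs {1..}"
proof -
  show "prob_space \<nu>" "sets \<nu> = sets (spin_algebra {1..})" using assms by (auto simp: space_prob_algebra)
  then show "space \<nu> = spin_configs {1..}" using sets_eq_imp_space_eq[of \<nu> "spin_algebra {1..}"] by simp
qed

lemma continuous_integrable:
  assumes \<nu>: "\<nu> \<in> space (prob_algebra (spin_algebra {1..}))" and g: "continuous_map \<Omega> euclideanreal g"
  shows "integrable \<nu> g"
proof -
  interpret prob_space \<nu> by (rule spin_prob_spaceD[OF \<nu>])
  have "compactin euclideanreal (g ` topspace \<Omega>)"
    using compact_space_spin_topology g by (intro image_compactin) (auto simp: compact_space_def)
  then have "bounded (g ` topspace \<Omega>)" unfolding compactin_euclidean_iff by (rule compact_imp_bounded)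
  then obtain b where b: "\<forall>v\<in>g ` topspace \<Omega>. norm v \<le> b" unfolding bounded_iff by blast
  have gm: "g \<in> borel_measurable \<nu>"
    using continuous_map_spin_measurable[OF g] by (subst measurable_cong_sets[OF spin_prob_spaceD(2)[OF \<nu>] refl])
  show ?thesis
    using b spin_prob_spaceD(3)[OF \<nu>] by (intro integrable_const_bound[of _ b] gm AE_I2) simp
qed

lemma localise_integral_approx:
  assumes \<nu>: "\<nu> \<in> space (prob_algebra (spin_algebra {1..}))" and g: "continuous_map \<Omega> euclideanreal g"
    and close: "\<And>\<sigma>. \<sigma> \<in> spin_configs {1..} \<Longrightarrow> \<bar>g \<sigma> - localise n g \<sigma>\<bar> \<le> e"
  shows "\<bar>(\<integral>\<sigma>. g \<sigma> \<partial>\<nu>) - (\<integral>\<sigma>. localise n g \<sigma> \<partial>\<nu>)\<bar> \<le> e"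
proof -
  interpret prob_space \<nu> by (rule spin_prob_spaceD[OF \<nu>])
  have "continuous_map \<Omega> euclideanreal (localise n g)"
    by (rule depends_on_continuous[OF depends_on_localise]) auto
  then show ?thesis
    using close spin_prob_spaceD(3)[OF \<nu>] by (intro integral_uniform_close continuous_integrable[OF \<nu>] g) auto
qed

section \<open>Weak compactness through finitely additive charges\<close>

definition charges :: "((nat \<Rightarrow> real) set \<Rightarrow> real) set" where
  "charges = {c. (\<forall>B. 0 \<le> c B \<and> c B \<le> 1) \<and> c (spin_configs {1..}) = 1 \<and>
     (\<forall>A\<in>sets (spin_algebra {1..}). \<forall>B\<in>sets (spin_algebra {1..}). A \<inter> B = {} \<longrightarrow> c (A \<union> B) = c A + c B)}"

text \<open>Charges are functions on all sets, with free values in [0, 1] on nonmeasurable ones, so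
  that they form a closed subset of a full Tychonoff cube. Only finite additivity is imposed because
  countable additivity would not be a closed condition.\<close>

lemma compact_charges: "compact charges"
proof -
  have coord: "continuous_on UNIV (\<lambda>c::(nat \<Rightarrow> real) set \<Rightarrow> real. c B)" for B
    by (rule continuous_on_product_coordinates)
  have "compactin (product_topology (\<lambda>_. euclidean) UNIV) (\<Pi>\<^sub>E B\<in>(UNIV::(nat \<Rightarrow> real) set set). {0..1::real})"
    by (subst compactin_PiE) (auto simp: compactin_euclidean_iff)
  then have box: "compact (\<Pi>\<^sub>E B\<in>(UNIV::(nat \<Rightarrow> real) set set). {0..1::real})"
    by (simp only: euclidean_product_topology compactin_euclidean_iff)
  have "closed {c::(nat \<Rightarrow> real) set \<Rightarrow> real. c (spin_configs {1..}) = 1}"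
    by (intro closed_Collect_eq coord continuous_intros)
  moreover have "closed {c::(nat \<Rightarrow> real) set \<Rightarrow> real. c (A \<union> B) = c A + c B}" for A B
    by (intro closed_Collect_eq coord continuous_intros)
  then have "closed (\<Inter>A\<in>sets (spin_algebra {1..}). \<Inter>B\<in>{B\<in>sets (spin_algebra {1..}). A \<inter> B = {}}.
      {c::(nat \<Rightarrow> real) set \<Rightarrow> real. c (A \<union> B) = c A + c B})" by (intro closed_INT ballI)
  ultimately have "compact ((\<Pi>\<^sub>E B\<in>UNIV. {0..1}) \<inter> ({c. c (spin_configs {1..}) = 1} \<inter>
      (\<Inter>A\<in>sets (spin_algebra {1..}). \<Inter>B\<in>{B\<in>sets (spin_algebra {1..}). A \<inter> B = {}}.
      {c::(nat \<Rightarrow> real) set \<Rightarrow> real. c (A \<union> B) = c A + c B})))"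
    by (intro compact_Int_closed[OF box] closed_Int)
  also have "(\<Pi>\<^sub>E B\<in>UNIV. {0..1}) \<inter> ({c. c (spin_configs {1..}) = 1} \<inter>
      (\<Inter>A\<in>sets (spin_algebra {1..}). \<Inter>B\<in>{B\<in>sets (spin_algebra {1..}). A \<inter> B = {}}.
      {c::(nat \<Rightarrow> real) set \<Rightarrow> real. c (A \<union> B) = c A + c B})) = charges"
    unfolding charges_def PiE_UNIV_domain by auto
  finally show ?thesis .
qed

lemma charge_sum:
  assumes c: "c \<in> charges" and "finite I" and A: "\<And>i. i \<in> I \<Longrightarrow> A i \<in> sets (spin_algebra {1..})" "disjoint_family_on A I"
  shows "c (\<Union>i\<in>I. A i) = (\<Sum>i\<in>I. c (A i))"
  using assms(2) A
proof (induction I)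
  case empty
  have "c ({} \<union> {}) = c {} + c {}" using c unfolding charges_def by blast
  then show ?case by simp
next
  case (insert i I)
  have "A i \<inter> (\<Union>i\<in>I. A i) = {}" using insert.prems(2) insert.hyps(2) by (auto simp: disjoint_family_on_def)
  moreover have "(\<Union>i\<in>I. A i) \<in> sets (spin_algebra {1..})" using insert by (intro sets.finite_UN) auto
  moreover have "A i \<in> sets (spin_algebra {1..})" using insert by simp
  ultimately have "c (A i \<union> (\<Union>i\<in>I. A i)) = c (A i) + c (\<Union>i\<in>I. A i)" using c unfolding charges_def by blast
  moreover have "c (\<Union>i\<in>I. A i) = (\<Sum>i\<in>I. c (A i))"
    using insert by (intro insert.IH) (auto simp: disjoint_family_on_def)
  ultimately show ?case using insert.hyps by simp
qed

lemma finite_spin_set_measurable: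
  assumes "finite J" "D \<subseteq> spin_configs J"
  shows "D \<in> sets (spin_algebra J)"
proof -
  have "{w} \<in> sets (spin_algebra J)" if "w \<in> D" for w
  proof -
    have "{\<sigma> \<in> spin_configs J. restrict \<sigma> J = w} = {w}" using that assms(2) by auto
    then show ?thesis using cylinder_measurable[OF assms(1) order_refl, of w] by simp
  qed
  moreover have "finite D" using finite_subset[OF assms(2) finite_spin_configs[OF assms(1)]] .
  ultimately have "(\<Union>w\<in>D. {w}) \<in> sets (spin_algebra J)" by (intro sets.finite_UN) auto
  then show ?thesis by simp
qed

text \<open>The finite-dimensional law is placed on real vectors because the projective limit is
  taken over Borel spaces.\<close>

definition marginal :: "((nat \<Rightarrow> real) set \<Rightarrow> real) \<Rightarrow> nat set \<Rightarrow> (nat \<Rightarrow> real) measure" where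
  "marginal c J = distr (point_measure (spin_configs J) (\<lambda>w. ennreal (c {\<sigma> \<in> spin_configs {1..}. restrict \<sigma> J = w})))
     (PiM J (\<lambda>_. borel)) (\<lambda>w. w)"

lemma restrict_spin_configs: "\<sigma> \<in> spin_configs S \<Longrightarrow> J \<subseteq> S \<Longrightarrow> restrict \<sigma> J \<in> spin_configs J"
  unfolding restrict_PiE_iff using PiE_mem by blast

lemma emeasure_marginal:
  assumes c: "c \<in> charges" and J: "finite J" "J \<subseteq> {1..}" and B: "B \<in> sets (PiM J (\<lambda>_. borel))"
  shows "emeasure (marginal c J) B = ennreal (c {\<sigma> \<in> spin_configs {1..}. restrict \<sigma> J \<in> B})"
proof -
  let ?Z = "\<lambda>w. {\<sigma> \<in> spin_configs {1..}. restrict \<sigma> J = w}"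
  have m: "(\<lambda>w. w) \<in> point_measure (spin_configs J) (\<lambda>w. ennreal (c (?Z w))) \<rightarrow>\<^sub>M PiM J (\<lambda>_. borel)"
    by (subst measurable_point_measure_eq1) (auto simp: space_PiM PiE_def)
  have "emeasure (marginal c J) B = emeasure (point_measure (spin_configs J) (\<lambda>w. ennreal (c (?Z w)))) (B \<inter> spin_configs J)"
    unfolding marginal_def using emeasure_distr[OF m B] by (simp add: space_point_measure)
  also have "\<dots> = (\<Sum>w\<in>B \<inter> spin_configs J. ennreal (c (?Z w)))"
    using finite_spin_configs[OF J(1)] by (subst emeasure_point_measure_finite) auto
  also have "\<dots> = ennreal (\<Sum>w\<in>B \<inter> spin_configs J. c (?Z w))"
    using c by (intro sum_ennreal) (simp add: charges_def)
  also have "(\<Sum>w\<in>B \<inter> spin_configs J. c (?Z w)) = c (\<Union>w\<in>B \<inter> spin_configs J. ?Z w)"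
    using finite_spin_configs[OF J(1)]
    by (intro charge_sum[OF c, symmetric] cylinder_measurable J) (auto simp: disjoint_family_on_def)
  also have "(\<Union>w\<in>B \<inter> spin_configs J. ?Z w) = {\<sigma> \<in> spin_configs {1..}. restrict \<sigma> J \<in> B}"
    using restrict_spin_configs[OF _ J(2)] by auto
  finally show ?thesis .
qed

lemma sets_marginal: "sets (marginal c J) = sets (PiM J (\<lambda>_. borel))"
  by (simp add: marginal_def)

text \<open>The way back from real vectors to spins: every value other than 1 becomes - 1. The map
  is total and fixes spin configurations.\<close>

definition sign_config :: "nat set \<Rightarrow> (nat \<Rightarrow> real) \<Rightarrow> nat \<Rightarrow> real" where
  "sign_config J v = (\<lambda>j\<in>J. if v j = 1 then 1 else - 1)"

lemma sign_config_measurable: "sign_config J \<in> PiM J (\<lambda>_. borel) \<rightarrow>\<^sub>M spin_algebra J"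
proof (rule measurable_into_spin_algebra)
  fix j assume j: "j \<in> J"
  note m = measurable_component_singleton[OF j, of "\<lambda>_. borel :: real measure"]
  have "{v \<in> space (PiM J (\<lambda>_. borel :: real measure)). v j = 1} \<in> sets (PiM J (\<lambda>_. borel))"
    using measurable_sets[OF m, of "{1}"] by (simp add: vimage_def Int_def conj_commute)
  then have "(\<lambda>v. if v j = (1::real) then 1 else - 1 :: real) \<in> PiM J (\<lambda>_. borel) \<rightarrow>\<^sub>M count_space {-1, 1}"
    by (intro measurable_If) auto
  then show "(\<lambda>v. sign_config J v j) \<in> PiM J (\<lambda>_. borel) \<rightarrow>\<^sub>M count_space {-1, 1}"
    using j by (simp add: sign_config_def)
qed (simp add: sign_config_def)

text \<open>On a Cantor space finite additivity suffices: a charge agrees on the cylinder sets with a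
  probability measure, by Kolmogorov's extension theorem.\<close>

lemma charge_extension:
  assumes c: "c \<in> charges"
  shows "\<exists>\<nu>\<in>space (prob_algebra (spin_algebra {1..})). \<forall>J D. finite J \<longrightarrow> J \<subseteq> {1..} \<longrightarrow> D \<subseteq> spin_configs J \<longrightarrow>
    measure \<nu> {\<sigma> \<in> spin_configs {1..}. restrict \<sigma> J \<in> D} = c {\<sigma> \<in> spin_configs {1..}. restrict \<sigma> J \<in> D}"
proof -
  \<comment> \<open>By \<open>emeasure_marginal\<close>, consistency compares two values of c on the
    same set; finite additivity of c is enough for this.\<close>
  interpret PP: polish_projective "{1::nat..}" "marginal c"
  proof (intro polish_projective.intro projective_family.intro)
    fix J H :: "nat set" assume JH: "J \<subseteq> H" "finite H" "H \<subseteq> {1..}"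
    have J: "finite J" "J \<subseteq> {1..}" using JH finite_subset by auto
    have m: "(\<lambda>f. restrict f J) \<in> marginal c H \<rightarrow>\<^sub>M PiM J (\<lambda>_. borel)"
      using measurable_restrict_subset[OF JH(1), of "\<lambda>_. borel"] by (subst measurable_cong_sets[OF sets_marginal refl])
    show "marginal c J = distr (marginal c H) (PiM J (\<lambda>_. borel)) (\<lambda>f. restrict f J)"
    proof (rule measure_eqI)
      fix B assume "B \<in> sets (marginal c J)"
      then have B: "B \<in> sets (PiM J (\<lambda>_. borel))" by (simp add: sets_marginal)
      let ?B = "(\<lambda>f. restrict f J) -` B \<inter> space (marginal c H)"
      have sp: "space (marginal c H) = extensional H" by (simp add: marginal_def space_PiM PiE_def)
      have "?B \<in> sets (PiM H (\<lambda>_. borel))" using measurable_sets[OF m B] by (simp add: sets_marginal)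
      then have "emeasure (marginal c H) ?B = ennreal (c {\<sigma> \<in> spin_configs {1..}. restrict \<sigma> H \<in> ?B})"
        by (rule emeasure_marginal[OF c JH(2,3)])
      also have "{\<sigma> \<in> spin_configs {1..}. restrict \<sigma> H \<in> ?B} = {\<sigma> \<in> spin_configs {1..}. restrict \<sigma> J \<in> B}"
        using JH(1) unfolding sp by (auto simp: Int_absorb1 Int_absorb2 restrict_restrict)
      also have "ennreal (c {\<sigma> \<in> spin_configs {1..}. restrict \<sigma> J \<in> B}) = emeasure (marginal c J) B"
        by (rule emeasure_marginal[OF c J B, symmetric])
      finally show "emeasure (marginal c J) B = emeasure (distr (marginal c H) (PiM J (\<lambda>_. borel)) (\<lambda>f. restrict f J)) B"
        by (simp only: emeasure_distr[OF m B])
    qed (simp add: sets_marginal)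
  next
    fix J :: "nat set" assume J: "finite J" "J \<subseteq> {1..}"
    show "prob_space (marginal c J)"
    proof (rule prob_spaceI)
      have "space (marginal c J) \<in> sets (PiM J (\<lambda>_. borel))" using sets.top[of "marginal c J"] by (simp add: sets_marginal)
      then have "emeasure (marginal c J) (space (marginal c J)) =
          ennreal (c {\<sigma> \<in> spin_configs {1..}. restrict \<sigma> J \<in> space (marginal c J)})"
        by (rule emeasure_marginal[OF c J])
      also have "{\<sigma> \<in> spin_configs {1..}. restrict \<sigma> J \<in> space (marginal c J)} = spin_configs {1..}"
        by (auto simp: marginal_def space_PiM PiE_def)
      finally show "emeasure (marginal c J) (space (marginal c J)) = 1" using c by (simp add: charges_def)
    qed
  qed
  have sign_lim: "sign_config {1..} \<in> PP.lim \<rightarrow>\<^sub>M spin_algebra {1..}"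
    using sign_config_measurable[of "{1..}"] by (subst measurable_cong_sets[OF PP.sets_lim refl])
  define \<nu> where "\<nu> = distr PP.lim (spin_algebra {1..}) (sign_config {1..})"
  have "\<nu> \<in> space (prob_algebra (spin_algebra {1..}))"
    unfolding space_prob_algebra \<nu>_def using PP.P.prob_space_distr[OF sign_lim] by simp
  moreover have "measure \<nu> {\<sigma> \<in> spin_configs {1..}. restrict \<sigma> J \<in> D} = c {\<sigma> \<in> spin_configs {1..}. restrict \<sigma> J \<in> D}"
    if J: "finite J" "J \<subseteq> {1..}" and D: "D \<subseteq> spin_configs J" for J D
  proof -
    let ?Z = "{\<sigma> \<in> spin_configs {1..}. restrict \<sigma> J \<in> D}"
    define E where "E = sign_config J -` D \<inter> space (PiM J (\<lambda>_. borel :: real measure))"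
    have E: "E \<in> sets (PiM J (\<lambda>_. borel))"
      unfolding E_def by (rule measurable_sets[OF sign_config_measurable finite_spin_set_measurable[OF J(1) D]])
    have "(\<lambda>\<sigma>. restrict \<sigma> J) \<in> spin_algebra {1..} \<rightarrow>\<^sub>M spin_algebra J"
      using reindex_measurable[of J "\<lambda>k. k" "{1..}"] J(2) by auto
    from measurable_sets[OF this finite_spin_set_measurable[OF J(1) D]]
    have Z: "?Z \<in> sets (spin_algebra {1..})" by (simp add: vimage_def Int_def conj_commute)
    have "emeasure \<nu> ?Z = emeasure PP.lim (sign_config {1..} -` ?Z \<inter> space PP.lim)"
      unfolding \<nu>_def by (rule emeasure_distr[OF sign_lim Z])
    \<comment> \<open>Taking signs commutes with restriction to J, so the preimage of a cylinder is
      again a cylinder.\<close>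
    also have "sign_config {1..} -` ?Z \<inter> space PP.lim = prod_emb {1..} (\<lambda>_. borel) J E"
    proof -
      have "restrict (sign_config {1..} v) J = sign_config J (restrict v J)" for v using J(2) by (auto simp: sign_config_def fun_eq_iff)
      moreover have "sign_config {1..} v \<in> spin_configs {1..}" for v
        unfolding sign_config_def restrict_PiE_iff by simp
      moreover have "space PP.lim = {1..} \<rightarrow>\<^sub>E UNIV" unfolding PP.space_lim space_PiM by simp
      ultimately show ?thesis
        unfolding prod_emb_def E_def by (auto simp: space_PiM)
    qed
    also have "emeasure PP.lim (prod_emb {1..} (\<lambda>_. borel) J E) = emeasure (marginal c J) E"
      by (rule PP.emeasure_lim_emb[OF J(2,1) E])
    also have "\<dots> = ennreal (c {\<sigma> \<in> spin_configs {1..}. restrict \<sigma> J \<in> E})"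
      by (rule emeasure_marginal[OF c J E])
    also have "{\<sigma> \<in> spin_configs {1..}. restrict \<sigma> J \<in> E} = ?Z"
    proof -
      have "sign_config J (restrict \<sigma> J) = restrict \<sigma> J" if "\<sigma> \<in> spin_configs {1..}" for \<sigma>
      proof
        fix j
        have "j \<in> J \<Longrightarrow> \<sigma> j \<in> {-1, 1}" using PiE_mem[OF that] J(2) by blast
        then show "sign_config J (restrict \<sigma> J) j = restrict \<sigma> J j" by (auto simp: sign_config_def)
      qed
      then show ?thesis by (auto simp: E_def space_PiM)
    qed
    finally have "emeasure \<nu> ?Z = ennreal (c ?Z)" .
    moreover have "0 \<le> c ?Z" using c unfolding charges_def by blast
    ultimately show ?thesis by (simp only: measure_def enn2real_ennreal)
  qed
  ultimately show ?thesis by (intro bexI[of _ \<nu>]) simp_all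
qed

lemma topspace_weak_topology: "topspace (weak_topology X M) = space (prob_algebra M)"
proof -
  have "space (prob_algebra M) \<in> {{\<nu> \<in> space (prob_algebra M). (\<integral>x. g x \<partial>\<nu>) \<in> V} | g V.
      continuous_map X euclideanreal g \<and> bounded (g ` topspace X) \<and> open V}"
    by (rule CollectI, rule exI[of _ "\<lambda>_. 0"], rule exI[of _ UNIV]) (auto simp: bounded_def)
  then show ?thesis unfolding weak_topology_def topology_generated_by_topspace by auto
qed

lemma integral_localise:
  assumes \<nu>: "\<nu> \<in> space (prob_algebra (spin_algebra {1..}))"
  shows "(\<integral>\<sigma>. localise n g \<sigma> \<partial>\<nu>) =
    (\<Sum>w\<in>spin_configs {1..n}. g (fill_up {1..n} w) * measure \<nu> {\<sigma> \<in> spin_configs {1..}. restrict \<sigma> {1..n} \<in> {w}})"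
proof -
  interpret prob_space \<nu> by (rule spin_prob_spaceD[OF \<nu>])
  let ?Z = "\<lambda>w. {\<sigma> \<in> spin_configs {1..}. restrict \<sigma> {1..n} \<in> {w}}"
  have Z: "?Z w \<in> events" for w
    using cylinder_measurable[of "{1..n}" "{1..}" w] spin_prob_spaceD(2)[OF \<nu>] by simp
  have "(\<integral>\<sigma>. localise n g \<sigma> \<partial>\<nu>) = (\<integral>\<sigma>. (\<Sum>w\<in>spin_configs {1..n}. g (fill_up {1..n} w) * indicat_real (?Z w) \<sigma>) \<partial>\<nu>)"
  proof (rule Bochner_Integration.integral_cong[OF refl])
    fix \<sigma> assume "\<sigma> \<in> space \<nu>"
    then have \<sigma>: "\<sigma> \<in> spin_configs {1..}" using spin_prob_spaceD(3)[OF \<nu>] by simp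
    have r: "restrict \<sigma> {1..n} \<in> spin_configs {1..n}" by (rule restrict_spin_configs[OF \<sigma>]) auto
    have "(\<Sum>w\<in>spin_configs {1..n}. g (fill_up {1..n} w) * indicat_real (?Z w) \<sigma>) =
        (\<Sum>w\<in>spin_configs {1..n}. if restrict \<sigma> {1..n} = w then g (fill_up {1..n} w) else 0)"
      using \<sigma> by (intro sum.cong) (auto simp: indicator_def)
    also have "\<dots> = g (fill_up {1..n} (restrict \<sigma> {1..n}))"
      using r finite_spin_configs[of "{1..n}"] by (subst sum.delta') auto
    also have "fill_up {1..n} (restrict \<sigma> {1..n}) = fill_up {1..n} \<sigma>" by (auto simp: fill_up_def fun_eq_iff)
    finally show "localise n g \<sigma> = (\<Sum>w\<in>spin_configs {1..n}. g (fill_up {1..n} w) * indicat_real (?Z w) \<sigma>)"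
      by (simp only: localise_def)
  qed
  also have "\<dots> = (\<Sum>w\<in>spin_configs {1..n}. \<integral>\<sigma>. g (fill_up {1..n} w) * indicat_real (?Z w) \<sigma> \<partial>\<nu>)"
    using Z by (intro Bochner_Integration.integral_sum integrable_mult_right) (simp add: emeasure_eq_measure less_top[symmetric])
  also have "\<dots> = (\<Sum>w\<in>spin_configs {1..n}. g (fill_up {1..n} w) * measure \<nu> (?Z w))"
    using Z by (intro sum.cong refl) simp
  finally show ?thesis .
qed

lemma spin_prob_eqI:
  fixes \<mu> \<nu> :: "(nat \<Rightarrow> real) measure"
  assumes \<mu>: "\<mu> \<in> space (prob_algebra (spin_algebra {1..}))" and \<nu>: "\<nu> \<in> space (prob_algebra (spin_algebra {1..}))"
    and eq: "\<And>J D. finite J \<Longrightarrow> J \<subseteq> {1..} \<Longrightarrow> D \<subseteq> spin_configs J \<Longrightarrow>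
      measure \<mu> {\<sigma> \<in> spin_configs {1..}. restrict \<sigma> J \<in> D} = measure \<nu> {\<sigma> \<in> spin_configs {1..}. restrict \<sigma> J \<in> D}"
  shows "\<mu> = \<nu>"
proof (rule measure_eqI_PiM_infinite[where I = "{1..}" and M = "\<lambda>_. count_space {-1, 1}"])
  interpret \<mu>: prob_space \<mu> by (rule spin_prob_spaceD[OF \<mu>])
  interpret \<nu>: prob_space \<nu> by (rule spin_prob_spaceD[OF \<nu>])
  show "sets \<mu> = sets (PiM {1..} (\<lambda>_. count_space {-1, 1}))" "sets \<nu> = sets (PiM {1..} (\<lambda>_. count_space {-1, 1}))"
    using spin_prob_spaceD(2)[OF \<mu>] spin_prob_spaceD(2)[OF \<nu>] by (simp_all add: spin_algebra_def)
  show "finite_measure \<mu>" by (rule \<mu>.finite_measure_axioms)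
  fix A and J :: "nat set" assume J: "finite J" "J \<subseteq> {1..}" and A: "\<And>i. i \<in> J \<Longrightarrow> A i \<in> sets (count_space {-1, 1::real})"
  have "Pi\<^sub>E J A \<subseteq> spin_configs J" using A by (intro PiE_mono) auto
  moreover have "prod_emb {1..} (\<lambda>_. count_space {-1, 1}) J (Pi\<^sub>E J A) = {\<sigma> \<in> spin_configs {1..}. restrict \<sigma> J \<in> Pi\<^sub>E J A}"
    by (auto simp: prod_emb_def)
  ultimately show "emeasure \<mu> (prod_emb {1..} (\<lambda>_. count_space {-1, 1}) J (Pi\<^sub>E J A)) =
      emeasure \<nu> (prod_emb {1..} (\<lambda>_. count_space {-1, 1}) J (Pi\<^sub>E J A))"
    using eq[OF J, of "Pi\<^sub>E J A"] by (simp only: \<mu>.emeasure_eq_measure \<nu>.emeasure_eq_measure)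
qed

text \<open>The space is the image of the compact set of charges under the map \<kappa> that sends a
  charge to a measure with the same cylinder values. Integrals of continuous functions against
  \<kappa> c are uniform limits of finite combinations of coordinates of c, so \<kappa> is
  continuous; it is onto because the charge of a probability measure is sent back to it.\<close>

lemma compact_space_weak_topology: "compact_space (weak_topology \<Omega> (spin_algebra {1..}))"
proof -
  let ?P = "space (prob_algebra (spin_algebra {1::nat..}))"
  define good where "good c \<nu> \<longleftrightarrow> \<nu> \<in> ?P \<and> (\<forall>J D. finite J \<longrightarrow> J \<subseteq> {1..} \<longrightarrow> D \<subseteq> spin_configs J \<longrightarrow>
      measure \<nu> {\<sigma> \<in> spin_configs {1..}. restrict \<sigma> J \<in> D} = c {\<sigma> \<in> spin_configs {1..}. restrict \<sigma> J \<in> D})"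
    for c :: "(nat \<Rightarrow> real) set \<Rightarrow> real" and \<nu>
  define \<kappa> where "\<kappa> c = (SOME \<nu>. good c \<nu>)" for c
  have good: "good c (\<kappa> c)" if c: "c \<in> charges" for c
  proof -
    have "\<exists>\<nu>. good c \<nu>" using charge_extension[OF c] unfolding good_def Bex_def .
    then show ?thesis unfolding \<kappa>_def by (rule someI_ex)
  qed
  have \<kappa>: "\<kappa> c \<in> ?P" if "c \<in> charges" for c using good[OF that] by (simp add: good_def)
  have \<kappa>_cyl: "measure (\<kappa> c) {\<sigma> \<in> spin_configs {1..}. restrict \<sigma> J \<in> D} = c {\<sigma> \<in> spin_configs {1..}. restrict \<sigma> J \<in> D}"
    if "c \<in> charges" "finite J" "J \<subseteq> {1..}" "D \<subseteq> spin_configs J" for c J D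
    using good[OF that(1)] that(2-) unfolding good_def by blast
  have cont: "continuous_on charges (\<lambda>c. \<integral>\<sigma>. g \<sigma> \<partial>\<kappa> c)" if g: "continuous_map \<Omega> euclideanreal g" for g
  proof -
    have "\<exists>n. \<forall>\<sigma>\<in>spin_configs {1..}. \<bar>g \<sigma> - localise n g \<sigma>\<bar> \<le> 1 / real (Suc k)" for k
      using localise_approx[OF g, of "1 / real (Suc k)"] by (metis of_nat_0_less_iff zero_less_Suc zero_less_divide_1_iff)
    then obtain n where n: "\<And>k \<sigma>. \<sigma> \<in> spin_configs {1..} \<Longrightarrow> \<bar>g \<sigma> - localise (n k) g \<sigma>\<bar> \<le> 1 / real (Suc k)"
      by metis
    define h where "h k c = (\<Sum>w\<in>spin_configs {1..n k}. g (fill_up {1..n k} w) *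
        c {\<sigma> \<in> spin_configs {1..}. restrict \<sigma> {1..n k} \<in> {w}})" for k and c :: "(nat \<Rightarrow> real) set \<Rightarrow> real"
    have h: "h k c = (\<integral>\<sigma>. localise (n k) g \<sigma> \<partial>\<kappa> c)" if c: "c \<in> charges" for k c
      unfolding h_def integral_localise[OF \<kappa>[OF c]]
      by (intro sum.cong refl arg_cong2[where f = "(*)"] \<kappa>_cyl[OF c, symmetric]) auto
    have "continuous_on charges (h k)" for k
      unfolding h_def by (intro continuous_intros continuous_on_product_coordinates[THEN continuous_on_subset] subset_UNIV)
    moreover have "uniform_limit charges h (\<lambda>c. \<integral>\<sigma>. g \<sigma> \<partial>\<kappa> c) sequentially"
    proof (rule uniform_limitI)
      fix e :: real assume e: "e > 0"
      have "(\<lambda>k. 1 / real (Suc k)) \<longlonglongrightarrow> 0" by (rule LIMSEQ_Suc[OF lim_const_over_n])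
      then have "\<forall>\<^sub>F k in sequentially. 1 / real (Suc k) < e" using e by (rule order_tendstoD)
      then show "\<forall>\<^sub>F k in sequentially. \<forall>c\<in>charges. dist (h k c) (\<integral>\<sigma>. g \<sigma> \<partial>\<kappa> c) < e"
      proof eventually_elim
        case (elim k)
        show ?case
        proof
          fix c assume c: "c \<in> charges"
          have "\<bar>(\<integral>\<sigma>. g \<sigma> \<partial>\<kappa> c) - h k c\<bar> \<le> 1 / real (Suc k)"
            unfolding h[OF c] by (rule localise_integral_approx[OF \<kappa>[OF c] g n])
          then show "dist (h k c) (\<integral>\<sigma>. g \<sigma> \<partial>\<kappa> c) < e" using elim by (simp add: dist_real_def abs_minus_commute)
        qed
      qed
    qed
    ultimately show ?thesis by (intro uniform_limit_theorem[of _ h]) auto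
  qed
  have "continuous_map (top_of_set charges) (weak_topology \<Omega> (spin_algebra {1..})) \<kappa>"
    unfolding weak_topology_def
  proof (rule continuous_on_generated_topo)
    fix W assume "W \<in> {{\<nu> \<in> ?P. (\<integral>x. g x \<partial>\<nu>) \<in> V} | g V.
        continuous_map \<Omega> euclideanreal g \<and> bounded (g ` topspace \<Omega>) \<and> open V}"
    then obtain g V where W: "W = {\<nu> \<in> ?P. (\<integral>x. g x \<partial>\<nu>) \<in> V}" "continuous_map \<Omega> euclideanreal g" "open V" by blast
    have "\<kappa> -` W \<inter> topspace (top_of_set charges) = charges \<inter> (\<lambda>c. \<integral>\<sigma>. g \<sigma> \<partial>\<kappa> c) -` V"
      using \<kappa> by (auto simp: W(1))
    then show "openin (top_of_set charges) (\<kappa> -` W \<inter> topspace (top_of_set charges))"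
      using continuous_openin_preimage_gen[OF cont[OF W(2)] W(3)] by simp
  next
    show "\<kappa> ` topspace (top_of_set charges) \<subseteq> \<Union>{{\<nu> \<in> ?P. (\<integral>x. g x \<partial>\<nu>) \<in> V} | g V.
        continuous_map \<Omega> euclideanreal g \<and> bounded (g ` topspace \<Omega>) \<and> open V}"
      using \<kappa> topspace_weak_topology[of \<Omega> "spin_algebra {1..}"]
      unfolding weak_topology_def topology_generated_by_topspace by auto
  qed
  then have "compactin (weak_topology \<Omega> (spin_algebra {1..})) (\<kappa> ` charges)"
    using compact_charges by (intro image_compactin[of "top_of_set charges"]) (auto simp: compactin_subtopology compactin_euclidean_iff)
  moreover have "\<kappa> ` charges = ?P"
  proof
    show "\<kappa> ` charges \<subseteq> ?P" using \<kappa> by blast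
    show "?P \<subseteq> \<kappa> ` charges"
    proof
      fix \<nu> assume \<nu>: "\<nu> \<in> ?P"
      interpret prob_space \<nu> by (rule spin_prob_spaceD[OF \<nu>])
      \<comment> \<open>Off the \<sigma>-algebra \<open>measure\<close> is 0, so the values lie in
        [0, 1] on all sets.\<close>
      have c: "measure \<nu> \<in> charges"
        unfolding charges_def using spin_prob_spaceD(2,3)[OF \<nu>] prob_space
        by (auto simp: finite_measure_Union)
      have "\<kappa> (measure \<nu>) = \<nu>" using \<kappa>[OF c] \<nu> \<kappa>_cyl[OF c] by (rule spin_prob_eqI)
      then show "\<nu> \<in> \<kappa> ` charges" using c by (metis imageI)
    qed
  qed
  ultimately show ?thesis by (simp add: compact_space_def topspace_weak_topology)
qed

subsection \<open>The large deviation principles\<close>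

text \<open>Removes the slack \<eta>: a real number a strictly between the lower limit and - c would
  contradict the bound for \<eta> = - c - a.\<close>

lemma liminf_ereal_ln_ge:
  assumes "\<And>\<eta>. \<eta> > 0 \<Longrightarrow> \<forall>\<^sub>F N in sequentially. exp (- real N * (c + \<eta>)) \<le> p N"
  shows "- ereal c \<le> liminf (\<lambda>N. ereal (1 / real N) * ereal_ln (p N))"
proof -
  have "- ereal (c + \<eta>) \<le> liminf (\<lambda>N. ereal (1 / real N) * ereal_ln (p N))" if "\<eta> > 0" for \<eta>
  proof (rule Liminf_bounded)
    show "\<forall>\<^sub>F N in sequentially. - ereal (c + \<eta>) \<le> ereal (1 / real N) * ereal_ln (p N)"
      using assms[OF that] eventually_ge_at_top[of 1]
    proof eventually_elim
      case (elim N)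
      have "exp (real N * (- (c + \<eta>))) \<le> p N" using elim(1) by (simp only: mult_minus_left mult_minus_right)
      from scaled_ereal_ln_ge[OF this elim(2)] show ?case by simp
    qed
  qed
  note le = this
  show ?thesis
  proof (rule ccontr)
    assume "\<not> - ereal c \<le> liminf (\<lambda>N. ereal (1 / real N) * ereal_ln (p N))"
    then have "liminf (\<lambda>N. ereal (1 / real N) * ereal_ln (p N)) < ereal (- c)" by simp
    then obtain a where a: "liminf (\<lambda>N. ereal (1 / real N) * ereal_ln (p N)) < ereal a" "ereal a < ereal (- c)"
      using ereal_dense2 by blast
    then have "- ereal (c + (- c - a)) \<le> liminf (\<lambda>N. ereal (1 / real N) * ereal_ln (p N))" by (intro le) simp
    then show False using a(1) by simp
  qed
qed

text \<open>The common frame of both principles. The lower bound is used only at points of finite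
  rate c, where the formula for the rate says that \<Phi> a x - p a \<le> c for every a; points of
  infinite rate contribute nothing.\<close>

lemma large_deviation_principleI:
  fixes Y :: "nat \<Rightarrow> 'a \<Rightarrow> 'x" and \<Phi> :: "'i \<Rightarrow> 'x \<Rightarrow> real"
  assumes M: "prob_space M"
    and K: "compactin X K" "\<And>N \<omega>. N \<ge> 1 \<Longrightarrow> \<omega> \<in> space M \<Longrightarrow> Y N \<omega> \<in> K"
    and meas: "\<And>N G. N \<ge> 1 \<Longrightarrow> openin X G \<Longrightarrow> {\<omega> \<in> space M. Y N \<omega> \<in> G} \<in> sets M"
    and cont: "\<And>a. a \<in> A \<Longrightarrow> continuous_map X euclideanreal (\<Phi> a)"
    and int: "\<And>a N. a \<in> A \<Longrightarrow> N \<ge> 1 \<Longrightarrow> integrable M (\<lambda>\<omega>. exp (real N * \<Phi> a (Y N \<omega>)))"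
    and lim: "\<And>a. a \<in> A \<Longrightarrow>
        (\<lambda>N. (1 / real N) * ln (\<integral>\<omega>. exp (real N * \<Phi> a (Y N \<omega>)) \<partial>M)) \<longlonglongrightarrow> p a"
    and I: "\<And>x. x \<in> topspace X \<Longrightarrow> I x = (SUP a\<in>A. ereal (\<Phi> a x - p a))"
    and z: "z \<in> A" "\<And>x. x \<in> topspace X \<Longrightarrow> \<Phi> z x - p z \<ge> 0"
    and lower: "\<And>G x c \<eta>. openin X G \<Longrightarrow> x \<in> G \<Longrightarrow> (\<And>a. a \<in> A \<Longrightarrow> \<Phi> a x - p a \<le> c) \<Longrightarrow> \<eta> > 0 \<Longrightarrow>
        \<forall>\<^sub>F N in sequentially. exp (- real N * (c + \<eta>)) \<le> measure M {\<omega> \<in> space M. Y N \<omega> \<in> G}"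
  shows "large_deviation_principle M Y X I"
  unfolding large_deviation_principle_def
proof (intro conjI allI impI)
  show rate: "rate_function X I" by (rule rate_function_SUP[OF cont I z])
  show "Y N \<in> space M \<rightarrow> topspace X" if "N \<ge> 1" for N
    using K(2)[OF that] compactin_subset_topspace[OF K(1)] by blast
  show "{\<omega> \<in> space M. Y N \<omega> \<in> G} \<in> sets M" if "N \<ge> 1" "openin X G" for N G by (rule meas[OF that])
  show "limsup (\<lambda>N. ereal (1 / real N) * ereal_ln (measure M {\<omega> \<in> space M. Y N \<omega> \<in> F})) \<le> - (INF x\<in>F. I x)"
    if "closedin X F" for F
    by (rule ldp_upper_bound[OF M K meas cont int lim I that])
  show "- (INF x\<in>G. I x) \<le> liminf (\<lambda>N. ereal (1 / real N) * ereal_ln (measure M {\<omega> \<in> space M. Y N \<omega> \<in> G}))"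
    if G: "openin X G" for G
  proof -
    let ?L = "liminf (\<lambda>N. ereal (1 / real N) * ereal_ln (measure M {\<omega> \<in> space M. Y N \<omega> \<in> G}))"
    have "- ?L \<le> I x" if x: "x \<in> G" for x
    proof (cases "I x = \<infinity>")
      case False
      have xX: "x \<in> topspace X" using x openin_subset[OF G] by blast
      have "0 \<le> I x" using rate xX by (simp add: rate_function_def)
      then obtain c where c: "I x = ereal c" using False by (cases "I x") auto
      have "\<Phi> a x - p a \<le> c" if "a \<in> A" for a
      proof -
        have "ereal (\<Phi> a x - p a) \<le> ereal c" unfolding c[symmetric] I[OF xX] using that by (rule SUP_upper)
        then show ?thesis by simp
      qed
      then have "- ereal c \<le> ?L" by (intro liminf_ereal_ln_ge lower[OF G x])
      then show ?thesis unfolding c using ereal_uminus_le_reorder by blast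
    qed simp
    then have "- ?L \<le> (INF x\<in>G. I x)" by (rule INF_greatest)
    then show ?thesis using ereal_uminus_le_reorder by blast
  qed
qed

text \<open>The topology is generated by continuous test functions, while the lower bound is
  available for local ones. Intersections and unions preserve the property, and a continuous test
  function is replaced by a truncation.\<close>

lemma openin_weak_topology_nbhd:
  assumes G: "openin (weak_topology \<Omega> (spin_algebra {1..})) G" and "\<rho> \<in> G"
  obtains F \<delta> where "finite F" "\<And>f. f \<in> F \<Longrightarrow> local_function f" "\<delta> > 0"
    "{\<nu> \<in> space (prob_algebra (spin_algebra {1..})). \<forall>f\<in>F. \<bar>(\<integral>\<sigma>. f \<sigma> \<partial>\<nu>) - (\<integral>\<sigma>. f \<sigma> \<partial>\<rho>)\<bar> < \<delta>} \<subseteq> G"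
proof -
  let ?P = "space (prob_algebra (spin_algebra {1::nat..}))"
  let ?N = "\<lambda>F \<delta>. {\<nu> \<in> ?P. \<forall>f\<in>F. \<bar>(\<integral>\<sigma>. f \<sigma> \<partial>\<nu>) - (\<integral>\<sigma>. f \<sigma> \<partial>\<rho>)\<bar> < \<delta>}"
  let ?good = "\<lambda>G. \<rho> \<in> G \<longrightarrow> (\<exists>F \<delta>. finite F \<and> (\<forall>f\<in>F. local_function f) \<and> \<delta> > 0 \<and> ?N F \<delta> \<subseteq> G)"
  have "generate_topology_on {{\<nu> \<in> ?P. (\<integral>x. g x \<partial>\<nu>) \<in> V} | g V.
        continuous_map \<Omega> euclideanreal g \<and> bounded (g ` topspace \<Omega>) \<and> open V} G"
    using G unfolding weak_topology_def by (rule openin_topology_generated_by)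
  then have "?good G"
  proof induction
    case Empty
    then show ?case by simp
  next
    case (Int a b)
    show ?case
    proof
      assume "\<rho> \<in> a \<inter> b"
      then have "\<rho> \<in> a" "\<rho> \<in> b" by auto
      obtain F1 \<delta>1 where 1: "finite F1" "\<forall>f\<in>F1. local_function f" "\<delta>1 > 0" "?N F1 \<delta>1 \<subseteq> a"
        using Int.IH(1)[rule_format, OF \<open>\<rho> \<in> a\<close>] by (elim exE conjE)
      obtain F2 \<delta>2 where 2: "finite F2" "\<forall>f\<in>F2. local_function f" "\<delta>2 > 0" "?N F2 \<delta>2 \<subseteq> b"
        using Int.IH(2)[rule_format, OF \<open>\<rho> \<in> b\<close>] by (elim exE conjE)
      have "?N (F1 \<union> F2) (min \<delta>1 \<delta>2) \<subseteq> ?N F1 \<delta>1 \<inter> ?N F2 \<delta>2" by auto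
      then have "?N (F1 \<union> F2) (min \<delta>1 \<delta>2) \<subseteq> a \<inter> b" using 1(4) 2(4) by blast
      then show "\<exists>F \<delta>. finite F \<and> (\<forall>f\<in>F. local_function f) \<and> \<delta> > 0 \<and> ?N F \<delta> \<subseteq> a \<inter> b"
        using 1 2 by (intro exI[of _ "F1 \<union> F2"] exI[of _ "min \<delta>1 \<delta>2"]) auto
    qed
  next
    case (UN K)
    show ?case
    proof
      assume "\<rho> \<in> \<Union>K"
      then obtain k where k: "k \<in> K" "\<rho> \<in> k" by blast
      obtain F \<delta> where F: "finite F" "\<forall>f\<in>F. local_function f" "\<delta> > 0" "?N F \<delta> \<subseteq> k"
        using UN.IH[OF k(1), rule_format, OF k(2)] by (elim exE conjE)
      then have "?N F \<delta> \<subseteq> \<Union>K" using k(1) by blast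
      then show "\<exists>F \<delta>. finite F \<and> (\<forall>f\<in>F. local_function f) \<and> \<delta> > 0 \<and> ?N F \<delta> \<subseteq> \<Union>K"
        using F(1-3) by (intro exI conjI)
    qed
  next
    case (Basis s)
    then obtain g V where s: "s = {\<nu> \<in> ?P. (\<integral>x. g x \<partial>\<nu>) \<in> V}" "continuous_map \<Omega> euclideanreal g" "open V" by blast
    show ?case
    proof
      assume "\<rho> \<in> s"
      then have \<rho>: "\<rho> \<in> ?P" "(\<integral>x. g x \<partial>\<rho>) \<in> V" unfolding s(1) by auto
      then obtain e where e: "e > 0" "ball (\<integral>x. g x \<partial>\<rho>) e \<subseteq> V" using s(3) open_contains_ball by blast
      \<comment> \<open>One e / 3 for each replacement of g, at \<nu> and at \<rho>, and one for the
        neighbourhood itself.\<close>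
      obtain n where n: "\<And>\<sigma>. \<sigma> \<in> spin_configs {1..} \<Longrightarrow> \<bar>g \<sigma> - localise n g \<sigma>\<bar> \<le> e / 3"
        using localise_approx[OF s(2), of "e / 3"] e(1) by auto
      have "?N {localise n g} (e / 3) \<subseteq> s"
      proof
        fix \<nu> assume "\<nu> \<in> ?N {localise n g} (e / 3)"
        then have \<nu>: "\<nu> \<in> ?P" "\<bar>(\<integral>\<sigma>. localise n g \<sigma> \<partial>\<nu>) - (\<integral>\<sigma>. localise n g \<sigma> \<partial>\<rho>)\<bar> < e / 3" by auto
        have "\<bar>(\<integral>\<sigma>. g \<sigma> \<partial>\<nu>) - (\<integral>\<sigma>. localise n g \<sigma> \<partial>\<nu>)\<bar> \<le> e / 3"
          by (rule localise_integral_approx[OF \<nu>(1) s(2) n])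
        moreover have "\<bar>(\<integral>\<sigma>. g \<sigma> \<partial>\<rho>) - (\<integral>\<sigma>. localise n g \<sigma> \<partial>\<rho>)\<bar> \<le> e / 3"
          by (rule localise_integral_approx[OF \<rho>(1) s(2) n])
        ultimately have "\<bar>(\<integral>\<sigma>. g \<sigma> \<partial>\<rho>) - (\<integral>\<sigma>. g \<sigma> \<partial>\<nu>)\<bar> < e" using \<nu>(2) by linarith
        then have "(\<integral>\<sigma>. g \<sigma> \<partial>\<nu>) \<in> ball (\<integral>x. g x \<partial>\<rho>) e" by (simp add: dist_real_def)
        then show "\<nu> \<in> s" unfolding s(1) using \<nu>(1) e(2) by blast
      qed
      then show "\<exists>F \<delta>. finite F \<and> (\<forall>f\<in>F. local_function f) \<and> \<delta> > 0 \<and> ?N F \<delta> \<subseteq> s"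
        using e(1) local_function_localise by (intro exI[of _ "{localise n g}"] exI[of _ "e / 3"]) auto
    qed
  qed
  then obtain F \<delta> where "finite F" "\<forall>f\<in>F. local_function f" "\<delta> > 0" "?N F \<delta> \<subseteq> G" using assms(2) by blast
  then show ?thesis using that[of F \<delta>] by simp
qed

lemma continuous_map_integral_local:
  assumes "local_function f"
  shows "continuous_map (weak_topology \<Omega> (spin_algebra {1..})) euclideanreal (\<lambda>\<nu>. \<integral>\<sigma>. f \<sigma> \<partial>\<nu>)"
proof -
  obtain K where K: "finite K" "K \<subseteq> {1..}" "depends_on K f" using assms unfolding local_function_iff by blast
  have f: "continuous_map \<Omega> euclideanreal f" by (rule depends_on_continuous[OF K(3,1,2)])
  have b: "bounded (f ` topspace \<Omega>)"
    using depends_on_finite_image[OF K(3,1,2)] by (simp add: finite_imp_bounded)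
  show ?thesis
    unfolding continuous_map_def
  proof (intro conjI allI impI)
    fix V :: "real set" assume "openin euclideanreal V"
    then have "openin (weak_topology \<Omega> (spin_algebra {1..})) {\<nu> \<in> space (prob_algebra (spin_algebra {1..})). (\<integral>\<sigma>. f \<sigma> \<partial>\<nu>) \<in> V}"
      unfolding weak_topology_def using f b by (intro topology_generated_by_Basis) auto
    then show "openin (weak_topology \<Omega> (spin_algebra {1..}))
        {\<nu> \<in> topspace (weak_topology \<Omega> (spin_algebra {1..})). (\<integral>\<sigma>. f \<sigma> \<partial>\<nu>) \<in> V}"
      by (simp only: topspace_weak_topology)
  qed simp
qed

section \<open>Empirical measures\<close>

lemma
  assumes N: "N \<ge> 1" and \<sigma>: "\<sigma> \<in> spin_configs {1..}"
  shows empirical_measure_prob: "empirical_measure N \<sigma> \<in> space (prob_algebra (spin_algebra {1..}))"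
    and integral_empirical_measure: "g \<in> borel_measurable (spin_algebra {1..}) \<Longrightarrow>
      (\<integral>\<tau>. g \<tau> \<partial>empirical_measure N \<sigma>) = (1 / real N) * (\<Sum>i=1..N. g (mult_shift i \<sigma>))"
proof -
  let ?A = "spin_algebra {1::nat..}"
  have T: "mult_shift i \<sigma> \<in> spin_configs {1..}" if "i \<in> {1..N}" for i
    using that by (intro mult_shift_spin_configs \<sigma>) simp
  \<comment> \<open>As an image of the uniform law on 1, ..., N this is visibly a probability
    measure whose integrals are averages. It remains to compare it with the set function in
    \<open>empirical_measure\<close> on measurable sets.\<close>
  define \<kappa> where "\<kappa> = distr (uniform_count_measure {1..N}) ?A (\<lambda>i. mult_shift i \<sigma>)"
  have m: "(\<lambda>i. mult_shift i \<sigma>) \<in> uniform_count_measure {1..N} \<rightarrow>\<^sub>M ?A"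
    using T by (intro measurableI) (auto simp: space_uniform_count_measure sets_uniform_count_measure)
  have eq: "(\<Sum>i=1..N. emeasure (return ?A (mult_shift i \<sigma>)) B) / of_nat N = emeasure \<kappa> B" if B: "B \<in> sets ?A" for B
  proof -
    let ?I = "{i \<in> {1..N}. mult_shift i \<sigma> \<in> B}"
    have "(\<Sum>i=1..N. emeasure (return ?A (mult_shift i \<sigma>)) B) = (\<Sum>i=1..N. if mult_shift i \<sigma> \<in> B then 1 else 0)"
      using B by (intro sum.cong) (auto simp: emeasure_return indicator_def)
    also have "\<dots> = of_nat (card ?I)" by (simp add: sum.If_cases Int_def)
    finally have "(\<Sum>i=1..N. emeasure (return ?A (mult_shift i \<sigma>)) B) / of_nat N = ennreal (real (card ?I) / real N)"
      using N by (simp add: divide_ennreal[symmetric] ennreal_of_nat_eq_real_of_nat)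
    moreover have "emeasure \<kappa> B = emeasure (uniform_count_measure {1..N}) ?I"
      unfolding \<kappa>_def emeasure_distr[OF m B]
      by (intro arg_cong[where f = "emeasure (uniform_count_measure {1..N})"]) (auto simp: space_uniform_count_measure)
    moreover have "\<dots> = ennreal (real (card ?I) / real N)"
      by (subst emeasure_uniform_count_measure) auto
    ultimately show ?thesis by simp
  qed
  have "empirical_measure N \<sigma> = measure_of (space \<kappa>) (sets \<kappa>) (emeasure \<kappa>)"
    unfolding empirical_measure_def
  proof -
    have sp: "space \<kappa> = spin_configs {1..}" "sets \<kappa> = sets ?A" by (simp_all add: \<kappa>_def)
    show "measure_of (spin_configs {1..}) (sets ?A) (\<lambda>B. (\<Sum>i=1..N. emeasure (return ?A (mult_shift i \<sigma>)) B) / of_nat N) =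
        measure_of (space \<kappa>) (sets \<kappa>) (emeasure \<kappa>)"
      unfolding sp
    proof (rule measure_of_eq)
      show "sets ?A \<subseteq> Pow (spin_configs {1..})" using sets.space_closed[of ?A] by simp
      fix B assume "B \<in> sigma_sets (spin_configs {1..}) (sets ?A)"
      then have "B \<in> sets ?A" using sets.sigma_sets_eq[of ?A] by simp
      then show "(\<Sum>i=1..N. emeasure (return ?A (mult_shift i \<sigma>)) B) / of_nat N = emeasure \<kappa> B" by (rule eq)
    qed
  qed
  then have emp: "empirical_measure N \<sigma> = \<kappa>" by (simp only: measure_of_of_measure)
  have "prob_space \<kappa>"
    unfolding \<kappa>_def using N by (intro prob_space.prob_space_distr[OF prob_space_uniform_count_measure m]) auto
  then show "empirical_measure N \<sigma> \<in> space (prob_algebra ?A)"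
    unfolding emp space_prob_algebra by (simp add: \<kappa>_def)
  assume g: "g \<in> borel_measurable ?A"
  show "(\<integral>\<tau>. g \<tau> \<partial>empirical_measure N \<sigma>) = (1 / real N) * (\<Sum>i=1..N. g (mult_shift i \<sigma>))"
    unfolding emp \<kappa>_def integral_distr[OF m g] by (subst integral_uniform_count_measure) simp_all
qed

lemma continuous_map_mult_shift:
  assumes "1 \<le> i" shows "continuous_map \<Omega> \<Omega> (mult_shift i)"
  unfolding spin_topology_def
proof (subst continuous_map_componentwise, intro conjI ballI)
  show "mult_shift i ` topspace (product_topology (\<lambda>_. discrete_topology {- 1, 1}) {1..}) \<subseteq> extensional {1..}"
    by (auto simp: mult_shift_def)
  fix k :: nat assume k: "k \<in> {1..}"
  then have "i * k \<in> {1..}" using assms by simp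
  from continuous_map_product_projection[OF this, of "\<lambda>_. discrete_topology {- 1, 1}"] k
  show "continuous_map (product_topology (\<lambda>_. discrete_topology {- 1, 1}) {1..}) (discrete_topology {- 1, 1}) (\<lambda>\<sigma>. mult_shift i \<sigma> k)"
    by (simp add: mult_shift_def)
qed

text \<open>The source of measurability: weakly open sets pull back to open sets of configurations,
  which are measurable by \<open>openin_spin_topology_sets\<close>.\<close>

lemma continuous_map_empirical_measure:
  assumes N: "N \<ge> 1"
  shows "continuous_map \<Omega> (weak_topology \<Omega> (spin_algebra {1..})) (empirical_measure N)"
  unfolding weak_topology_def
proof (rule continuous_on_generated_topo)
  let ?S = "{{\<nu> \<in> space (prob_algebra (spin_algebra {1..})). (\<integral>x. g x \<partial>\<nu>) \<in> V} | g V.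
        continuous_map \<Omega> euclideanreal g \<and> bounded (g ` topspace \<Omega>) \<and> open V}"
  show "empirical_measure N ` topspace \<Omega> \<subseteq> \<Union>?S"
    using empirical_measure_prob[OF N] topspace_weak_topology[of \<Omega> "spin_algebra {1..}"]
    unfolding weak_topology_def topology_generated_by_topspace by auto
  fix W assume "W \<in> ?S"
  then obtain g V where W: "W = {\<nu> \<in> space (prob_algebra (spin_algebra {1..})). (\<integral>x. g x \<partial>\<nu>) \<in> V}"
    "continuous_map \<Omega> euclideanreal g" "open V" by blast
  have "continuous_map \<Omega> euclideanreal (\<lambda>\<sigma>. (1 / real N) * (\<Sum>i=1..N. g (mult_shift i \<sigma>)))"
  proof (intro continuous_map_real_mult continuous_map_sum)
    fix i assume "i \<in> {1..N}"
    then show "continuous_map \<Omega> euclideanreal (\<lambda>\<sigma>. g (mult_shift i \<sigma>))"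
      using continuous_map_compose[OF continuous_map_mult_shift W(2), of i] by (simp add: comp_def)
  qed auto
  then have "openin \<Omega> {\<sigma> \<in> topspace \<Omega>. (1 / real N) * (\<Sum>i=1..N. g (mult_shift i \<sigma>)) \<in> V}"
    using W(3) by (intro openin_continuous_map_preimage) auto
  also have "{\<sigma> \<in> topspace \<Omega>. (1 / real N) * (\<Sum>i=1..N. g (mult_shift i \<sigma>)) \<in> V} = empirical_measure N -` W \<inter> topspace \<Omega>"
    using empirical_measure_prob[OF N] integral_empirical_measure[OF N _ continuous_map_spin_measurable[OF W(2)]]
    by (auto simp: W(1))
  finally show "openin \<Omega> (empirical_measure N -` W \<inter> topspace \<Omega>)" .
qed

section \<open>Application to the Gibbs measure\<close>

context layer_unique_gibbs
begin

text \<open>Each application chooses its own primes; finitely many local functions are served by one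
  Q, taken from the union of their coordinate sets.\<close>

lemma extend_primes:
  assumes "finite K" "K \<subseteq> {1..}"
  obtains Q where "layer_unique_gibbs_primes U \<A> J \<mu> Q" "K \<subseteq> smooth_numbers Q"
proof (rule that)
  let ?Q = "P \<union> (\<Union>k\<in>K. prime_factors k)"
  show "layer_unique_gibbs_primes U \<A> J \<mu> ?Q"
  proof
    show "finite ?Q" using assms(1) finite_base_primes by simp
    show "prime p" if "p \<in> ?Q" for p using that base_primes_prime by (auto simp: in_prime_factors_iff)
  qed simp
  show "K \<subseteq> smooth_numbers ?Q" using assms(2) by (auto simp: smooth_numbers_def)
qed

lemma log_moment_limit:
  assumes "local_function f"
  shows "convergent (log_moment \<mu> f)" "log_moment \<mu> f \<longlonglongrightarrow> mult_pressure \<mu> f"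
proof -
  obtain K where K: "finite K" "K \<subseteq> {1..}" "depends_on K f" using assms unfolding local_function_iff by blast
  obtain Q where Q: "layer_unique_gibbs_primes U \<A> J \<mu> Q" "K \<subseteq> smooth_numbers Q" by (rule extend_primes[OF K(1,2)])
  show "convergent (log_moment \<mu> f)"
    by (rule layer_unique_gibbs_primes.log_moment_convergent[OF Q(1) K(3,1) Q(2)])
  then show "log_moment \<mu> f \<longlonglongrightarrow> mult_pressure \<mu> f"
    by (simp add: mult_pressure_def convergent_LIMSEQ_iff)
qed

lemma mult_pressure_zero: "mult_pressure \<mu> (\<lambda>_. 0) = 0"
proof -
  have "log_moment \<mu> (\<lambda>_. 0) = (\<lambda>_. 0)" by (simp add: log_moment_def fun_eq_iff prob_space)
  then show ?thesis by (simp add: mult_pressure_def)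
qed

text \<open>An instance of \<open>ldp_lower_bound\<close>: the cumulant of the averages is the
  logarithmic moment of a linear combination of the f j, and moving one parameter adds a multiple of
  one f j, so \<open>log_moment_second_order\<close> applies with \<open>smooth_count Q N\<close> as
  variance proxy.\<close>

lemma local_averages_lower_bound:
  fixes f :: "nat \<Rightarrow> (nat \<Rightarrow> real) \<Rightarrow> real"
  assumes f: "\<And>j. j < m \<Longrightarrow> local_function (f j)"
    and rate: "\<And>t. (\<Sum>j<m. t j * x j) - mult_pressure \<mu> (\<lambda>\<sigma>. \<Sum>j<m. t j * f j \<sigma>) \<le> c"
    and "\<delta> > 0" "\<eta> > 0"
  shows "\<forall>\<^sub>F N in sequentially. exp (- real N * (c + \<eta>)) \<le>
    prob {\<sigma> \<in> space \<mu>. \<forall>j<m. \<bar>(1 / real N) * (\<Sum>i=1..N. f j (mult_shift i \<sigma>)) - x j\<bar> < \<delta>}"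
proof -
  have "\<exists>K. finite K \<and> K \<subseteq> {1..} \<and> depends_on K (f j)" if "j < m" for j
    using f[OF that] unfolding local_function_iff .
  then obtain K where K: "\<And>j. j < m \<Longrightarrow> finite (K j)" "\<And>j. j < m \<Longrightarrow> K j \<subseteq> {1..}" "\<And>j. j < m \<Longrightarrow> depends_on (K j) (f j)"
    by metis
  define L where "L = (\<Union>j<m. K j)"
  have L: "finite L" "L \<subseteq> {1..}" using K(1,2) by (auto simp: L_def)
  have fL: "depends_on L (f j)" if "j < m" for j
    using that by (intro depends_on_mono[OF K(3)]) (auto simp: L_def)
  obtain Q where Q: "layer_unique_gibbs_primes U \<A> J \<mu> Q" "L \<subseteq> smooth_numbers Q" by (rule extend_primes[OF L])
  interpret Q: layer_unique_gibbs_primes U \<A> J \<mu> Q by (rule Q(1))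
  have "\<exists>M. \<forall>\<sigma>\<in>spin_configs {1..}. \<bar>f j \<sigma>\<bar> \<le> M \<and> M > 0" if "j < m" for j
    by (rule depends_on_bounded[OF fL[OF that] L]) blast
  then obtain M where M: "\<And>j \<sigma>. j < m \<Longrightarrow> \<sigma> \<in> spin_configs {1..} \<Longrightarrow> \<bar>f j \<sigma>\<bar> \<le> M j" by metis
  \<comment> \<open>One bound for all the functions; the summand 1 keeps it positive also for m =
    0.\<close>
  define B where "B = 1 + (\<Sum>j<m. \<bar>M j\<bar>)"
  have B0: "B > 0" by (simp add: B_def add_pos_nonneg sum_nonneg)
  have B: "\<bar>f j \<sigma>\<bar> \<le> B" if "j < m" "\<sigma> \<in> spin_configs {1..}" for j \<sigma>
    using M[OF that] member_le_sum[of j "{..<m}" "\<lambda>j. \<bar>M j\<bar>"] that(1) by (simp add: B_def)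
  define X where "X N j \<sigma> = (1 / real N) * (\<Sum>i=1..N. f j (mult_shift i \<sigma>))" for N j \<sigma>
  interpret S: bounded_statistics \<mu> X m B
  proof
    show "X N j \<in> borel_measurable \<mu>" if "j < m" for N j
      unfolding X_def[abs_def]
      by (intro borel_measurable_times borel_measurable_const borel_measurable_sum Q.measurable_mu
          measurable_compose[OF mult_shift_measurable depends_on_measurable[OF fL[OF that] L]]) simp
    show "\<bar>X N j \<sigma>\<bar> \<le> B" if "j < m" "\<sigma> \<in> space \<mu>" for N j \<sigma>
    proof (cases "N = 0")
      case True
      then show ?thesis using B0 by (simp add: X_def)
    next
      case False
      have \<sigma>: "\<sigma> \<in> spin_configs {1..}" using that(2) Q.space_mu by simp
      have "\<bar>\<Sum>i=1..N. f j (mult_shift i \<sigma>)\<bar> \<le> (\<Sum>i=1..N. \<bar>f j (mult_shift i \<sigma>)\<bar>)" by (rule sum_abs)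
      also have "\<dots> \<le> (\<Sum>i=1..N. B)"
        by (intro sum_mono B[OF that(1)] mult_shift_spin_configs \<sigma>) simp
      finally show ?thesis using False by (simp add: X_def abs_mult divide_le_eq mult.commute)
    qed
  qed (rule B0)
  have cumulant: "S.cumulant N t = log_moment \<mu> (\<lambda>\<sigma>. \<Sum>j<m. t j * f j \<sigma>) N" for N t
  proof (cases "N = 0")
    case True
    then show ?thesis by (simp add: S.cumulant_def log_moment_def)
  next
    case False
    have "real N * S.combination N t \<sigma> = (\<Sum>i=1..N. \<Sum>j<m. t j * f j (mult_shift i \<sigma>))" for \<sigma>
    proof -
      have "real N * S.combination N t \<sigma> = (\<Sum>j<m. t j * (\<Sum>i=1..N. f j (mult_shift i \<sigma>)))"
        unfolding S.combination_def sum_distrib_left using False by (intro sum.cong) (auto simp: X_def sum_distrib_left)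
      also have "\<dots> = (\<Sum>i=1..N. \<Sum>j<m. t j * f j (mult_shift i \<sigma>))"
        unfolding sum_distrib_left by (rule sum.swap)
      finally show ?thesis .
    qed
    then show ?thesis by (simp add: S.cumulant_def log_moment_def)
  qed
  have combL: "depends_on L (\<lambda>\<sigma>. \<Sum>j<m. t j * f j \<sigma>)" for t
    using fL by (intro depends_on_sum) simp
  have "\<forall>\<^sub>F N in sequentially. exp (- real N * (c + \<eta>)) \<le> prob {\<sigma> \<in> space \<mu>. \<forall>j<m. \<bar>X N j \<sigma> - x j\<bar> < \<delta>}"
  proof (rule S.ldp_lower_bound[where S = "\<lambda>N. real (smooth_count Q N)" and p = "\<lambda>t. mult_pressure \<mu> (\<lambda>\<sigma>. \<Sum>j<m. t j * f j \<sigma>)"])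
    show "(\<lambda>N. S.cumulant N t) \<longlonglongrightarrow> mult_pressure \<mu> (\<lambda>\<sigma>. \<Sum>j<m. t j * f j \<sigma>)" for t
      unfolding cumulant using combL L local_function_iff by (intro log_moment_limit(2)) blast
    show "\<exists>d. \<forall>s. \<bar>s\<bar> * (B * real (smooth_count Q N)) \<le> 1 \<longrightarrow>
        S.cumulant N (t(j := t j + s)) - S.cumulant N t \<le> s * d + s\<^sup>2 * (B\<^sup>2 * real (smooth_count Q N))"
      if "N \<ge> 1" "j < m" for N t j
    proof -
      have "(\<Sum>i<m. (t(j := t j + s)) i * f i \<sigma>) = (\<Sum>i<m. t i * f i \<sigma>) + s * f j \<sigma>" for s \<sigma>
      proof -
        have "(\<Sum>i<m. (t(j := t j + s)) i * f i \<sigma>) = (\<Sum>i<m. t i * f i \<sigma> + (if i = j then s * f j \<sigma> else 0))"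
          by (intro sum.cong) (auto simp: distrib_right)
        then show ?thesis using that(2) by (simp add: sum.distrib)
      qed
      then show ?thesis
        unfolding cumulant
        using Q.log_moment_second_order[OF combL fL[OF that(2)] L(1) Q(2) B[OF that(2)] B0 that(1)] by simp
    qed
    show "real (smooth_count Q N) \<ge> 1" if "N \<ge> 1" for N using smooth_count_pos[OF that, of Q] by simp
    show "(\<lambda>N. real (smooth_count Q N) / real N) \<longlonglongrightarrow> 0" by (rule smooth_count_density_zero[OF Q.Q(1,2)])
  qed (use rate assms(3,4) in auto)
  then show ?thesis by (simp only: X_def)
qed

lemma exp_average_integrable:
  assumes "local_function f"
  shows "integrable \<mu> (\<lambda>\<sigma>. exp (\<Sum>i=1..N. f (mult_shift i \<sigma>)))"
proof -
  obtain K where K: "finite K" "K \<subseteq> {1..}" "depends_on K f" using assms unfolding local_function_iff by blast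
  obtain M where M: "M > 0" "\<And>\<sigma>. \<sigma> \<in> spin_configs {1..} \<Longrightarrow> \<bar>f \<sigma>\<bar> \<le> M" by (rule depends_on_bounded[OF K(3,1,2)]) blast
  note \<mu> = gibbs_measureD[OF gibbs]
  have "(\<lambda>\<sigma>. f (mult_shift i \<sigma>)) \<in> borel_measurable \<mu>" if "i \<in> {1..N}" for i
    using that measurable_compose[OF mult_shift_measurable depends_on_measurable[OF K(3,1,2)], of i]
    by (subst measurable_cong_sets[OF \<mu>(2) refl]) simp
  then have meas: "(\<lambda>\<sigma>. \<Sum>i=1..N. f (mult_shift i \<sigma>)) \<in> borel_measurable \<mu>" by (intro borel_measurable_sum)
  show ?thesis
  proof (rule integrable_const_bound[of _ "exp (real N * M)"])
    have "(\<Sum>i=1..N. f (mult_shift i \<sigma>)) \<le> real N * M" if "\<sigma> \<in> space \<mu>" for \<sigma>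
    proof -
      have "(\<Sum>i=1..N. f (mult_shift i \<sigma>)) \<le> (\<Sum>i=1..N. M)"
      proof (rule sum_mono)
        fix i assume "i \<in> {1..N}"
        then have "mult_shift i \<sigma> \<in> spin_configs {1..}" using that \<mu>(3) by (intro mult_shift_spin_configs) auto
        then show "f (mult_shift i \<sigma>) \<le> M" using M(2) abs_le_D1 by blast
      qed
      then show ?thesis by simp
    qed
    then show "AE \<sigma> in \<mu>. norm (exp (\<Sum>i=1..N. f (mult_shift i \<sigma>))) \<le> exp (real N * M)"
      by (intro AE_I2) simp
    show "(\<lambda>\<sigma>. exp (\<Sum>i=1..N. f (mult_shift i \<sigma>))) \<in> borel_measurable \<mu>" using meas by measurable
  qed
qed

lemma average_ldp:
  assumes f: "local_function f"
  shows "large_deviation_principle \<mu> (\<lambda>N \<sigma>. (1 / real N) * (\<Sum>i=1..N. f (mult_shift i \<sigma>)))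
    euclideanreal (rate_average \<mu> f)"
proof -
  note \<mu> = gibbs_measureD[OF gibbs]
  obtain K where K: "finite K" "K \<subseteq> {1..}" "depends_on K f" using f unfolding local_function_iff by blast
  obtain M where M: "M > 0" "\<And>\<sigma>. \<sigma> \<in> spin_configs {1..} \<Longrightarrow> \<bar>f \<sigma>\<bar> \<le> M" by (rule depends_on_bounded[OF K(3,1,2)]) blast
  let ?Y = "\<lambda>N \<sigma>. (1 / real N) * (\<Sum>i=1..N. f (mult_shift i \<sigma>))"
  have local_scale: "local_function (\<lambda>\<sigma>. t * f \<sigma>)" for t
    using f unfolding local_function_def by metis
  have scale: "real N * (t * ?Y N \<sigma>) = (\<Sum>i=1..N. t * f (mult_shift i \<sigma>))" if "N \<ge> 1" for N t \<sigma>
    using that by (simp add: sum_distrib_left)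
  show ?thesis
  proof (rule large_deviation_principleI[where K = "{- M..M}" and A = UNIV and \<Phi> = "\<lambda>t x. t * x"
        and p = "\<lambda>t. mult_pressure \<mu> (\<lambda>\<sigma>. t * f \<sigma>)" and z = 0])
    show "prob_space \<mu>" by (rule \<mu>)
    show "compactin euclideanreal {- M..M}" by (simp add: compactin_euclidean_iff)
    show "?Y N \<sigma> \<in> {- M..M}" if N: "N \<ge> 1" and \<sigma>: "\<sigma> \<in> space \<mu>" for N \<sigma>
    proof -
      have "\<bar>\<Sum>i=1..N. f (mult_shift i \<sigma>)\<bar> \<le> (\<Sum>i=1..N. \<bar>f (mult_shift i \<sigma>)\<bar>)" by (rule sum_abs)
      also have "\<dots> \<le> (\<Sum>i=1..N. M)"
        using \<sigma> \<mu>(3) by (intro sum_mono M(2) mult_shift_spin_configs) auto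
      finally have "\<bar>?Y N \<sigma>\<bar> \<le> M" using N by (simp add: abs_mult divide_le_eq mult.commute)
      then show ?thesis unfolding atLeastAtMost_iff by linarith
    qed
    show "{\<sigma> \<in> space \<mu>. ?Y N \<sigma> \<in> G} \<in> events" if "N \<ge> 1" "openin euclideanreal G" for N G
    proof -
      have "(\<lambda>\<sigma>. f (mult_shift i \<sigma>)) \<in> borel_measurable \<mu>" if "i \<in> {1..N}" for i
        using that measurable_compose[OF mult_shift_measurable depends_on_measurable[OF K(3,1,2)], of i]
        by (subst measurable_cong_sets[OF \<mu>(2) refl]) simp
      then have "?Y N \<in> borel_measurable \<mu>" by (intro borel_measurable_times borel_measurable_sum borel_measurable_const)
      then have "?Y N -` G \<inter> space \<mu> \<in> events" using that(2) by (intro measurable_sets[of _ _ borel]) auto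
      moreover have "?Y N -` G \<inter> space \<mu> = {\<sigma> \<in> space \<mu>. ?Y N \<sigma> \<in> G}" by auto
      ultimately show ?thesis by (simp only:)
    qed
    show "continuous_map euclideanreal euclideanreal ((*) t)" for t :: real
      by (simp add: continuous_intros)
    show "integrable \<mu> (\<lambda>\<sigma>. exp (real N * (t * ?Y N \<sigma>)))" if "N \<ge> 1" for t N
      unfolding scale[OF that] by (rule exp_average_integrable[OF local_scale])
    show "(\<lambda>N. (1 / real N) * ln (expectation (\<lambda>\<sigma>. exp (real N * (t * ?Y N \<sigma>))))) \<longlonglongrightarrow> mult_pressure \<mu> (\<lambda>\<sigma>. t * f \<sigma>)" for t
    proof (rule Lim_transform_eventually[OF log_moment_limit(2)[OF local_scale]])
      show "\<forall>\<^sub>F N in sequentially. log_moment \<mu> (\<lambda>\<sigma>. t * f \<sigma>) N =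
          (1 / real N) * ln (expectation (\<lambda>\<sigma>. exp (real N * (t * ?Y N \<sigma>))))"
        using eventually_ge_at_top[of 1] by eventually_elim (simp only: scale log_moment_def)
    qed
    show "0 \<le> 0 * x - mult_pressure \<mu> (\<lambda>\<sigma>. 0 * f \<sigma>)" for x :: real by (simp add: mult_pressure_zero)
    show "rate_average \<mu> f x = (SUP t. ereal (t * x - mult_pressure \<mu> (\<lambda>\<sigma>. t * f \<sigma>)))" for x
      by (simp add: rate_average_def)
    fix G :: "real set" and x c \<eta> :: real
    assume G: "openin euclideanreal G" "x \<in> G" and c: "\<And>t. t \<in> UNIV \<Longrightarrow> t * x - mult_pressure \<mu> (\<lambda>\<sigma>. t * f \<sigma>) \<le> c" and \<eta>: "\<eta> > 0"
    have "open G" using G(1) by simp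
    then obtain \<delta> where \<delta>: "\<delta> > 0" "ball x \<delta> \<subseteq> G" using G(2) unfolding open_contains_ball by blast
    \<comment> \<open>The line needs a single statistic: with m = 1 the bound c on the rate is used
      at the parameter \<open>t 0\<close>.\<close>
    have "\<forall>\<^sub>F N in sequentially. exp (- real N * (c + \<eta>)) \<le> prob {\<sigma> \<in> space \<mu>. \<forall>j<1::nat. \<bar>?Y N \<sigma> - x\<bar> < \<delta>}"
      using c f \<delta>(1) \<eta> by (intro local_averages_lower_bound[where f = "\<lambda>_. f" and x = "\<lambda>_. x"]) auto
    then show "\<forall>\<^sub>F N in sequentially. exp (- real N * (c + \<eta>)) \<le> prob {\<sigma> \<in> space \<mu>. ?Y N \<sigma> \<in> G}"
      using eventually_ge_at_top[of 1]
    proof eventually_elim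
      case (elim N)
      have "prob {\<sigma> \<in> space \<mu>. \<forall>j<1::nat. \<bar>?Y N \<sigma> - x\<bar> < \<delta>} \<le> prob {\<sigma> \<in> space \<mu>. ?Y N \<sigma> \<in> G}"
      proof (rule finite_measure_mono)
        show "{\<sigma> \<in> space \<mu>. \<forall>j<1::nat. \<bar>?Y N \<sigma> - x\<bar> < \<delta>} \<subseteq> {\<sigma> \<in> space \<mu>. ?Y N \<sigma> \<in> G}"
          using \<delta>(2) by (auto simp: subset_iff dist_real_def abs_minus_commute)
      qed (use \<open>\<And>G N. 1 \<le> N \<Longrightarrow> openin euclideanreal G \<Longrightarrow> {\<sigma> \<in> space \<mu>. ?Y N \<sigma> \<in> G} \<in> events\<close> G elim(2) in blast)
      then show ?case using elim(1) by linarith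
    qed
  qed simp_all
qed

lemma empirical_measure_ldp:
  "large_deviation_principle \<mu> empirical_measure (weak_topology \<Omega> (spin_algebra {1..})) (rate_empirical \<mu>)"
proof -
  note \<mu> = gibbs_measureD[OF gibbs]
  let ?W = "weak_topology \<Omega> (spin_algebra {1..})"
  have scale: "real N * (\<integral>\<tau>. f \<tau> \<partial>empirical_measure N \<sigma>) = (\<Sum>i=1..N. f (mult_shift i \<sigma>))"
    if f: "local_function f" and N: "N \<ge> 1" and \<sigma>: "\<sigma> \<in> space \<mu>" for f N \<sigma>
  proof -
    obtain K where K: "finite K" "K \<subseteq> {1..}" "depends_on K f" using f unfolding local_function_iff by blast
    have "\<sigma> \<in> spin_configs {1..}" using \<sigma> \<mu>(3) by simp
    from integral_empirical_measure[OF N this depends_on_measurable[OF K(3,1,2)]] N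
    show ?thesis by simp
  qed
  have meas: "{\<sigma> \<in> space \<mu>. empirical_measure N \<sigma> \<in> G} \<in> events" if "N \<ge> 1" "openin ?W G" for N G
  proof -
    have "{\<sigma> \<in> topspace \<Omega>. empirical_measure N \<sigma> \<in> G} \<in> sets (spin_algebra {1..})"
      by (rule openin_spin_topology_sets[OF openin_continuous_map_preimage[OF continuous_map_empirical_measure[OF that(1)] that(2)]])
    then show ?thesis using \<mu>(2,3) by simp
  qed
  show ?thesis
  proof (rule large_deviation_principleI[where K = "topspace ?W" and A = "{f. local_function f}"
        and \<Phi> = "\<lambda>f \<nu>. \<integral>\<sigma>. f \<sigma> \<partial>\<nu>" and p = "mult_pressure \<mu>" and z = "\<lambda>_. 0"])
    show "prob_space \<mu>" by (rule \<mu>)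
    show "compactin ?W (topspace ?W)" using compact_space_weak_topology by (simp add: compact_space_def)
    show "empirical_measure N \<sigma> \<in> topspace ?W" if "N \<ge> 1" "\<sigma> \<in> space \<mu>" for N \<sigma>
      unfolding topspace_weak_topology using that \<mu>(3) by (intro empirical_measure_prob) auto
    show "{\<sigma> \<in> space \<mu>. empirical_measure N \<sigma> \<in> G} \<in> events" if "N \<ge> 1" "openin ?W G" for N G
      by (rule meas[OF that])
    show "continuous_map ?W euclideanreal (\<lambda>\<nu>. \<integral>\<sigma>. f \<sigma> \<partial>\<nu>)" if "f \<in> {f. local_function f}" for f
      using that by (intro continuous_map_integral_local) simp
    show "integrable \<mu> (\<lambda>\<sigma>. exp (real N * (\<integral>\<tau>. f \<tau> \<partial>empirical_measure N \<sigma>)))"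
      if "f \<in> {f. local_function f}" "N \<ge> 1" for f N
      using that exp_average_integrable[of f N] scale[of f N] by (subst Bochner_Integration.integrable_cong[OF refl]) auto
    show "(\<lambda>N. (1 / real N) * ln (expectation (\<lambda>\<sigma>. exp (real N * (\<integral>\<tau>. f \<tau> \<partial>empirical_measure N \<sigma>))))) \<longlonglongrightarrow> mult_pressure \<mu> f"
      if f: "f \<in> {f. local_function f}" for f
    proof (rule Lim_transform_eventually[OF log_moment_limit(2)])
      show "local_function f" using f by simp
      show "\<forall>\<^sub>F N in sequentially. log_moment \<mu> f N =
          (1 / real N) * ln (expectation (\<lambda>\<sigma>. exp (real N * (\<integral>\<tau>. f \<tau> \<partial>empirical_measure N \<sigma>))))"
        using eventually_ge_at_top[of 1]
      proof eventually_elim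
        case (elim N)
        have "expectation (\<lambda>\<sigma>. exp (\<Sum>i=1..N. f (mult_shift i \<sigma>))) =
            expectation (\<lambda>\<sigma>. exp (real N * (\<integral>\<tau>. f \<tau> \<partial>empirical_measure N \<sigma>)))"
          using f elim by (intro Bochner_Integration.integral_cong refl) (simp add: scale)
        then show ?case by (simp only: log_moment_def)
      qed
    qed
    show "rate_empirical \<mu> \<nu> = (SUP f\<in>{f. local_function f}. ereal ((\<integral>\<sigma>. f \<sigma> \<partial>\<nu>) - mult_pressure \<mu> f))" for \<nu>
      by (simp add: rate_empirical_def)
    show "(\<lambda>_. 0) \<in> {f. local_function f}" by (simp add: local_function_def) blast
    show "0 \<le> (\<integral>\<sigma>. 0 \<partial>\<nu>) - mult_pressure \<mu> (\<lambda>_. 0)" for \<nu> :: "(nat \<Rightarrow> real) measure" by (simp add: mult_pressure_zero)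
    fix G :: "(nat \<Rightarrow> real) measure set" and \<rho> and c \<eta> :: real
    assume G: "openin ?W G" "\<rho> \<in> G" and c: "\<And>f. f \<in> {f. local_function f} \<Longrightarrow> (\<integral>\<sigma>. f \<sigma> \<partial>\<rho>) - mult_pressure \<mu> f \<le> c" and \<eta>: "\<eta> > 0"
    obtain F \<delta> where F: "finite F" "\<And>f. f \<in> F \<Longrightarrow> local_function f" "\<delta> > 0"
      "{\<nu> \<in> space (prob_algebra (spin_algebra {1..})). \<forall>f\<in>F. \<bar>(\<integral>\<sigma>. f \<sigma> \<partial>\<nu>) - (\<integral>\<sigma>. f \<sigma> \<partial>\<rho>)\<bar> < \<delta>} \<subseteq> G"
      by (rule openin_weak_topology_nbhd[OF G]) blast
    have \<rho>: "\<rho> \<in> space (prob_algebra (spin_algebra {1..}))"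
      using openin_subset[OF G(1)] G(2) unfolding topspace_weak_topology by blast
    interpret L: prob_space \<rho> by (rule spin_prob_spaceD[OF \<rho>])
    \<comment> \<open>An enumeration of F, since the joint lower bound speaks of statistics numbered
      from 0.\<close>
    obtain fs where fs: "F = fs ` {..<card F}"
      using ex_bij_betw_nat_finite[OF F(1)] by (metis atLeast0LessThan bij_betw_imp_surj_on)
    have loc: "local_function (fs j)" if "j < card F" for j using F(2) fs that by blast
    have int_fs: "integrable \<rho> (fs j)" if j: "j < card F" for j
    proof -
      obtain K where K: "finite K" "K \<subseteq> {1..}" "depends_on K (fs j)" using loc[OF j] unfolding local_function_iff by blast
      show ?thesis by (rule continuous_integrable[OF \<rho> depends_on_continuous[OF K(3,1,2)]])
    qed
    have "\<forall>\<^sub>F N in sequentially. exp (- real N * (c + \<eta>)) \<le>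
      prob {\<sigma> \<in> space \<mu>. \<forall>j<card F. \<bar>(1 / real N) * (\<Sum>i=1..N. fs j (mult_shift i \<sigma>)) - (\<integral>\<sigma>. fs j \<sigma> \<partial>\<rho>)\<bar> < \<delta>}"
    proof (rule local_averages_lower_bound[OF loc _ F(3) \<eta>])
      fix t :: "nat \<Rightarrow> real"
      let ?f = "\<lambda>\<sigma>. \<Sum>j<card F. t j * fs j \<sigma>"
      have "\<exists>K. finite K \<and> K \<subseteq> {1..} \<and> depends_on K (fs j)" if "j < card F" for j
        using loc[OF that] unfolding local_function_iff .
      then obtain K where K: "\<And>j. j < card F \<Longrightarrow> finite (K j)" "\<And>j. j < card F \<Longrightarrow> K j \<subseteq> {1..}"
        "\<And>j. j < card F \<Longrightarrow> depends_on (K j) (fs j)" by metis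
      have "depends_on (\<Union>j<card F. K j) ?f"
        by (intro depends_on_sum depends_on_mono[OF K(3)]) auto
      moreover have "finite (\<Union>j<card F. K j)" "(\<Union>j<card F. K j) \<subseteq> {1..}" using K(1,2) by auto
      \<comment> \<open>A linear combination of local functions is local, hence one of the functions
        in the supremum that defines the rate. The bound c therefore covers every joint tilt of the
        finitely many statistics.\<close>
      ultimately have "local_function ?f" unfolding local_function_iff by blast
      then have "(\<integral>\<sigma>. ?f \<sigma> \<partial>\<rho>) - mult_pressure \<mu> ?f \<le> c" by (intro c) simp
      moreover have "(\<integral>\<sigma>. ?f \<sigma> \<partial>\<rho>) = (\<Sum>j<card F. t j * (\<integral>\<sigma>. fs j \<sigma> \<partial>\<rho>))"
        using int_fs by (subst Bochner_Integration.integral_sum) auto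
      ultimately show "(\<Sum>j<card F. t j * (\<integral>\<sigma>. fs j \<sigma> \<partial>\<rho>)) - mult_pressure \<mu> ?f \<le> c" by simp
    qed
    then show "\<forall>\<^sub>F N in sequentially. exp (- real N * (c + \<eta>)) \<le> prob {\<sigma> \<in> space \<mu>. empirical_measure N \<sigma> \<in> G}"
      using eventually_ge_at_top[of 1]
    proof eventually_elim
      case (elim N)
      have "prob {\<sigma> \<in> space \<mu>. \<forall>j<card F. \<bar>(1 / real N) * (\<Sum>i=1..N. fs j (mult_shift i \<sigma>)) - (\<integral>\<sigma>. fs j \<sigma> \<partial>\<rho>)\<bar> < \<delta>}
          \<le> prob {\<sigma> \<in> space \<mu>. empirical_measure N \<sigma> \<in> G}"
      proof (rule finite_measure_mono)
        show "{\<sigma> \<in> space \<mu>. \<forall>j<card F. \<bar>(1 / real N) * (\<Sum>i=1..N. fs j (mult_shift i \<sigma>)) - (\<integral>\<sigma>. fs j \<sigma> \<partial>\<rho>)\<bar> < \<delta>}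
            \<subseteq> {\<sigma> \<in> space \<mu>. empirical_measure N \<sigma> \<in> G}"
        proof
          fix \<sigma> assume "\<sigma> \<in> {\<sigma> \<in> space \<mu>. \<forall>j<card F. \<bar>(1 / real N) * (\<Sum>i=1..N. fs j (mult_shift i \<sigma>)) - (\<integral>\<sigma>. fs j \<sigma> \<partial>\<rho>)\<bar> < \<delta>}"
          then have \<sigma>: "\<sigma> \<in> space \<mu>" and close: "\<And>j. j < card F \<Longrightarrow>
              \<bar>(1 / real N) * (\<Sum>i=1..N. fs j (mult_shift i \<sigma>)) - (\<integral>\<sigma>. fs j \<sigma> \<partial>\<rho>)\<bar> < \<delta>" by auto
          have "\<bar>(\<integral>\<tau>. f \<tau> \<partial>empirical_measure N \<sigma>) - (\<integral>\<tau>. f \<tau> \<partial>\<rho>)\<bar> < \<delta>" if "f \<in> F" for f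
          proof -
            obtain j where j: "j < card F" "f = fs j" using fs \<open>f \<in> F\<close> by blast
            have "(\<integral>\<tau>. f \<tau> \<partial>empirical_measure N \<sigma>) = (1 / real N) * (\<Sum>i=1..N. fs j (mult_shift i \<sigma>))"
              using scale[OF loc[OF j(1)] elim(2) \<sigma>] elim(2) unfolding j(2) by (simp add: field_simps)
            then show ?thesis using close[OF j(1)] j(2) by simp
          qed
          moreover have "empirical_measure N \<sigma> \<in> space (prob_algebra (spin_algebra {1..}))"
            using \<sigma> \<mu>(3) elim(2) by (intro empirical_measure_prob) auto
          ultimately show "\<sigma> \<in> {\<sigma> \<in> space \<mu>. empirical_measure N \<sigma> \<in> G}" using F(4) \<sigma> by blast
        qed
      qed (rule meas[OF elim(2) G(1)])
      then show ?case using elim(1) by linarith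
    qed
  qed
qed

end

theorem theorem6p3:
  fixes U :: "nat set \<Rightarrow> (nat \<Rightarrow> real) \<Rightarrow> real"
    and \<A> :: "nat set set"
    and J :: "nat set \<Rightarrow> real"
    and \<mu> :: "(nat \<Rightarrow> real) measure"
  assumes "potential {1..} U"
    and "multiplication_invariant U"
    and "generated_by U \<A> J"
    and "finite (base_primes \<A>)"
    and "card (base_primes \<A>) \<ge> 1"
    and "layer_unique \<A> J"
    and "gibbs_measure {1..} U \<mu>"
  shows "(\<forall>f. local_function f \<longrightarrow>
            convergent (log_moment \<mu> f) \<and>
            large_deviation_principle \<mu>
              (\<lambda>N \<sigma>. (1 / real N) * (\<Sum>i=1..N. f (mult_shift i \<sigma>)))
              euclideanreal (rate_average \<mu> f)) \<and>
         large_deviation_principle \<mu> empirical_measure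
           (weak_topology (spin_topology {1..}) (spin_algebra {1..})) (rate_empirical \<mu>)"
proof -
  interpret multiplicative_potential U \<A> J by unfold_locales (fact assms)+
  interpret prob_space \<mu> by (rule gibbs_measureD(1)[OF assms(7)])
  interpret layer_unique_gibbs U \<A> J \<mu> by unfold_locales (fact assms)+
  show ?thesis using log_moment_limit(1) average_ldp empirical_measure_ldp by blast
qed

end
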